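(* Let $r\geqslant 2$ be an integer and let $\mathcal F$ be the family of binary fewnomials attached to data $(r,(\mathcal E_k))$. Let $C=2^{79}3^{15}$, and let $\lambda,\mu$ be real numbers with $\lambda>2$ and $0<\mu<\frac{\lambda-2}{Cr^{4r}\lambda}$. Let $d_0\geqslant3$ be an integer and assume $\mathcal A^\star(F)\leqslant\exp(\mu d/\log d)$ for all $d\geqslant d_0$ and all $F\in\mathcal F_d$. Then: (a) For all $m\in\mathbb Z\setminus\{-1,0,1\}$ and all $d\geqslant3$ multiple of $r$, the set $\mathcal G_{\geqslant d}(m)$ is finite. Furthermore, for all such $\lambda,\mu,r$ and all $d\geqslant d_0$ multiple of $r$, there is a constant $c_1$ depending only on $(\lambda,\mu,r,d)$ such that $\sharp\,\mathcal G_{\geqslant d}(m)\leqslant c_1|m|^{\lambda/(2d)}$ for every $|m|\geqslant2$. (b) For all such $\lambda,\mu,r$ and all $d\geqslant d_0$ multiple of $r$, there exists $c_2$ depending only on $(\lambda,\mu,r,d)$ such that $\sharp\,\mathcal R_{\geqslant d}(N)\leqslant c_2N^{\lambda/d}$ for all $N\geqslant2$.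
   Context: Binary fewnomials: fix an integer $r\geqslant1$. For every integer $k\geqslant 1$ with $kr\geqslant 3$, let $\mathcal E_k$ be a finite subset of $\mathbb Z^{r+1}$ such that every $\mathbf a=(a_0,\dots,a_r)\in\mathcal E_k$ satisfies $a_0a_r\neq0$ and the polynomial $a_0T^r+\cdots+a_r$ has nonzero discriminant. Put $F_{k,\mathbf a}(X,Y)=a_0X^{kr}+a_1X^{k(r-1)}Y^k+\cdots+a_rY^{kr}$. The attached family is $\mathcal F=\{F_{k,\mathbf a}:k\geqslant3/r,\mathbf a\in\mathcal E_k\}$; $\mathcal F_d$ is the set of its elements of degree $d$. For $F=F_{k,\mathbf a}$, $\mathcal A^\star(F)=\max\{2,|a_0|,\dots,|a_r|\}$. For $m\in\mathbb Z$, $\mathcal G_{\geqslant d}(m)$ is the set of triples $(x,y,F)$ with $F\in\mathcal F$, $\deg F\geqslant d$, $(x,y)\in\mathbb Z^2$, $\max\{|x|,|y|\}\geqslant2$, $F(x,y)=m$; $\mathcal R_{\geqslant d}(N)$ is the set of $m\in\mathbb Z\cap[-N,N]$ with $\mathcal G_{\geqslant d}(m)\neq\emptyset$. *)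

theory Defs
  imports Complex_Main "Subresultants.Resultant_Prelim"
begin

text \<open>
  For \<open>p\<close> of degree \<open>n \<ge> 1\<close> over the integers this is the classical formula
  \<open>Disc p = (-1)^(n(n-1)/2) Res(p, p') / lc p\<close>; the integer division is exact.
\<close>
definition discriminant :: "int poly \<Rightarrow> int" where
  "discriminant p =
     (-1) ^ (degree p * (degree p - 1) div 2) * resultant p (pderiv p) div lead_coeff p"

text \<open>
  A polynomial in \<open>X, Y\<close> over the integers is an element of \<open>\<int>[X][Y]\<close>: the coefficient of
  \<open>X^i Y^j\<close> in \<open>F\<close> is \<open>coeff (coeff F j) i\<close>.
\<close>
definition eval2 :: "int poly poly \<Rightarrow> int \<Rightarrow> int \<Rightarrow> int" where
  "eval2 F x y = poly (poly F [:y:]) x"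

definition total_degree :: "int poly poly \<Rightarrow> nat" where
  "total_degree F = Max (insert 0 {i + j | i j. coeff (coeff F j) i \<noteq> 0})"

text \<open>A vector \<open>(a\<^sub>0, \<dots>, a\<^sub>r)\<close> of integers is a list of length \<open>r + 1\<close>.\<close>

definition coeff_poly :: "nat \<Rightarrow> int list \<Rightarrow> int poly" where
  "coeff_poly r a = (\<Sum>i\<le>r. monom (a ! i) (r - i))"

definition fewnomial :: "nat \<Rightarrow> nat \<Rightarrow> int list \<Rightarrow> int poly poly" where
  "fewnomial r k a = (\<Sum>i\<le>r. monom (monom (a ! i) (k * (r - i))) (k * i))"

text \<open>Values \<open>E k\<close> at indices \<open>k\<close> with \<open>k = 0\<close> or \<open>k * r < 3\<close> are unconstrained and never used.\<close>
definition fewnomial_data :: "nat \<Rightarrow> (nat \<Rightarrow> int list set) \<Rightarrow> bool" where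
  "fewnomial_data r E \<longleftrightarrow>
     (\<forall>k\<ge>1. k * r \<ge> 3 \<longrightarrow>
        finite (E k) \<and>
        (\<forall>a\<in>E k. length a = r + 1 \<and> a ! 0 * a ! r \<noteq> 0 \<and> discriminant (coeff_poly r a) \<noteq> 0))"

definition family :: "nat \<Rightarrow> (nat \<Rightarrow> int list set) \<Rightarrow> int poly poly set" where
  "family r E = {fewnomial r k a | k a. k \<ge> 1 \<and> k * r \<ge> 3 \<and> a \<in> E k}"

definition family_deg :: "nat \<Rightarrow> (nat \<Rightarrow> int list set) \<Rightarrow> nat \<Rightarrow> int poly poly set" where
  "family_deg r E d = {F \<in> family r E. total_degree F = d}"

text \<open>
  \<open>\<A>\<^sup>\<star>(F)\<close> for \<open>F = F\<^bsub>k,a\<^esub>\<close>, as a function of the vector \<open>a\<close> (which \<open>F\<close> determines).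
\<close>
definition Astar :: "int list \<Rightarrow> int" where
  "Astar a = Max (insert 2 (abs ` set a))"

definition Astar_bound :: "nat \<Rightarrow> (nat \<Rightarrow> int list set) \<Rightarrow> real \<Rightarrow> nat \<Rightarrow> bool" where
  "Astar_bound r E mu d0 \<longleftrightarrow>
     (\<forall>d\<ge>d0. \<forall>k a. k \<ge> 1 \<and> k * r \<ge> 3 \<and> a \<in> E k \<and> fewnomial r k a \<in> family_deg r E d \<longrightarrow>
        real_of_int (Astar a) \<le> exp (mu * real d / ln (real d)))"

definition G_ge ::
  "nat \<Rightarrow> (nat \<Rightarrow> int list set) \<Rightarrow> nat \<Rightarrow> int \<Rightarrow> (int \<times> int \<times> int poly poly) set" where
  "G_ge r E d m =
     {(x, y, F). F \<in> family r E \<and> total_degree F \<ge> d \<and> max \<bar>x\<bar> \<bar>y\<bar> \<ge> 2 \<and> eval2 F x y = m}"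

definition R_ge :: "nat \<Rightarrow> (nat \<Rightarrow> int list set) \<Rightarrow> nat \<Rightarrow> real \<Rightarrow> int set" where
  "R_ge r E d N = {m. - N \<le> real_of_int m \<and> real_of_int m \<le> N \<and> G_ge r E d m \<noteq> {}}"

lemma eval2_fewnomial:
  "eval2 (fewnomial r k a) x y = (\<Sum>i\<le>r. a ! i * x ^ (k * (r - i)) * y ^ (k * i))"
  by (simp add: eval2_def fewnomial_def poly_sum poly_monom poly_const_pow mult_ac)

lemma coeff_fewnomial:
  "coeff (coeff (fewnomial r k a) j) n =
     (\<Sum>i\<le>r. if k * i = j \<and> k * (r - i) = n then a ! i else 0)"
  by (auto simp: fewnomial_def coeff_sum intro!: sum.cong)

lemma total_degree_fewnomial:
  assumes "k \<ge> 1" "a ! 0 \<noteq> 0"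
  shows "total_degree (fewnomial r k a) = k * r"
proof -
  let ?S = "{i + j | i j. coeff (coeff (fewnomial r k a) j) i \<noteq> 0}"
  have sub: "s = k * r" if s: "s \<in> ?S" for s
  proof -
    obtain n j where nj: "s = n + j" "coeff (coeff (fewnomial r k a) j) n \<noteq> 0"
      using s by auto
    have "\<exists>i\<le>r. k * i = j \<and> k * (r - i) = n"
    proof (rule ccontr)
      assume "\<not> ?thesis"
      then have "coeff (coeff (fewnomial r k a) j) n = 0"
        unfolding coeff_fewnomial by (intro sum.neutral) auto
      with nj(2) show False ..
    qed
    then obtain i where "i \<le> r" "k * i = j" "k * (r - i) = n"
      by auto
    then have "s = k * (r - i + i)"
      using nj(1) by (simp only: add_mult_distrib2)
    with \<open>i \<le> r\<close> show ?thesis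
      by simp
  qed
  have "coeff (coeff (fewnomial r k a) 0) (k * r) = (\<Sum>i\<le>r. if i = 0 then a ! i else 0)"
    unfolding coeff_fewnomial using assms(1) by (intro sum.cong) auto
  also have "\<dots> = a ! 0"
    by simp
  finally have "k * r \<in> ?S"
    using assms(2) by (intro CollectI exI[of _ "k * r"] exI[of _ 0]) simp
  with sub have "?S = {k * r}"
    by blast
  then show ?thesis
    unfolding total_degree_def by simp
qed

end

theory Submission
  imports Defs "HOL-Computational_Algebra.Fundamental_Theorem_Algebra" "HOL-Library.FuncSet"
begin

text \<open>
  Let \<open>f = a\<^sub>0 T^r + \<dots> + a\<^sub>r\<close>, so that \<open>F(x, y) = y^(kr) f((x/y)^k)\<close>, and write \<open>X = max(|x|, |y|)\<close>.

  For \<open>k\<close> large compared with \<open>log A\<^sup>\<star>(F)\<close> one has \<open>|F(x, y)| \<ge> X^(kr(1 - \<epsilon>))\<close> whenever \<open>F(x, y) \<noteq> 0\<close>.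
  Otherwise \<open>(x/y)^k\<close> is extremely close to a root \<open>\<theta>\<close> of \<open>f\<close>, hence \<open>x/y\<close> is close to 1. Schneider's method
  with the functions \<open>binom(z, i) (x/y)^(jz)\<close> at the integers \<open>z = u + kv\<close> then gives a contradiction; as
  \<open>x/y\<close> is close to 1, the analytic estimates reduce to Newton interpolation.

  For each of the remaining finitely many forms, Thue's theorem bounds \<open>X\<close> by a power of \<open>|F(x, y)|\<close>.
  Points with \<open>X > N^(\<lambda>/(2d))\<close> and \<open>|F(x, y)| \<le> N\<close> approximate a root so well that a gap principle
  applies, and there are only \<open>O(N^(1/d) log N)\<close> of them. The number of coefficient vectors in degree \<open>d\<close>
  is \<open>exp(o(d))\<close> and only degrees \<open>d = O(log N)\<close> occur, so summing over all forms costs \<open>N^(o(1))\<close>.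
\<close>

section \<open>Siegel lemma and Liouville bound\<close>

text \<open>Zero is not a root of \<open>f\<close>, because the last coefficient is nonzero. So a
  value of \<open>f\<close> at \<open>(x/y)^k\<close> of size at most 1/2 forces
  \<open>(x/y)^k >= 1/(4A)\<close>, with \<open>A\<close> a bound for the coefficients, and then
  \<open>1 - x/y\<close> is \<open>O(log A / k)\<close>. This is why \<open>x/y\<close> is close to
  1. The coefficients may grow with the degree, so this step must be uniform in the vector as long
  as \<open>log A\<close> is at most a small multiple of \<open>k\<close>. The Liouville inequality
  used there costs a factor of order \<open>r^2\<close> in the exponent, and this cost fixes the
  ratio of unknowns to conditions in the pigeonhole step. From Thue's theorem the exponent
  \<open>n - 1/10\<close> is enough for degree \<open>n\<close>: any gain over \<open>n\<close>
  bounds the height by a power of the value, hence the number of dyadic intervals by a logarithm.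
  The gap principle works with approximation exponent \<open>n(1 - 2/lambda)\<close>, which has to
  exceed 2. The bound on \<open>mu\<close> enters here: since \<open>Astar\<close> is at least 2, it
  forces this inequality for every degree that occurs.\<close>

text \<open>Dirichlet's box principle. For coefficients in \<open>0..H\<close> each form takes
  values in an interval of length \<open>2*H*M\<close>, which is cut into \<open>B\<close> pieces.
  By \<open>less\<close> there are more coefficient vectors than tuples of pieces, and
  \<open>p\<close> is the difference of two vectors in the same cell.\<close>

lemma small_linear_forms:
  fixes c :: "'n \<Rightarrow> 's \<Rightarrow> real" and M :: real and B H :: nat
  assumes fin: "finite S" "finite I" and M: "M > 0"
    and c: "\<And>n. n \<in> I \<Longrightarrow> (\<Sum>s\<in>S. \<bar>c n s\<bar>) \<le> M"
    and H: "H \<ge> 1" and B: "B \<ge> 1" and less: "B ^ card I < (H + 1) ^ card S"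
  shows "\<exists>p :: 's \<Rightarrow> int. (\<exists>s\<in>S. p s \<noteq> 0) \<and> (\<forall>s. \<bar>p s\<bar> \<le> int H) \<and>
           (\<forall>n\<in>I. \<bar>\<Sum>s\<in>S. real_of_int (p s) * c n s\<bar> \<le> 2 * real H * M / real B)"
proof -
  let ?D = "S \<rightarrow>\<^sub>E {..H}"
  define L where "L q n = (\<Sum>s\<in>S. real (q s) * c n s)" for q :: "'s \<Rightarrow> nat" and n
  define w where "w = 2 * real H * M / real B"
  have w: "w > 0" using M H B by (simp add: w_def)
  \<comment> \<open>The right endpoint of the interval would get index \<open>B\<close>; the
    \<open>min\<close> puts it into the last piece.\<close>
  define \<phi> where "\<phi> q = restrict (\<lambda>n. min (nat \<lfloor>(L q n + real H * M) / w\<rfloor>) (B - 1)) I" for q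
  have bound: "\<bar>L q n\<bar> \<le> real H * M" if "q \<in> ?D" "n \<in> I" for q n
  proof -
    have "\<bar>L q n\<bar> \<le> (\<Sum>s\<in>S. real (q s) * \<bar>c n s\<bar>)"
      unfolding L_def by (rule order_trans[OF sum_abs]) (simp add: abs_mult)
    also have "\<dots> \<le> (\<Sum>s\<in>S. real H * \<bar>c n s\<bar>)"
      using that(1) by (intro sum_mono mult_right_mono) auto
    also have "\<dots> \<le> real H * M"
      using c[OF that(2)] by (simp flip: sum_distrib_left add: mult_left_mono)
    finally show ?thesis .
  qed
  have "\<phi> ` ?D \<subseteq> I \<rightarrow>\<^sub>E {..<B}"
    using B by (auto simp: \<phi>_def)
  moreover have "finite (I \<rightarrow>\<^sub>E {..<B})" using fin by (simp add: finite_PiE)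
  ultimately have "card (\<phi> ` ?D) \<le> card (I \<rightarrow>\<^sub>E {..<B})" by (rule card_mono[rotated])
  also have "\<dots> = B ^ card I" using fin by (simp add: card_PiE)
  also have "\<dots> < card ?D" using less fin by (simp add: card_PiE)
  finally have "\<not> inj_on \<phi> ?D" by (rule pigeonhole)
  then obtain q q' where q: "q \<in> ?D" "q' \<in> ?D" "q \<noteq> q'" "\<phi> q = \<phi> q'"
    by (auto simp: inj_on_def)
  define p where "p s = (if s \<in> S then int (q s) - int (q' s) else 0)" for s
  have "\<exists>s\<in>S. p s \<noteq> 0"
  proof (rule ccontr)
    assume "\<not> ?thesis"
    then have "q s = q' s" if "s \<in> S" for s using that by (auto simp: p_def)
    then have "q = q'" using q(1,2) by (intro PiE_ext) auto
    with q(3) show False ..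
  qed
  moreover have "\<bar>p s\<bar> \<le> int H" for s
  proof (cases "s \<in> S")
    case True
    then have "q s \<le> H" "q' s \<le> H" using q by auto
    then show ?thesis by (auto simp: p_def)
  qed (simp add: p_def)
  moreover have "\<bar>\<Sum>s\<in>S. real_of_int (p s) * c n s\<bar> \<le> w" if n: "n \<in> I" for n
  proof -
    define X X' where "X = (L q n + real H * M) / w" and "X' = (L q' n + real H * M) / w"
    have mins: "min (nat \<lfloor>X\<rfloor>) (B - 1) = min (nat \<lfloor>X'\<rfloor>) (B - 1)"
      using fun_cong[OF q(4), of n] n by (simp add: \<phi>_def X_def X'_def)
    have wB: "w * real B = 2 * real H * M" using B by (simp add: w_def)
    have range: "0 \<le> X" "X \<le> real B" "0 \<le> X'" "X' \<le> real B"
      using bound[OF q(1) n] bound[OF q(2) n] w wB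
      by (auto simp: X_def X'_def field_simps abs_le_iff)
    have "\<bar>X - X'\<bar> \<le> 1"
      using mins range B by (simp add: min_def split: if_splits) linarith+
    moreover have "X - X' = (L q n - L q' n) / w" by (simp add: X_def X'_def diff_divide_distrib add_divide_distrib)
    moreover have "(\<Sum>s\<in>S. real_of_int (p s) * c n s) = L q n - L q' n"
      by (simp add: L_def p_def sum_subtractf algebra_simps)
    ultimately show ?thesis using w by (simp add: abs_le_iff field_simps)
  qed
  ultimately show ?thesis by (auto simp: w_def)
qed

text \<open>With \<open>H = (2M)^h\<close> and \<open>B = (2M)^(h+2)\<close> the pigeonhole bound
  \<open>2*H*M/B\<close> becomes \<open>1/(2M)\<close>, so an integral form below it vanishes. The
  condition \<open>num\<close> says that \<open>h\<close> is at least twice the usual Siegel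
  exponent \<open>card I / (card S - card I)\<close>.\<close>

lemma siegel_lemma:
  fixes c :: "'n \<Rightarrow> 's \<Rightarrow> int" and M h :: nat
  assumes fin: "finite S" "finite I" and M: "M \<ge> 1" and h: "h \<ge> 1"
    and c: "\<And>n. n \<in> I \<Longrightarrow> (\<Sum>s\<in>S. \<bar>c n s\<bar>) \<le> int M"
    and num: "(h + 2) * card I \<le> h * card S" and S: "S \<noteq> {}"
  shows "\<exists>p :: 's \<Rightarrow> int. (\<exists>s\<in>S. p s \<noteq> 0) \<and> (\<forall>s. \<bar>p s\<bar> \<le> (2 * int M) ^ h) \<and>
           (\<forall>n\<in>I. (\<Sum>s\<in>S. p s * c n s) = 0)"
proof -
  define Z where "Z = 2 * M"
  have Z: "Z \<ge> 2" using M by (simp add: Z_def)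
  have "(Z ^ (h + 2)) ^ card I \<le> (Z ^ h) ^ card S"
    using num Z by (simp flip: power_mult add: power_increasing del: power_Suc add_2_eq_Suc')
  also have "\<dots> < (Z ^ h + 1) ^ card S"
    using S fin by (intro power_strict_mono) (auto simp: card_gt_0_iff)
  finally have less: "(Z ^ (h + 2)) ^ card I < (Z ^ h + 1) ^ card S" .
  have cr: "(\<Sum>s\<in>S. \<bar>real_of_int (c n s)\<bar>) \<le> real M" if "n \<in> I" for n
    using c[OF that] by (metis (mono_tags, lifting) of_int_abs of_int_le_iff of_int_of_nat_eq of_int_sum sum.cong)
  obtain p :: "'s \<Rightarrow> int" where p: "\<exists>s\<in>S. p s \<noteq> 0" "\<forall>s. \<bar>p s\<bar> \<le> int (Z ^ h)"
    "\<forall>n\<in>I. \<bar>\<Sum>s\<in>S. real_of_int (p s) * real_of_int (c n s)\<bar> \<le> 2 * real (Z ^ h) * real M / real (Z ^ (h + 2))"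
    using small_linear_forms[of S I "real M" "\<lambda>n s. real_of_int (c n s)", OF fin _ cr _ _ less] M Z
    by (fastforce simp del: of_nat_power)
  have small: "2 * real (Z ^ h) * real M / real (Z ^ (h + 2)) < 1"
    using Z by (simp add: Z_def field_simps power_add power2_eq_square)
  have "(\<Sum>s\<in>S. p s * c n s) = 0" if "n \<in> I" for n
  proof -
    have "real_of_int \<bar>\<Sum>s\<in>S. p s * c n s\<bar> < 1"
      using p(3) that small by fastforce
    then show ?thesis by linarith
  qed
  then show ?thesis using p by (auto simp: Z_def)
qed

lemma poly_of_int_poly_eq_sum:
  fixes z :: "'a :: {comm_ring_1, ring_char_0}"
  assumes "degree p \<le> n"
  shows "poly (of_int_poly p) z = (\<Sum>m\<le>n. of_int (coeff p m) * z ^ m)"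
proof -
  have "poly (of_int_poly p) z = (\<Sum>m\<le>degree p. of_int (coeff p m) * z ^ m)"
    by (simp add: poly_altdef)
  also have "\<dots> = (\<Sum>m\<le>n. of_int (coeff p m) * z ^ m)"
    using assms by (intro sum.mono_neutral_left) (auto simp: coeff_eq_0)
  finally show ?thesis .
qed

text \<open>
  \<open>power_red f m\<close> lists the coordinates of \<open>(lc f \<cdot> \<alpha>)^m\<close> on \<open>1, \<alpha>, \<dots>, \<alpha>^(deg f - 1)\<close>, simultaneously for
  every root \<open>\<alpha>\<close> of the possibly reducible \<open>f\<close>.
\<close>
primrec power_red :: "int poly \<Rightarrow> nat \<Rightarrow> nat \<Rightarrow> int" where
  "power_red f 0 l = (if l = 0 then 1 else 0)"
| "power_red f (Suc m) l =
     (if l = 0 then 0 else lead_coeff f * power_red f m (l - 1)) - power_red f m (degree f - 1) * coeff f l"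

lemma power_red_bound:
  assumes "\<And>i. \<bar>coeff f i\<bar> \<le> A"
  shows "\<bar>power_red f m l\<bar> \<le> (2 * A) ^ m"
proof (induction m arbitrary: l)
  case (Suc m)
  have A: "A \<ge> 0" using assms[of 0] by linarith
  have "\<bar>if l = 0 then 0 else lead_coeff f * power_red f m (l - 1)\<bar> \<le> A * (2 * A) ^ m"
    using assms Suc A by (auto simp: abs_mult intro!: mult_mono)
  moreover have "\<bar>power_red f m (degree f - 1) * coeff f l\<bar> \<le> (2 * A) ^ m * A"
    using assms Suc A by (auto simp: abs_mult intro!: mult_mono)
  ultimately show ?case by (simp add: algebra_simps)
qed simp

lemma power_red:
  fixes \<alpha> :: complex
  assumes root: "poly (of_int_poly f) \<alpha> = 0" and deg: "degree f \<ge> 1"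
  shows "of_int (lead_coeff f) ^ m * \<alpha> ^ m = (\<Sum>l<degree f. of_int (power_red f m l) * \<alpha> ^ l)"
proof (induction m)
  case 0
  have "(\<Sum>l<degree f. of_int (power_red f 0 l) * \<alpha> ^ l) = (\<Sum>l\<in>{0}. of_int (power_red f 0 l) * \<alpha> ^ l)"
    using deg by (intro sum.mono_neutral_right) auto
  then show ?case by simp
next
  case (Suc m)
  obtain n where n: "degree f = Suc n" using deg by (cases "degree f") auto
  have f0: "of_int (lead_coeff f) * \<alpha> ^ Suc n = - (\<Sum>l<Suc n. of_int (coeff f l) * \<alpha> ^ l)"
    using root unfolding poly_altdef using n
    by (simp add: lessThan_Suc_atMost[symmetric] eq_neg_iff_add_eq_0 add_ac del: sum.lessThan_Suc)
       (simp add: add_ac)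
  have "of_int (lead_coeff f) ^ Suc m * \<alpha> ^ Suc m =
     (\<Sum>l<Suc n. of_int (lead_coeff f) * (of_int (power_red f m l) * \<alpha> ^ Suc l))"
  proof -
    have "of_int (lead_coeff f) ^ Suc m * \<alpha> ^ Suc m =
        of_int (lead_coeff f) * \<alpha> * (of_int (lead_coeff f) ^ m * \<alpha> ^ m)"
      by (simp add: mult_ac)
    also have "\<dots> = (\<Sum>l<Suc n. of_int (lead_coeff f) * (of_int (power_red f m l) * \<alpha> ^ Suc l))"
      by (simp only: Suc) (simp only: n sum_distrib_left power_Suc mult_ac)
    finally show ?thesis .
  qed
  also have "\<dots> = (\<Sum>l<n. of_int (lead_coeff f) * (of_int (power_red f m l) * \<alpha> ^ Suc l))
      + of_int (power_red f m n) * (of_int (lead_coeff f) * \<alpha> ^ Suc n)"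
    by simp
  also have "(\<Sum>l<n. of_int (lead_coeff f) * (of_int (power_red f m l) * \<alpha> ^ Suc l)) =
     (\<Sum>l<Suc n. of_int (if l = 0 then 0 else lead_coeff f * power_red f m (l - 1)) * \<alpha> ^ l)"
    by (subst sum.lessThan_Suc_shift) (simp add: mult_ac)
  also have "\<dots> + of_int (power_red f m n) * (of_int (lead_coeff f) * \<alpha> ^ Suc n) =
     (\<Sum>l<Suc n. of_int (power_red f (Suc m) l) * \<alpha> ^ l)"
  proof -
    have "(of_int (power_red f (Suc m) l) :: complex) * \<alpha> ^ l =
        of_int (if l = 0 then 0 else lead_coeff f * power_red f m (l - 1)) * \<alpha> ^ l
        - of_int (power_red f m n) * (of_int (coeff f l) * \<alpha> ^ l)" for l
      unfolding power_red.simps n diff_Suc_1 of_int_diff of_int_mult left_diff_distrib mult.assoc ..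
    then show ?thesis unfolding f0 by (simp only: sum_subtractf sum_distrib_left[symmetric] mult_minus_right) simp
  qed
  finally show ?case using n by simp
qed

text \<open>The sum is used instead of the maximum because it is submultiplicative, which controls
  the powers of \<open>g\<close> in the Liouville bound.\<close>

definition l1_norm :: "int poly \<Rightarrow> int" where
  "l1_norm p = (\<Sum>i\<le>degree p. \<bar>coeff p i\<bar>)"

lemma l1_norm_eq: "degree p \<le> n \<Longrightarrow> l1_norm p = (\<Sum>i\<le>n. \<bar>coeff p i\<bar>)"
  unfolding l1_norm_def by (rule sum.mono_neutral_left) (auto simp: coeff_eq_0)

lemma l1_norm_nonneg: "l1_norm p \<ge> 0"
  by (simp add: l1_norm_def sum_nonneg)

lemma l1_norm_mult: "l1_norm (p * q) \<le> l1_norm p * l1_norm q"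
proof -
  let ?a = "degree p" and ?b = "degree q"
  have "l1_norm (p * q) = (\<Sum>n\<le>?a+?b. \<bar>coeff (p * q) n\<bar>)"
    by (rule l1_norm_eq[OF degree_mult_le])
  also have "\<dots> \<le> (\<Sum>n\<le>?a+?b. \<Sum>i\<le>n. \<bar>coeff p i\<bar> * \<bar>coeff q (n - i)\<bar>)"
    unfolding coeff_mult by (intro sum_mono order_trans[OF sum_abs]) (simp add: abs_mult)
  also have "\<dots> = (\<Sum>(i, j)\<in>{(i, j). i + j \<le> ?a + ?b}. \<bar>coeff p i\<bar> * \<bar>coeff q j\<bar>)"
    using sum.triangle_reindex_eq[of "\<lambda>i j. \<bar>coeff p i\<bar> * \<bar>coeff q j\<bar>" "?a+?b"] by simp
  also have "\<dots> = (\<Sum>(i, j)\<in>{..?a} \<times> {..?b}. \<bar>coeff p i\<bar> * \<bar>coeff q j\<bar>)"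
  proof (rule sum.mono_neutral_right)
    show "finite {(i, j). i + j \<le> ?a + ?b}"
      by (rule finite_subset[of _ "{..?a+?b} \<times> {..?a+?b}"]) auto
  qed (auto intro: le_degree)
  also have "\<dots> = l1_norm p * l1_norm q"
    by (simp add: l1_norm_def sum_product sum.cartesian_product)
  finally show ?thesis .
qed

lemma l1_norm_power: "l1_norm (p ^ n) \<le> l1_norm p ^ n"
proof (induction n)
  case (Suc n)
  have "l1_norm (p ^ Suc n) \<le> l1_norm p * l1_norm (p ^ n)" by (simp add: l1_norm_mult)
  also have "\<dots> \<le> l1_norm p * l1_norm p ^ n" by (intro mult_left_mono Suc l1_norm_nonneg)
  finally show ?case by simp
qed (simp add: l1_norm_def)

text \<open>Since \<open>f\<close> may be reducible, no norm of a number field is used. The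
  \<open>r + 1\<close> powers of the value \<open>g(theta)\<close>, times a power of the leading
  coefficient, have integral coordinates on \<open>r\<close> powers of \<open>theta\<close>.
  Siegel's lemma gives a small integral relation between them; after division by the lowest power
  its nonzero constant term is an integer, which cannot be balanced if \<open>g(theta)\<close> is
  too small.\<close>

lemma liouville_lower_bound:
  fixes f g :: "int poly" and \<theta> :: complex and A B :: int
  assumes root: "poly (of_int_poly f) \<theta> = 0" and deg: "degree f = r" "r \<ge> 1"
    and A: "\<And>i. \<bar>coeff f i\<bar> \<le> A" "A \<ge> 1"
    and g: "degree g \<le> n" "l1_norm g \<le> B" "B \<ge> 1"
    and nz: "poly (of_int_poly g) \<theta> \<noteq> 0"
  shows "1 \<le> norm (poly (of_int_poly g) \<theta>) * (real r *
           (2 * (real r + 1) * real_of_int B ^ r * (2 * real_of_int A) ^ (n * r)) ^ (2 * r))"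
proof -
  define \<gamma> where "\<gamma> = poly (of_int_poly g) \<theta>"
  define e where "e l i = (\<Sum>m\<le>n*r. coeff (g ^ i) m * (lead_coeff f ^ (n*r - m) * power_red f m l))" for l i
  define M where "M = (r + 1) * (nat B ^ r * (2 * nat A) ^ (n * r))"
  have M: "M \<ge> 1" using A g by (simp add: M_def Suc_leI)
  have lc: "\<bar>lead_coeff f\<bar> \<le> A" "lead_coeff f \<noteq> 0" using A deg by auto
  have deg_gi: "degree (g ^ i) \<le> n * r" if "i \<le> r" for i
    using degree_power_le[of g i] that g(1) by (meson le_trans mult_le_mono)
  have e_bound: "\<bar>e l i\<bar> \<le> B ^ r * (2 * A) ^ (n * r)" if i: "i \<le> r" for l i
  proof -
    have "\<bar>e l i\<bar> \<le> (\<Sum>m\<le>n*r. \<bar>coeff (g ^ i) m\<bar> * \<bar>lead_coeff f ^ (n*r - m) * power_red f m l\<bar>)"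
      unfolding e_def by (rule order_trans[OF sum_abs]) (simp add: abs_mult)
    also have "\<dots> \<le> (\<Sum>m\<le>n*r. \<bar>coeff (g ^ i) m\<bar> * (2 * A) ^ (n * r))"
    proof (intro sum_mono mult_left_mono)
      fix m assume m: "m \<in> {..n*r}"
      have "\<bar>lead_coeff f ^ (n*r - m) * power_red f m l\<bar> \<le> (2 * A) ^ (n*r - m) * (2 * A) ^ m"
        unfolding abs_mult power_abs using lc(1) A(2)
        by (intro mult_mono power_mono power_red_bound A(1)) (auto intro: order_trans[of _ A])
      also have "\<dots> = (2 * A) ^ (n * r)" unfolding power_add[symmetric] using m by simp
      finally show "\<bar>lead_coeff f ^ (n*r - m) * power_red f m l\<bar> \<le> (2 * A) ^ (n * r)" .
    qed auto
    also have "\<dots> = l1_norm (g ^ i) * (2 * A) ^ (n * r)"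
      by (simp add: l1_norm_eq[OF deg_gi[OF i]] sum_distrib_right)
    also have "\<dots> \<le> B ^ r * (2 * A) ^ (n * r)"
    proof (intro mult_right_mono)
      have "l1_norm (g ^ i) \<le> l1_norm g ^ i" by (rule l1_norm_power)
      also have "\<dots> \<le> B ^ i" using g by (intro power_mono l1_norm_nonneg)
      also have "\<dots> \<le> B ^ r" using g i by (intro power_increasing) auto
      finally show "l1_norm (g ^ i) \<le> B ^ r" .
    qed (use A in auto)
    finally show ?thesis .
  qed
  have rel: "of_int (lead_coeff f) ^ (n*r) * \<gamma> ^ i = (\<Sum>l<r. of_int (e l i) * \<theta> ^ l)" if i: "i \<le> r" for i
  proof -
    have "\<gamma> ^ i = poly (of_int_poly (g ^ i)) \<theta>" by (simp add: \<gamma>_def of_int_poly_hom.hom_power)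
    also have "\<dots> = (\<Sum>m\<le>n*r. of_int (coeff (g ^ i) m) * \<theta> ^ m)"
      by (rule poly_of_int_poly_eq_sum[OF deg_gi[OF i]])
    finally have "of_int (lead_coeff f) ^ (n*r) * \<gamma> ^ i =
       (\<Sum>m\<le>n*r. of_int (coeff (g ^ i) m) * (of_int (lead_coeff f) ^ (n*r) * \<theta> ^ m))"
      by (simp add: sum_distrib_left mult_ac)
    also have "\<dots> = (\<Sum>m\<le>n*r. of_int (coeff (g ^ i) m) * (of_int (lead_coeff f) ^ (n*r - m) *
        (of_int (lead_coeff f) ^ m * \<theta> ^ m)))"
      by (intro sum.cong refl) (simp add: mult.assoc[symmetric] power_add[symmetric])
    also have "\<dots> = (\<Sum>m\<le>n*r. \<Sum>l<r. of_int (coeff (g ^ i) m * (lead_coeff f ^ (n*r - m) * power_red f m l)) * \<theta> ^ l)"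
      using power_red[OF root] deg by (simp add: sum_distrib_left mult_ac)
    also have "\<dots> = (\<Sum>l<r. of_int (e l i) * \<theta> ^ l)"
      by (subst sum.swap) (simp add: e_def sum_distrib_right)
    finally show ?thesis .
  qed
  \<comment> \<open>For \<open>r + 1\<close> unknowns and \<open>r\<close> equations,
    \<open>h = 2*r\<close> gives equality in the counting condition of
    \<open>siegel_lemma\<close>.\<close>
  have "\<exists>p. (\<exists>i\<in>{..r}. p i \<noteq> 0) \<and> (\<forall>i. \<bar>p i\<bar> \<le> (2 * int M) ^ (2 * r)) \<and>
          (\<forall>l\<in>{..<r}. (\<Sum>i\<le>r. p i * e l i) = 0)"
  proof (rule siegel_lemma)
    fix l
    have "(\<Sum>i\<le>r. \<bar>e l i\<bar>) \<le> (\<Sum>i\<le>r. B ^ r * (2 * A) ^ (n * r))"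
      by (intro sum_mono e_bound) auto
    also have "\<dots> = int M" using A g by (simp add: M_def algebra_simps)
    finally show "(\<Sum>i\<le>r. \<bar>e l i\<bar>) \<le> int M" .
  qed (use M deg in auto)
  then obtain p where p: "\<exists>i\<in>{..r}. p i \<noteq> 0" "\<And>i. \<bar>p i\<bar> \<le> (2 * int M) ^ (2 * r)"
      "\<And>l. l < r \<Longrightarrow> (\<Sum>i\<le>r. p i * e l i) = 0" by auto
  \<comment> \<open>Dividing the relation by the power of index \<open>s\<close> leaves a constant
    term \<open>p s\<close> of absolute value at least 1.\<close>
  define s where "s = (LEAST i. p i \<noteq> 0)"
  from p(1) obtain i0 where i0: "i0 \<le> r" "p i0 \<noteq> 0" by auto
  have s: "s \<le> r" "p s \<noteq> 0"
    using Least_le[of "\<lambda>i. p i \<noteq> 0", OF i0(2)] LeastI[of "\<lambda>i. p i \<noteq> 0", OF i0(2)] i0(1)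
    unfolding s_def by linarith+
  have s0: "p i = 0" if "i < s" for i
    using not_less_Least[of i "\<lambda>i. p i \<noteq> 0"] that unfolding s_def by blast
  have "of_int (lead_coeff f) ^ (n*r) * (\<Sum>i\<le>r. of_int (p i) * \<gamma> ^ i) =
      (\<Sum>i\<le>r. of_int (p i) * (of_int (lead_coeff f) ^ (n*r) * \<gamma> ^ i))"
    by (simp add: sum_distrib_left mult_ac)
  also have "\<dots> = (\<Sum>i\<le>r. \<Sum>l<r. of_int (p i * e l i) * \<theta> ^ l)"
    using rel by (simp add: sum_distrib_left mult_ac)
  also have "\<dots> = (\<Sum>l<r. of_int (\<Sum>i\<le>r. p i * e l i) * \<theta> ^ l)"
    by (subst sum.swap) (simp add: sum_distrib_right)
  also have "\<dots> = 0" using p(3) by simp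
  finally have rel0: "(\<Sum>i\<le>r. of_int (p i) * \<gamma> ^ i) = 0" using lc by simp
  have "(\<Sum>i\<le>r. of_int (p i) * \<gamma> ^ i) = (\<Sum>i\<in>{s..r}. of_int (p i) * \<gamma> ^ i)"
    by (intro sum.mono_neutral_right) (auto simp: s0)
  also have "\<dots> = \<gamma> ^ s * (\<Sum>i\<in>{s..r}. of_int (p i) * \<gamma> ^ (i - s))"
    unfolding sum_distrib_left by (intro sum.cong refl) (simp add: mult.left_commute power_add[symmetric])
  finally have "(\<Sum>i\<in>{s..r}. of_int (p i) * \<gamma> ^ (i - s)) = 0" using rel0 nz by (simp add: \<gamma>_def)
  moreover have "(\<Sum>i\<in>{s..r}. of_int (p i) * \<gamma> ^ (i - s)) = of_int (p s) + (\<Sum>i\<in>{s<..r}. of_int (p i) * \<gamma> ^ (i - s))"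
    using s(1) by (simp add: sum.head)
  ultimately have ps: "of_int (p s) = - (\<Sum>i\<in>{s<..r}. of_int (p i) * \<gamma> ^ (i - s))"
    by (simp add: add_eq_0_iff)
  define C where "C = (2 * real M) ^ (2 * r)"
  have C: "C \<ge> 1" unfolding C_def using M by (intro one_le_power) auto
  have main: "1 \<le> norm \<gamma> * (real r * C)"
  proof (cases "norm \<gamma> \<ge> 1")
    case True
    then have "1 * (1 * 1) \<le> norm \<gamma> * (real r * C)" using C deg by (intro mult_mono) auto
    then show ?thesis by simp
  next
    case False
    have "1 \<le> norm (of_int (p s) :: complex)" using s(2) by simp
    also have "\<dots> \<le> (\<Sum>i\<in>{s<..r}. norm (of_int (p i) * \<gamma> ^ (i - s)))"
      unfolding ps norm_minus_cancel by (rule norm_sum)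
    also have "\<dots> \<le> (\<Sum>i\<in>{s<..r}. C * norm \<gamma>)"
    proof (intro sum_mono)
      fix i assume i: "i \<in> {s<..r}"
      have "real_of_int \<bar>p i\<bar> \<le> real_of_int ((2 * int M) ^ (2 * r))" using p(2) by (subst of_int_le_iff)
      then have "norm (of_int (p i) :: complex) \<le> C" by (simp add: C_def)
      moreover have "norm \<gamma> ^ (i - s) \<le> norm \<gamma> ^ 1" using i False by (intro power_decreasing) auto
      ultimately show "norm (of_int (p i) * \<gamma> ^ (i - s)) \<le> C * norm \<gamma>"
        unfolding norm_mult norm_power using C by (intro mult_mono) auto
    qed
    also have "\<dots> \<le> norm \<gamma> * (real r * C)"
    proof -
      have "real (r - s) * (C * norm \<gamma>) \<le> real r * (C * norm \<gamma>)" using C by (intro mult_right_mono) auto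
      then show ?thesis by (simp add: mult_ac)
    qed
    finally show ?thesis .
  qed
  have "real M = (real r + 1) * real_of_int B ^ r * (2 * real_of_int A) ^ (n * r)"
    using A g by (simp add: M_def algebra_simps)
  then have eq: "2 * (real r + 1) * real_of_int B ^ r * (2 * real_of_int A) ^ (n * r) = 2 * real M"
    by (simp only: mult.assoc)
  show ?thesis using main unfolding eq C_def \<gamma>_def .
qed

section \<open>Powers of rationals near algebraic numbers\<close>

text \<open>
  Shifting \<open>u\<close> by one and eliminating one of the polynomials at a time at most doubles the degrees.
\<close>
lemma zero_estimate:
  fixes P :: "nat \<Rightarrow> complex poly" and \<alpha> \<theta> :: complex
  assumes "finite T" "T \<noteq> {}" "\<And>j. j \<in> T \<Longrightarrow> P j \<noteq> 0" "\<And>j. j \<in> T \<Longrightarrow> degree (P j) \<le> D"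
    and \<alpha>: "\<alpha> \<noteq> 0" "inj (\<lambda>j::nat. \<alpha> ^ j)" and \<theta>: "\<theta> \<noteq> 0" and U: "U \<le> k"
    and zero: "\<And>u v. u < U + card T \<Longrightarrow> v < V \<Longrightarrow>
       (\<Sum>j\<in>T. poly (P j) (of_nat (u + k * v)) * (\<alpha> ^ u * \<theta> ^ v) ^ j) = 0"
  shows "U * V \<le> 2 ^ card T * D"
  using assms(1-4) zero
proof (induction T arbitrary: P D rule: finite_ne_induct)
  case (singleton j)
  let ?h = "\<lambda>(u, v). of_nat (u + k * v) :: complex"
  have sub: "?h ` ({..<U} \<times> {..<V}) \<subseteq> {z. poly (P j) z = 0}"
    using singleton.prems(3) \<alpha> \<theta> by fastforce
  \<comment> \<open>\<open>u < U <= k\<close> makes \<open>u\<close> the residue of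
    \<open>u + k*v\<close> modulo \<open>k\<close>, so the \<open>U*V\<close> points are
    distinct.\<close>
  have inj: "inj_on ?h ({..<U} \<times> {..<V})"
  proof (rule inj_onI, clarify, rule conjI)
    fix u v u' v' assume *: "u < U" "u' < U" "(of_nat (u + k * v) :: complex) = of_nat (u' + k * v')"
    then have eq: "u + k * v = u' + k * v'" by (simp only: of_nat_eq_iff)
    have "u < k" "u' < k" using * U by auto
    then show "u = u'" using arg_cong[OF eq, of "\<lambda>z. z mod k"] by simp
    then show "v = v'" using eq \<open>u < k\<close> by auto
  qed
  have "U * V = card (?h ` ({..<U} \<times> {..<V}))" using inj by (simp add: card_image)
  also have "\<dots> \<le> card {z. poly (P j) z = 0}"
    using singleton.prems(1) by (intro card_mono sub poly_roots_finite) auto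
  also have "\<dots> \<le> degree (P j)" using singleton.prems(1) by (intro card_poly_roots_bound) auto
  also have "\<dots> \<le> D" using singleton.prems(2) by auto
  finally show ?case by simp
next
  case (insert j0 T)
  define S where "S p = pcompose p [:1, 1:]" for p :: "complex poly"
  define Q where "Q j = smult (\<alpha> ^ j0) (S (P j0) * P j) - smult (\<alpha> ^ j) (P j0 * S (P j))" for j
  have S: "poly (S p) z = poly p (z + 1)" "degree (S p) = degree p" "lead_coeff (S p) = lead_coeff p"
    for p z
    using lead_coeff_comp[of "[:1, 1:]" p] by (auto simp: S_def poly_pcompose add.commute)
  \<comment> \<open>The shift \<open>S\<close> keeps leading coefficients, so that of
    \<open>Q j\<close> gets the factor \<open>\<alpha> ^ j0 - \<alpha> ^ j\<close>, which is nonzero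
    because the powers of \<open>\<alpha>\<close> are distinct.\<close>
  have Q0: "Q j \<noteq> 0" if j: "j \<in> T" for j
  proof -
    have ne: "P j \<noteq> 0" "P j0 \<noteq> 0" using insert.prems(1) j by auto
    let ?n = "degree (P j0) + degree (P j)"
    have "coeff (S (P j0) * P j) ?n = lead_coeff (P j0) * lead_coeff (P j)"
         "coeff (P j0 * S (P j)) ?n = lead_coeff (P j0) * lead_coeff (P j)"
      using coeff_mult_degree_sum[of "S (P j0)" "P j"] coeff_mult_degree_sum[of "P j0" "S (P j)"]
      by (simp_all add: S(2,3)) (metis S(2,3))+
    then have "coeff (Q j) ?n = (\<alpha> ^ j0 - \<alpha> ^ j) * (lead_coeff (P j0) * lead_coeff (P j))"
      by (simp add: Q_def algebra_simps)
    moreover have "\<alpha> ^ j0 \<noteq> \<alpha> ^ j" using \<alpha>(2) j insert.hyps by (metis injD)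
    ultimately show ?thesis using ne by auto
  qed
  have "U * V \<le> 2 ^ card T * (2 * D)"
  proof (rule insert.IH[of Q])
    fix j assume j: "j \<in> T"
    have "degree (P j) \<le> D" "degree (P j0) \<le> D" using insert.prems(2) j by auto
    then show "degree (Q j) \<le> 2 * D"
      unfolding Q_def
      by (intro degree_diff_le order_trans[OF degree_smult_le] order_trans[OF degree_mult_le]) (auto simp: S)
  next
    fix u v assume uv: "u < U + card T" "v < V"
    let ?z = "of_nat (u + k * v) :: complex" and ?w = "\<alpha> ^ u * \<theta> ^ v"
    have e1: "(\<Sum>j\<in>insert j0 T. poly (P j) ?z * ?w ^ j) = 0"
      using insert.prems(3)[of u v] uv insert.hyps by simp
    have "(\<Sum>j\<in>insert j0 T. poly (P j) (of_nat (Suc u + k * v)) * (\<alpha> ^ Suc u * \<theta> ^ v) ^ j) = 0"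
      using insert.prems(3)[of "Suc u" v] uv insert.hyps by simp
    also have "(\<Sum>j\<in>insert j0 T. poly (P j) (of_nat (Suc u + k * v)) * (\<alpha> ^ Suc u * \<theta> ^ v) ^ j)
       = (\<Sum>j\<in>insert j0 T. poly (S (P j)) ?z * \<alpha> ^ j * ?w ^ j)"
    proof (intro sum.cong refl)
      fix j
      have "(\<alpha> ^ Suc u * \<theta> ^ v) ^ j = \<alpha> ^ j * ?w ^ j"
        by (simp only: power_mult_distrib power_Suc mult_ac)
      moreover have "of_nat (Suc u + k * v) = ?z + 1" by simp
      ultimately show "poly (P j) (of_nat (Suc u + k * v)) * (\<alpha> ^ Suc u * \<theta> ^ v) ^ j =
          poly (S (P j)) ?z * \<alpha> ^ j * ?w ^ j" by (simp only: S mult.assoc)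
    qed
    finally have e2: "(\<Sum>j\<in>insert j0 T. poly (S (P j)) ?z * \<alpha> ^ j * ?w ^ j) = 0" .
    have "(\<Sum>j\<in>insert j0 T. poly (Q j) ?z * ?w ^ j) =
       \<alpha> ^ j0 * poly (S (P j0)) ?z * (\<Sum>j\<in>insert j0 T. poly (P j) ?z * ?w ^ j)
       - poly (P j0) ?z * (\<Sum>j\<in>insert j0 T. poly (S (P j)) ?z * \<alpha> ^ j * ?w ^ j)"
      unfolding sum_distrib_left sum_subtractf[symmetric]
      by (intro sum.cong refl) (simp only: Q_def poly_diff poly_smult poly_mult algebra_simps)
    also have "\<dots> = 0" unfolding e1 e2 by simp
    finally have "(\<Sum>j\<in>insert j0 T. poly (Q j) ?z * ?w ^ j) = 0" .
    moreover have "Q j0 = 0" by (simp add: Q_def mult.commute)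
    ultimately show "(\<Sum>j\<in>T. poly (Q j) ?z * ?w ^ j) = 0"
      using insert.hyps by simp
  qed (use Q0 in auto)
  then show ?case using insert.hyps by (simp add: mult_ac)
qed

text \<open>Newton's interpolation series of \<open>(z choose i) * w ^ z\<close> at 0, 1, 2 and so
  on. Its coefficients carry powers of \<open>w - 1\<close>, so they decay when \<open>w\<close> is
  close to 1. It comes from expanding \<open>w ^ (z - i)\<close> around 1 and regrouping by
  \<open>choose_mult\<close>.\<close>

lemma newton_expansion:
  fixes w :: real
  shows "real (z choose i) * w ^ z =
    (\<Sum>n\<le>z. real (n choose i) * w ^ i * (w - 1) ^ (n - i) * real (z choose n))"
proof (cases "i \<le> z")
  case False
  then show ?thesis by (simp add: binomial_eq_0)
next
  case True
  have "(\<Sum>n\<le>z. real (n choose i) * w ^ i * (w - 1) ^ (n - i) * real (z choose n)) =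
     (\<Sum>n\<in>{i..z}. real (n choose i) * w ^ i * (w - 1) ^ (n - i) * real (z choose n))"
    by (rule sum.mono_neutral_right) (auto simp: binomial_eq_0)
  also have "\<dots> = (\<Sum>n\<in>{i..z}. real (z choose i) * w ^ i * (real (z - i choose (n - i)) * (w - 1) ^ (n - i)))"
  proof (intro sum.cong refl)
    fix n assume n: "n \<in> {i..z}"
    have "real ((z choose n) * (n choose i)) = real ((z choose i) * (z - i choose (n - i)))"
      using n by (subst choose_mult) auto
    then show "real (n choose i) * w ^ i * (w - 1) ^ (n - i) * real (z choose n) =
        real (z choose i) * w ^ i * (real (z - i choose (n - i)) * (w - 1) ^ (n - i))"
      by (simp add: algebra_simps)
  qed
  also have "\<dots> = real (z choose i) * w ^ i * (\<Sum>m\<le>z-i. real (z - i choose m) * (w - 1) ^ m)"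
    unfolding sum_distrib_left
    by (rule sum.reindex_bij_witness[of _ "\<lambda>m. m + i" "\<lambda>n. n - i"]) (use True in auto)
  also have "(\<Sum>m\<le>z-i. real (z - i choose m) * (w - 1) ^ m) = w ^ (z - i)"
    using binomial_ring[of "w - 1" 1 "z - i"] by simp
  also have "real (z choose i) * w ^ i * w ^ (z - i) = real (z choose i) * w ^ z"
    using True by (simp add: mult.assoc flip: power_add)
  finally show ?thesis ..
qed

definition binom_poly :: "nat \<Rightarrow> complex poly" where
  "binom_poly i = smult (1 / fact i) (\<Prod>m<i. [:- of_nat m, 1:])"

lemma poly_binom_poly: "poly (binom_poly i) (of_nat z) = of_nat (z choose i)"
  by (simp add: binom_poly_def poly_prod binomial_gbinomial gbinomial_prod_rev atLeast0LessThan)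

lemma degree_binom_poly: "degree (binom_poly i) \<le> i"
proof -
  have "degree (\<Prod>m<i. [:- of_nat m, 1:] :: complex poly) \<le> (\<Sum>m<i. degree ([:- of_nat m, 1:] :: complex poly))"
    using degree_prod_sum_le[of "{..<i}" "\<lambda>m. [:- of_nat m, 1:] :: complex poly"] by (simp add: comp_def)
  then show ?thesis by (simp add: binom_poly_def)
qed

lemma norm_power_diff_le_2:
  fixes z w :: complex
  assumes "norm z \<le> 2" "norm w \<le> 2"
  shows "norm (z ^ m - w ^ m) \<le> real m * 2 ^ m * norm (z - w)"
proof (induction m)
  case (Suc m)
  have "norm (z ^ Suc m - w ^ Suc m) = norm (z * (z ^ m - w ^ m) + (z - w) * w ^ m)"
    by (simp add: algebra_simps)
  also have "\<dots> \<le> 2 * (real m * 2 ^ m * norm (z - w)) + norm (z - w) * 2 ^ m"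
    using assms Suc
    by (intro order_trans[OF norm_triangle_ineq] add_mono)
       (auto simp: norm_mult norm_power intro!: mult_mono power_mono)
  also have "\<dots> \<le> real (Suc m) * 2 ^ Suc m * norm (z - w)"
    by (simp add: algebra_simps)
  finally show ?case .
qed simp

lemma l1_norm_sum_monom:
  "l1_norm (\<Sum>s\<in>S. monom (c s) (e s)) \<le> (\<Sum>s\<in>S. \<bar>c s\<bar>)"
proof (induction S rule: infinite_finite_induct)
  case (insert s S)
  let ?p = "monom (c s) (e s)" and ?q = "\<Sum>s\<in>S. monom (c s) (e s)"
  define n where "n = max (degree ?q) (e s)"
  have "degree (?p + ?q) \<le> n" "degree ?q \<le> n"
    using degree_monom_le[of "c s" "e s"] by (auto simp: n_def intro!: degree_add_le)
  then have "l1_norm (?p + ?q) = (\<Sum>i\<le>n. \<bar>coeff (?p + ?q) i\<bar>)" "l1_norm ?q = (\<Sum>i\<le>n. \<bar>coeff ?q i\<bar>)"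
    by (auto simp only: l1_norm_eq)
  moreover have "(\<Sum>i\<le>n. \<bar>coeff (?p + ?q) i\<bar>) \<le> (\<Sum>i\<le>n. (if i = e s then \<bar>c s\<bar> else 0) + \<bar>coeff ?q i\<bar>)"
    by (intro sum_mono) auto
  moreover have "\<dots> = \<bar>c s\<bar> + (\<Sum>i\<le>n. \<bar>coeff ?q i\<bar>)" by (simp add: sum.distrib n_def)
  ultimately show ?case using insert by simp
qed (auto simp: l1_norm_def)

text \<open>
  The auxiliary function is \<open>\<Phi>(z) = \<Sum> p\<^sub>i\<^sub>j binom(z, i) (x/y)^(jz)\<close>; at the integer \<open>z = u + kv\<close> it is close
  to a polynomial in \<open>\<theta>\<close>, because \<open>(x/y)^k\<close> is close to \<open>\<theta>\<close>. Its Newton coefficients are linear forms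
  in the \<open>p\<^sub>i\<^sub>j\<close>, the first \<open>N\<close> of which are made small by pigeonhole, whereas the others are small
  because \<open>x/y\<close> is close to 1.
\<close>
lemma auxiliary_function_contradiction:
  fixes f :: "int poly" and \<theta> :: complex and A Bd :: int and x y k K J U V N H Bx R :: nat
    and \<epsilon> l M tail :: real
  defines "R \<equiv> k * V"
  defines "c \<equiv> (\<lambda>n i. real (R choose n) * real (n choose i) * (real J * l) ^ (n - i))"
  assumes root: "poly (of_int_poly f) \<theta> = 0" and deg: "degree f = r" "r \<ge> 1"
    and A: "\<And>i. \<bar>coeff f i\<bar> \<le> A" "A \<ge> 1"
    and xy: "0 < x" "x < y" and \<theta>: "\<theta> \<noteq> 0" "norm \<theta> \<le> 2"
    and close: "norm (of_real ((real x / real y) ^ k) - \<theta>) \<le> \<epsilon>"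
    and J: "J \<ge> 1" and K: "K \<ge> 1" and U: "U + J \<le> k" "U * V > 2 ^ J * K"
    and l: "1 - real x / real y \<le> l"
    and M: "M > 0" "\<And>n. n < N \<Longrightarrow> real J * (\<Sum>i<K. c n i) \<le> M"
    and tail: "real J * (\<Sum>n\<in>{N..R}. \<Sum>i<K. c n i) \<le> tail"
    and H: "H \<ge> 1" "Bx \<ge> 1" "Bx ^ N < (H + 1) ^ (K * J)"
    and Bd: "Bd \<ge> 1" "real y ^ (J * (U + J)) * (real H * (real J * (\<Sum>i<K. real (R choose i)))) \<le> real_of_int Bd"
    and final: "(real y ^ (J * (U + J)) * (real N * (2 * real H * M / real Bx) + real H * tail)
        + real_of_int Bd * (real (J * V) * 2 ^ (J * V) * \<epsilon>))
       * (real r * (2 * (real r + 1) * real_of_int Bd ^ r * (2 * real_of_int A) ^ (J * V * r)) ^ (2 * r)) < 1"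
  shows False
proof -
  define S where "S = {..<K} \<times> {..<J}"
  define w where "w j = (real x / real y) ^ j" for j
  \<comment> \<open>The Newton coefficients are weighted by \<open>R choose n\<close>, the largest
    value of \<open>z choose n\<close> at points \<open>z <= R\<close>; one small linear form then
    serves all these points.\<close>
  define cc where "cc n = (\<lambda>(i, j). real (R choose n) * (real (n choose i) * w j ^ i * (w j - 1) ^ (n - i)))" for n
  have cardS: "card S = K * J" and finS: "finite S" by (simp_all add: S_def)
  have q: "0 < real x / real y" "real x / real y < 1" using xy by auto
  have l0: "l > 0" using l q by linarith
  have w: "0 < w j" "w j \<le> 1" for j using q by (auto simp: w_def power_le_one)
  have w1: "\<bar>w j - 1\<bar> \<le> real J * l" if "j < J" for j
  proof -
    have "1 + real j * (real x / real y - 1) \<le> (1 + (real x / real y - 1)) ^ j"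
      using q by (intro Bernoulli_inequality) simp
    then have "1 - w j \<le> real j * (1 - real x / real y)" by (simp add: w_def algebra_simps)
    also have "\<dots> \<le> real J * l" using that l q by (intro mult_mono) auto
    finally show ?thesis using w(2)[of j] by simp
  qed
  have c0: "c n i \<ge> 0" for n i using l0 by (simp add: c_def)
  have cc: "\<bar>cc n (i, j)\<bar> \<le> c n i" if "j < J" for n i j
  proof -
    have "\<bar>cc n (i, j)\<bar> = real (R choose n) * (real (n choose i) * w j ^ i * \<bar>w j - 1\<bar> ^ (n - i))"
      using w[of j] by (simp add: cc_def abs_mult power_abs)
    also have "\<dots> \<le> real (R choose n) * (real (n choose i) * 1 * (real J * l) ^ (n - i))"
      using w[of j] w1[OF that] by (intro mult_mono power_mono power_le_one) (auto simp: less_imp_le)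
    finally show ?thesis by (simp add: c_def mult_ac)
  qed
  have sumS: "(\<Sum>s\<in>S. \<bar>cc n s\<bar>) \<le> real J * (\<Sum>i<K. c n i)" for n
  proof -
    have "(\<Sum>s\<in>S. \<bar>cc n s\<bar>) \<le> (\<Sum>(i, j)\<in>S. c n i)"
      by (intro sum_mono) (auto simp: S_def cc)
    also have "\<dots> = real J * (\<Sum>i<K. c n i)"
      by (simp add: S_def flip: sum.cartesian_product) (simp add: sum_distrib_left)
    finally show ?thesis .
  qed
  have sm: "(\<Sum>s\<in>S. \<bar>cc n s\<bar>) \<le> M" if "n \<in> {..<N}" for n
    using sumS[of n] M(2)[of n] that by auto
  have Hless: "Bx ^ card {..<N} < (H + 1) ^ card S" using H by (simp add: cardS)
  obtain p :: "nat \<times> nat \<Rightarrow> int" where p: "\<exists>s\<in>S. p s \<noteq> 0" "\<And>s. \<bar>p s\<bar> \<le> int H"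
    "\<And>n. n < N \<Longrightarrow> \<bar>\<Sum>s\<in>S. real_of_int (p s) * cc n s\<bar> \<le> 2 * real H * M / real Bx"
    using small_linear_forms[of S "{..<N}" M cc, OF finS finite_lessThan M(1) sm H(1,2) Hless]
    by (metis lessThan_iff)
  define \<Phi> where "\<Phi> z = (\<Sum>(i, j)\<in>S. real_of_int (p (i, j)) * (real (z choose i) * w j ^ z))" for z
  define E where "E = real N * (2 * real H * M / real Bx) + real H * tail"
  have \<Phi>: "\<bar>\<Phi> z\<bar> \<le> E" if z: "z \<le> R" for z
  proof -
    define C where "C n = (\<Sum>(i, j)\<in>S. real_of_int (p (i, j)) * (real (n choose i) * w j ^ i * (w j - 1) ^ (n - i)))" for n
    have CR: "C n * real (R choose n) = (\<Sum>s\<in>S. real_of_int (p s) * cc n s)" for n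
      by (simp add: C_def cc_def sum_distrib_right sum_distrib_left case_prod_unfold mult_ac)
    have "\<Phi> z = (\<Sum>(i, j)\<in>S. \<Sum>n\<le>z. real_of_int (p (i, j)) * (real (n choose i) * w j ^ i * (w j - 1) ^ (n - i)) * real (z choose n))"
      unfolding \<Phi>_def newton_expansion by (simp add: sum_distrib_left mult_ac)
    also have "\<dots> = (\<Sum>n\<le>z. C n * real (z choose n))"
      unfolding C_def sum_distrib_right case_prod_unfold by (subst sum.swap) (rule refl)
    finally have "\<bar>\<Phi> z\<bar> \<le> (\<Sum>n\<le>z. \<bar>C n\<bar> * real (z choose n))"
      using sum_abs[of "\<lambda>n. C n * real (z choose n)" "{..z}"] by (simp add: abs_mult)
    also have "\<dots> \<le> (\<Sum>n\<le>z. \<bar>C n\<bar> * real (R choose n))"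
      using z by (intro sum_mono mult_left_mono) (auto intro: binomial_right_mono)
    also have "\<dots> \<le> (\<Sum>n\<in>{..<N} \<union> {N..R}. \<bar>C n\<bar> * real (R choose n))"
      using z by (intro sum_mono2) auto
    also have "\<dots> = (\<Sum>n<N. \<bar>C n\<bar> * real (R choose n)) + (\<Sum>n\<in>{N..R}. \<bar>C n\<bar> * real (R choose n))"
      by (intro sum.union_disjoint) auto
    also have "(\<Sum>n<N. \<bar>C n\<bar> * real (R choose n)) \<le> (\<Sum>n<N. 2 * real H * M / real Bx)"
    proof (intro sum_mono)
      fix n assume "n \<in> {..<N}"
      moreover have "\<bar>C n\<bar> * real (R choose n) = \<bar>C n * real (R choose n)\<bar>" by (simp add: abs_mult)
      ultimately show "\<bar>C n\<bar> * real (R choose n) \<le> 2 * real H * M / real Bx"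
        using p(3)[of n] CR by simp
    qed
    also have "(\<Sum>n\<in>{N..R}. \<bar>C n\<bar> * real (R choose n)) \<le> (\<Sum>n\<in>{N..R}. real H * (real J * (\<Sum>i<K. c n i)))"
    proof (intro sum_mono)
      fix n
      have "\<bar>C n\<bar> * real (R choose n) = \<bar>\<Sum>s\<in>S. real_of_int (p s) * cc n s\<bar>"
        by (simp add: abs_mult flip: CR)
      also have "\<dots> \<le> (\<Sum>s\<in>S. real H * \<bar>cc n s\<bar>)"
      proof (intro order_trans[OF sum_abs] sum_mono)
        fix s
        have "real_of_int \<bar>p s\<bar> \<le> real_of_int (int H)" by (subst of_int_le_iff) (rule p(2))
        then show "\<bar>real_of_int (p s) * cc n s\<bar> \<le> real H * \<bar>cc n s\<bar>"
          unfolding abs_mult by (intro mult_right_mono) auto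
      qed
      also have "\<dots> \<le> real H * (real J * (\<Sum>i<K. c n i))"
        unfolding sum_distrib_left[symmetric] by (intro mult_left_mono sumS) simp
      finally show "\<bar>C n\<bar> * real (R choose n) \<le> real H * (real J * (\<Sum>i<K. c n i))" .
    qed
    also have "\<dots> = real H * (real J * (\<Sum>n\<in>{N..R}. \<Sum>i<K. c n i))"
      by (simp add: sum_distrib_left)
    also have "\<dots> \<le> real H * tail" using tail by (intro mult_left_mono) auto
    finally show ?thesis by (simp add: E_def)
  qed
  \<comment> \<open>This power of \<open>y\<close> clears the denominators of
    \<open>(x/y)^(j*u)\<close> for all \<open>j < J\<close> and \<open>u < U + J\<close>.\<close>
  define e where "e = J * (U + J)"
  define b where "b u v = (\<lambda>(i, j). p (i, j) * (int (u + k * v choose i) * (int x ^ (j * u) * int y ^ (e - j * u))))" for u v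
  \<comment> \<open>At \<open>z = u + k*v\<close> the factor \<open>(x/y)^(j*k*v)\<close> is
    replaced by the variable to the power \<open>j*v\<close>. So \<open>g u v\<close> is an integer
    polynomial whose value at \<open>(x/y)^k\<close> is \<open>y^e\<close> times the auxiliary
    function at \<open>z\<close>, and it can be evaluated at \<open>\<theta>\<close>
    instead.\<close>
  define g where "g u v = (\<Sum>s\<in>S. monom (b u v s) (snd s * v))" for u v
  define \<tau> where "\<tau> = (real x / real y) ^ k"
  have \<tau>: "norm (of_real \<tau> :: complex) \<le> 2" using q unfolding \<tau>_def norm_of_real
    by (simp add: power_abs) (meson order_trans power_le_one less_imp_le one_le_numeral divide_nonneg_nonneg of_nat_0_le_iff)
  have evalg: "poly (of_int_poly (g u v)) (z :: complex) = (\<Sum>s\<in>S. of_int (b u v s) * z ^ (snd s * v))" for u v z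
    by (simp add: g_def of_int_hom.poly_map_poly_eval_poly hom_distribs poly_sum poly_monom of_int_poly_hom.hom_sum)
  have zR: "u + k * v \<le> R" if "u < U + J" "v < V" for u v
  proof -
    have "u + k * v \<le> k * Suc v" using that U by simp
    also have "\<dots> \<le> k * V" using that by (intro mult_le_mono) auto
    finally show ?thesis by (simp add: R_def)
  qed
  have eju: "j * u \<le> e" if "u < U + J" "j < J" for j u
    unfolding e_def using that by (intro mult_le_mono) auto
  have bsum: "(\<Sum>s\<in>S. \<bar>b u v s\<bar>) \<le> Bd" if uv: "u < U + J" "v < V" for u v
  proof -
    have "real_of_int (\<Sum>s\<in>S. \<bar>b u v s\<bar>) \<le> (\<Sum>(i, j)\<in>S. real H * (real (R choose i) * real y ^ e))"
      unfolding of_int_sum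
    proof (intro sum_mono, clarify)
      fix i j assume ij: "(i, j) \<in> S"
      have "int x ^ (j * u) * int y ^ (e - j * u) \<le> int y ^ (j * u) * int y ^ (e - j * u)"
        using xy by (intro mult_right_mono power_mono) auto
      also have "\<dots> = int y ^ e" unfolding power_add[symmetric] using ij eju[of u j] uv by (simp add: S_def)
      finally have "\<bar>b u v (i, j)\<bar> \<le> int H * (int (R choose i) * int y ^ e)"
        unfolding b_def prod.case abs_mult using p(2) zR[OF uv]
        by (intro mult_mono) (auto intro: binomial_right_mono)
      then have "real_of_int \<bar>b u v (i, j)\<bar> \<le> real_of_int (int H * (int (R choose i) * int y ^ e))"
        by (subst of_int_le_iff)
      then show "real_of_int \<bar>b u v (i, j)\<bar> \<le> real H * (real (R choose i) * real y ^ e)" by simp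
    qed
    also have "\<dots> = real y ^ e * (real H * (real J * (\<Sum>i<K. real (R choose i))))"
      by (simp add: S_def flip: sum.cartesian_product) (simp add: sum_distrib_left mult_ac)
    also have "\<dots> \<le> real_of_int Bd" using Bd(2) by (simp add: e_def)
    finally show ?thesis by (simp only: of_int_le_iff)
  qed
  \<comment> \<open>By \<open>final\<close> the value at \<open>\<theta>\<close> lies below the
    Liouville bound, so it vanishes. The range of \<open>u\<close> has \<open>J\<close> extra values
    because \<open>zero_estimate\<close> reserves one shift of \<open>u\<close> for each
    polynomial.\<close>
  have g_zero: "poly (of_int_poly (g u v)) \<theta> = 0" if uv: "u < U + J" "v < V" for u v
  proof (rule ccontr)
    assume nz: "poly (of_int_poly (g u v)) \<theta> \<noteq> 0"
    have dg: "degree (g u v) \<le> J * V"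
      unfolding g_def
    proof (intro degree_sum_le finS)
      fix s assume "s \<in> S"
      then have "snd s * v \<le> J * V" using uv by (intro mult_le_mono) (auto simp: S_def)
      then show "degree (monom (b u v s) (snd s * v)) \<le> J * V"
        using degree_monom_le[of "b u v s" "snd s * v"] by linarith
    qed
    have ln: "l1_norm (g u v) \<le> Bd"
      unfolding g_def by (rule order_trans[OF l1_norm_sum_monom bsum[OF uv]])
    have "poly (of_int_poly (g u v)) (of_real \<tau> :: complex) = of_real (real y ^ e * \<Phi> (u + k * v))"
      unfolding evalg \<Phi>_def sum_distrib_left of_real_sum
    proof (intro sum.cong refl)
      fix s assume "s \<in> S"
      then obtain i j where s: "s = (i, j)" and ij: "(i, j) \<in> S" by (cases s) auto
      have "w j ^ (u + k * v) = (real x / real y) ^ (j * u) * \<tau> ^ (j * v)"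
        by (simp add: w_def \<tau>_def flip: power_mult power_add) (simp add: algebra_simps)
      moreover have "real y ^ e = real y ^ (j * u) * real y ^ (e - j * u)"
        unfolding power_add[symmetric] using ij eju[of u j] uv by (simp add: S_def)
      ultimately have "real_of_int (b u v (i, j)) * \<tau> ^ (j * v) =
          real y ^ e * (real_of_int (p (i, j)) * (real (u + k * v choose i) * w j ^ (u + k * v)))"
        using xy by (simp add: b_def power_divide field_simps)
      then have "complex_of_real (real_of_int (b u v (i, j)) * \<tau> ^ (j * v)) = complex_of_real
          (real y ^ e * (real_of_int (p (i, j)) * (real (u + k * v choose i) * w j ^ (u + k * v))))"
        by (simp only:)
      then show "of_int (b u v s) * complex_of_real \<tau> ^ (snd s * v) =
         complex_of_real (real y ^ e * (case s of (i, j) \<Rightarrow> real_of_int (p (i, j)) * (real (u + k * v choose i) * w j ^ (u + k * v))))"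
        by (simp add: s)
    qed
    then have n1: "norm (poly (of_int_poly (g u v)) (of_real \<tau> :: complex)) \<le> real y ^ e * E"
      using \<Phi>[OF zR[OF uv]] by (simp add: norm_mult norm_power mult_left_mono)
    have "poly (of_int_poly (g u v)) \<theta> - poly (of_int_poly (g u v)) (of_real \<tau>) =
       (\<Sum>s\<in>S. of_int (b u v s) * (\<theta> ^ (snd s * v) - of_real \<tau> ^ (snd s * v)))"
      unfolding evalg by (simp add: sum_subtractf algebra_simps)
    also have "norm \<dots> \<le> (\<Sum>s\<in>S. real_of_int \<bar>b u v s\<bar> * (real (J * V) * 2 ^ (J * V) * \<epsilon>))"
    proof (intro order_trans[OF norm_sum] sum_mono)
      fix s assume s: "s \<in> S"
      have le: "snd s * v \<le> J * V" using uv s by (intro mult_le_mono) (auto simp: S_def)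
      have "norm (\<theta> ^ (snd s * v) - of_real \<tau> ^ (snd s * v)) \<le>
          real (snd s * v) * 2 ^ (snd s * v) * norm (\<theta> - of_real \<tau>)"
        by (rule norm_power_diff_le_2[OF \<theta>(2) \<tau>])
      also have "\<dots> \<le> real (J * V) * 2 ^ (J * V) * \<epsilon>"
      proof -
        have "real (snd s * v) * 2 ^ (snd s * v) \<le> real (J * V) * 2 ^ (J * V)"
          using le by (intro mult_mono[of "real (snd s * v)" "real (J * V)"] power_increasing)
            (simp_all del: of_nat_mult)
        moreover have "norm (\<theta> - of_real \<tau>) \<le> \<epsilon>" using close by (simp add: \<tau>_def norm_minus_commute)
        ultimately show ?thesis by (intro mult_mono[of _ "real (J * V) * 2 ^ (J * V)"]) auto
      qed
      finally show "norm (of_int (b u v s) * (\<theta> ^ (snd s * v) - of_real \<tau> ^ (snd s * v)))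
         \<le> real_of_int \<bar>b u v s\<bar> * (real (J * V) * 2 ^ (J * V) * \<epsilon>)"
        by (simp add: norm_mult mult_left_mono)
    qed
    also have "\<dots> = real_of_int (\<Sum>s\<in>S. \<bar>b u v s\<bar>) * (real (J * V) * 2 ^ (J * V) * \<epsilon>)"
      by (simp add: sum_distrib_right)
    also have "\<dots> \<le> real_of_int Bd * (real (J * V) * 2 ^ (J * V) * \<epsilon>)"
      using bsum[OF uv] order_trans[OF norm_ge_zero close]
      by (intro mult_right_mono mult_nonneg_nonneg) (auto simp del: of_int_sum)
    finally have "norm (poly (of_int_poly (g u v)) \<theta>) \<le>
        real y ^ e * E + real_of_int Bd * (real (J * V) * 2 ^ (J * V) * \<epsilon>)"
      using n1 norm_triangle_ineq2[of "poly (of_int_poly (g u v)) \<theta>" "poly (of_int_poly (g u v)) (of_real \<tau>)"]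
      by linarith
    then have "norm (poly (of_int_poly (g u v)) \<theta>) * (real r * (2 * (real r + 1) * real_of_int Bd ^ r * (2 * real_of_int A) ^ (J * V * r)) ^ (2 * r))
       \<le> (real y ^ e * E + real_of_int Bd * (real (J * V) * 2 ^ (J * V) * \<epsilon>)) * (real r * (2 * (real r + 1) * real_of_int Bd ^ r * (2 * real_of_int A) ^ (J * V * r)) ^ (2 * r))"
      using A Bd by (intro mult_right_mono) auto
    moreover have "\<dots> < 1" using final by (simp add: e_def E_def)
    ultimately show False
      using liouville_lower_bound[OF root deg A dg ln Bd(1) nz] by linarith
  qed
  define P where "P j = (\<Sum>i<K. smult (of_int (p (i, j))) (binom_poly i))" for j
  define \<alpha> where "\<alpha> = (of_real (real x / real y) :: complex)"
  have evalP: "poly (P j) (of_nat z) = (\<Sum>i<K. of_int (p (i, j)) * of_nat (z choose i))" for j z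
    by (simp add: P_def poly_sum poly_binom_poly)
  have degP: "degree (P j) \<le> K" for j
    unfolding P_def
  proof (intro degree_sum_le finite_lessThan)
    fix i assume "i \<in> {..<K}"
    then show "degree (smult (of_int (p (i, j))) (binom_poly i)) \<le> K"
      using degree_smult_le[of "of_int (p (i, j))" "binom_poly i"] degree_binom_poly[of i] by simp
  qed
  define T where "T = {j. j < J \<and> P j \<noteq> 0}"
  have T: "finite T" "card T \<le> J" using card_mono[of "{..<J}" T] by (auto simp: T_def)
  have T0: "T \<noteq> {}"
  proof -
    obtain i0 j where ij: "i0 < K" "j < J" "p (i0, j) \<noteq> 0" using p(1) by (auto simp: S_def)
    \<comment> \<open>At the least \<open>i\<close> with nonzero coefficient only one term of
      \<open>P j\<close> survives: smaller indices have coefficient 0, larger ones binomial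
      0.\<close>
    define i where "i = (LEAST i. p (i, j) \<noteq> 0)"
    have i: "p (i, j) \<noteq> 0" "i \<le> i0"
      using LeastI[of "\<lambda>i. p (i, j) \<noteq> 0", OF ij(3)] Least_le[of "\<lambda>i. p (i, j) \<noteq> 0", OF ij(3)]
      unfolding i_def by linarith+
    have i_less: "p (i', j) = 0" if "i' < i" for i'
      using not_less_Least[of i' "\<lambda>i. p (i, j) \<noteq> 0"] that unfolding i_def by blast
    have "poly (P j) (of_nat i) = (\<Sum>i'\<in>{i}. of_int (p (i', j)) * of_nat (i choose i'))"
      unfolding evalP
    proof (rule sum.mono_neutral_right)
      show "\<forall>i'\<in>{..<K} - {i}. complex_of_int (p (i', j)) * of_nat (i choose i') = 0"
        using i_less by (metis DiffE binomial_eq_0 insertI1 linorder_neqE_nat mult_zero_left mult_zero_right of_int_0 of_nat_0)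
    qed (use i ij(1) in auto)
    then have "poly (P j) (of_nat i) \<noteq> 0" using i(1) by simp
    then have "P j \<noteq> 0" by auto
    then show ?thesis using ij(2) by (auto simp: T_def)
  qed
  have \<alpha>0: "\<alpha> \<noteq> 0" using xy by (simp add: \<alpha>_def)
  have inj\<alpha>: "inj (\<lambda>j::nat. \<alpha> ^ j)"
  proof (rule injI)
    fix i j :: nat assume "\<alpha> ^ i = \<alpha> ^ j"
    then have "(real x / real y) ^ i = (real x / real y) ^ j"
      unfolding \<alpha>_def of_real_power[symmetric] of_real_eq_iff .
    then show "i = j" using power_inject_exp'[of "real x / real y" i j] xy by simp
  qed
  have vanish: "(\<Sum>j\<in>T. poly (P j) (of_nat (u + k * v)) * (\<alpha> ^ u * \<theta> ^ v) ^ j) = 0"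
    if "u < U + card T" "v < V" for u v
  proof -
    have uv: "u < U + J" "v < V" using that T by auto
    have "(\<Sum>j\<in>T. poly (P j) (of_nat (u + k * v)) * (\<alpha> ^ u * \<theta> ^ v) ^ j) =
        (\<Sum>j<J. poly (P j) (of_nat (u + k * v)) * (\<alpha> ^ u * \<theta> ^ v) ^ j)"
      by (rule sum.mono_neutral_left) (auto simp: T_def)
    also have "of_nat y ^ e * \<dots> = (\<Sum>j<J. \<Sum>i<K. of_int (b u v (i, j)) * \<theta> ^ (j * v))"
      unfolding sum_distrib_left
    proof (intro sum.cong refl)
      fix j assume j: "j \<in> {..<J}"
      have "(of_nat y :: complex) ^ e = of_nat y ^ (j * u) * of_nat y ^ (e - j * u)"
        unfolding power_add[symmetric] using j eju[of u j] uv by simp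
      moreover have "(\<alpha> ^ u * \<theta> ^ v) ^ j = of_nat x ^ (j * u) / of_nat y ^ (j * u) * \<theta> ^ (j * v)"
        by (simp add: \<alpha>_def power_mult_distrib power_divide mult.commute flip: power_mult)
      ultimately show "of_nat y ^ e * (poly (P j) (of_nat (u + k * v)) * (\<alpha> ^ u * \<theta> ^ v) ^ j) =
          (\<Sum>i<K. of_int (b u v (i, j)) * \<theta> ^ (j * v))"
        unfolding evalP using xy
        by (simp add: b_def sum_distrib_right sum_distrib_left sum_divide_distrib mult_ac)
    qed
    also have "\<dots> = poly (of_int_poly (g u v)) \<theta>"
      unfolding evalg S_def by (subst sum.swap) (simp add: sum.cartesian_product case_prod_unfold)
    finally show ?thesis using g_zero[OF uv] xy by simp
  qed
  have "U * V \<le> 2 ^ card T * K"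
    by (rule zero_estimate[OF T(1) T0 _ degP \<alpha>0 inj\<alpha> \<theta>(1) _ vanish]) (use U in \<open>auto simp: T_def\<close>)
  also have "\<dots> \<le> 2 ^ J * K" using T by (intro mult_right_mono power_increasing) auto
  finally show False using U by simp
qed

section \<open>Estimates for binomial coefficients and factorials\<close>

lemma half_less_ln_2: "1/2 < ln (2::real)"
proof -
  have "exp (1/2 :: real) < 2"
  proof (rule power2_less_imp_less)
    have "(exp (1/2 :: real))\<^sup>2 = exp 1" by (simp add: power2_eq_square flip: exp_add)
    then show "(exp (1/2 :: real))\<^sup>2 < 2\<^sup>2" using exp_le by simp
  qed simp
  then show ?thesis by (metis exp_less_cancel_iff exp_ln zero_less_numeral)
qed

lemma power_over_fact_le_exp:
  fixes x :: real
  assumes "x \<ge> 0"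
  shows "x ^ n / fact n \<le> exp x"
proof -
  have "(\<Sum>k\<in>{n}. x ^ k /\<^sub>R fact k) \<le> (\<Sum>k. x ^ k /\<^sub>R fact k)"
    using assms by (intro sum_le_suminf summable_exp_generic) auto
  then show ?thesis by (simp add: exp_def field_simps)
qed

lemma binomial_le_exp:
  fixes s :: real
  assumes "real R \<le> real K * s" "s \<ge> 1" "i \<le> K"
  shows "real (R choose i) \<le> exp (real K) * s ^ K"
proof -
  have "real ((R choose i) * fact i) \<le> real (R ^ i)"
    by (simp only: of_nat_le_iff binomial_fact_pow)
  then have "real (R choose i) \<le> real R ^ i / fact i" by (simp add: field_simps)
  also have "\<dots> \<le> (real K * s) ^ i / fact i" using assms by (intro divide_right_mono power_mono) auto
  also have "\<dots> = real K ^ i / fact i * s ^ i" by (simp add: power_mult_distrib)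
  also have "\<dots> \<le> exp (real K) * s ^ K"
    using assms by (intro mult_mono power_over_fact_le_exp power_increasing) auto
  finally show ?thesis .
qed

text \<open>\<open>choose_mult\<close> turns the two binomials into \<open>R choose i\<close>,
  bounded by \<open>binomial_le_exp\<close>, and \<open>R - i choose (n - i)\<close>, bounded by
  \<open>R^(n-i)/(n-i)!\<close>. Only the product \<open>R*z\<close> remains in the last factor; in
  the application \<open>R\<close> is a multiple of \<open>k\<close> and \<open>z\<close> a multiple
  of \<open>1/k\<close>, so \<open>k\<close> cancels.\<close>

lemma newton_coefficient_bound:
  fixes s z :: real
  assumes "real R \<le> real K * s" "s \<ge> 1" "i \<le> K" "z \<ge> 0"
  shows "real (R choose n) * real (n choose i) * z ^ (n - i)
    \<le> exp (real K) * s ^ K * ((real R * z) ^ (n - i) / fact (n - i))"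
proof (cases "i \<le> n \<and> n \<le> R")
  case True
  let ?q = "n - i"
  have "real ((R - i choose ?q) * fact ?q) \<le> real ((R - i) ^ ?q)"
    by (simp only: of_nat_le_iff binomial_fact_pow)
  also have "\<dots> \<le> real R ^ ?q" by (simp add: power_mono)
  finally have "real (R - i choose ?q) \<le> real R ^ ?q / fact ?q" by (simp add: field_simps)
  moreover have "real (R choose n) * real (n choose i) = real (R choose i) * real (R - i choose ?q)"
    using choose_mult[of i n R] True by (metis of_nat_mult)
  moreover have "real (R choose i) \<le> exp (real K) * s ^ K" using binomial_le_exp assms by blast
  ultimately have "real (R choose n) * real (n choose i) * z ^ ?q
      \<le> (exp (real K) * s ^ K) * (real R ^ ?q / fact ?q) * z ^ ?q"
    using assms by (simp only:) (intro mult_mono mult_nonneg_nonneg zero_le_power, auto)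
  then show ?thesis by (simp add: power_mult_distrib mult_ac)
next
  case False
  then have "real (R choose n) * real (n choose i) = 0" by (auto simp: binomial_eq_0)
  moreover have "0 \<le> exp (real K) * s ^ K * ((real R * z) ^ (n - i) / fact (n - i))" using assms by simp
  ultimately show ?thesis by (simp only: mult_zero_left)
qed

text \<open>From \<open>q! >= (q/e)^q\<close>, which compares \<open>exp q\<close> with a single
  term of its series.\<close>

lemma power_over_fact_small:
  fixes x \<rho> :: real
  assumes x: "x \<ge> 0" "Q > 0" "Q \<le> q" and \<rho>: "exp 1 * x / real Q \<le> \<rho>" "0 < \<rho>" "\<rho> \<le> 1"
  shows "x ^ q / fact q \<le> \<rho> ^ Q"
proof -
  have q: "q > 0" using x by simp
  have "x ^ q / fact q = (x / real q) ^ q * (real q ^ q / fact q)"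
    using q by (simp add: power_divide)
  also have "\<dots> \<le> (x / real q) ^ q * exp (real q)"
    using x by (intro mult_left_mono power_over_fact_le_exp) auto
  also have "\<dots> = (exp 1 * x / real q) ^ q"
    by (simp add: power_mult_distrib power_divide exp_of_nat_mult[symmetric])
  also have "\<dots> \<le> (exp 1 * x / real Q) ^ q" using x by (intro power_mono divide_left_mono) auto
  also have "\<dots> \<le> \<rho> ^ q" using \<rho> x by (intro power_mono) auto
  also have "\<dots> \<le> \<rho> ^ Q" using \<rho> x by (intro power_decreasing) auto
  finally show ?thesis .
qed

text \<open>
  With \<open>t = k / ln A\<close>, all contributions to the logarithm of the Liouville quotient are compared with
  \<open>G = K ln t\<close>. Since \<open>1 - x/y\<close> is at most \<open>3/t\<close>, also \<open>y \<ge> t/3\<close>, and \<open>J\<close> may be chosen depending on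
  \<open>r\<close> only.
\<close>
lemma power_near_root_contradiction:
  fixes r :: nat and \<epsilon> :: real
  assumes r: "r \<ge> 1" and \<epsilon>: "\<epsilon> > 0"
  shows "\<exists>T>0. \<forall>(f :: int poly) (A :: int) (\<theta> :: complex) (k :: nat) (x :: nat) (y :: nat).
    degree f = r \<and> (\<forall>i. \<bar>coeff f i\<bar> \<le> A) \<and> A \<ge> 2 \<and> poly (of_int_poly f) \<theta> = 0 \<and>
    \<theta> \<noteq> 0 \<and> norm \<theta> \<le> 2 \<and> 0 < x \<and> x < y \<and> T * ln (real_of_int A) \<le> real k \<and>
    real k * (1 - real x / real y) \<le> 3 * ln (real_of_int A) \<and>
    norm (of_real ((real x / real y) ^ k) - \<theta>) \<le> real y powr (- \<epsilon> * real k) \<longrightarrow> False"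
proof -
  \<comment> \<open>The Liouville factor is at most \<open>exp ((1 + 34 r^2) G)\<close>; the
    remaining 18 pays for other factors of total size \<open>exp (16 G)\<close> and leaves
    \<open>exp (-2 G)\<close>.\<close>
  define m where "m = 19 + 34 * r\<^sup>2"
  \<comment> \<open>With \<open>N = K*J'\<close> the tail of the Newton series has
    \<open>4*m*K\<close> orders beyond the \<open>K\<close> lost to the index \<open>i\<close>. Each
    gains \<open>t^(-1/4)\<close>, in total \<open>exp (-m G)\<close>.\<close>
  define J' where "J' = 4 * m + 1"
  \<comment> \<open>There are \<open>\<nu>\<close> times as many unknowns as small forms, so
    \<open>Bx = H ^ \<nu>\<close> is allowed. The forms gain \<open>H^(-4 r^2)\<close>, at most
    \<open>exp (-44 r^2 G)\<close>, which beats the term \<open>34 r^2 G\<close> in the Liouville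
    factor.\<close>
  define \<nu> where "\<nu> = 4 * r\<^sup>2 + 1"
  define J where "J = \<nu> * J'"
  define cU where "cU = 2 ^ (J + 2) + real J"
  define E0 where "E0 = real r * (2 * (real r + 1)) ^ (2 * r)"
  \<comment> \<open>A sum of lower bounds for \<open>s = sqrt t\<close>: \<open>cU\<close> for
    \<open>U + J <= k\<close>, \<open>9 J^2\<close> for the decay of the Newton coefficients, the
    third term for turning closeness to the root into \<open>exp (-(m + 1) G)\<close>, and the
    exponential to make \<open>ln t\<close> exceed the constants depending on
    \<open>r\<close>.\<close>
  define s0 where "s0 = cU + 9 * (real J)\<^sup>2 + 2 * (real m + 1) * (real J * cU + 2) / \<epsilon> + exp (real J + 4 + E0)"
  have J: "J \<ge> 1" "J' \<ge> 1" "\<nu> \<ge> 1" "real J \<ge> 1" by (simp_all add: J_def J'_def \<nu>_def Suc_leI)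
  have cU: "cU > 0" using J by (simp add: cU_def add_pos_pos)
  have E0: "E0 \<ge> 1" unfolding E0_def using r
    by (intro mult_ge1_I one_le_power) auto
  have pos: "cU \<ge> 0" "9 * (real J)\<^sup>2 \<ge> 0" "2 * (real m + 1) * (real J * cU + 2) / \<epsilon> \<ge> 0"
    using \<epsilon> cU J by auto
  have s0: "s0 \<ge> cU" "s0 \<ge> 9 * (real J)\<^sup>2" "s0 \<ge> 2 * (real m + 1) * (real J * cU + 2) / \<epsilon>"
      "s0 \<ge> exp (real J + 4 + E0)" "s0 > 0"
    unfolding s0_def using pos exp_gt_zero[of "real J + 4 + E0"] by linarith+
  show ?thesis
  proof (rule exI[of _ "s0\<^sup>2"], intro conjI allI impI)
    show "s0\<^sup>2 > 0" using s0 by simp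
  next
    fix f :: "int poly" and A :: int and \<theta> :: complex and k x y :: nat
    assume hyp: "degree f = r \<and> (\<forall>i. \<bar>coeff f i\<bar> \<le> A) \<and> A \<ge> 2 \<and> poly (of_int_poly f) \<theta> = 0 \<and>
      \<theta> \<noteq> 0 \<and> norm \<theta> \<le> 2 \<and> 0 < x \<and> x < y \<and> s0\<^sup>2 * ln (real_of_int A) \<le> real k \<and>
      real k * (1 - real x / real y) \<le> 3 * ln (real_of_int A) \<and>
      norm (of_real ((real x / real y) ^ k) - \<theta>) \<le> real y powr (- \<epsilon> * real k)"
    define a where "a = ln (real_of_int A)"
    have "ln 2 \<le> a" unfolding a_def using hyp by (subst ln_le_cancel_iff) auto
    then have a: "a > 1/2" using half_less_ln_2 by linarith
    define t where "t = real k / a"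
    define s where "s = sqrt t"
    define lt where "lt = ln t"
    define Lx where "Lx = ln (real y)"
    have xy: "0 < x" "x < y" using hyp by auto
    have ts: "t \<ge> s0\<^sup>2" using hyp a by (simp add: t_def a_def field_simps)
    have ss: "s \<ge> s0" unfolding s_def using ts s0 by (metis real_le_rsqrt)
    have tpos: "t > 0" using ts s0 by (meson less_le_trans zero_less_power)
    have s: "s * s = t" "s > 0" using tpos by (auto simp: s_def)
    have k: "real k = a * t" using a by (simp add: t_def)
    have s_exp: "s \<ge> exp (real J + 4 + E0)" using ss s0 by linarith
    have s5: "s \<ge> 5" using s_exp exp_ge_add_one_self[of "real J + 4 + E0"] E0 J by linarith
    have lns: "ln s \<ge> real J + 4 + E0" using s_exp s(2) by (simp add: ln_ge_iff)
    have "lt = ln (s * s)" by (simp only: lt_def s(1))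
    then have lt: "lt = 2 * ln s" using s(2) by (simp add: ln_mult)
    have lt2: "lt \<ge> real J + 4 + E0" using lt lns E0 J by linarith
    have st: "s \<le> t" "s \<ge> 1" using s s5 mult_left_mono[of 1 s s] by auto
    have as: "a * s \<ge> 1" using mult_mono[of "1/2" a 2 s] a s5 by auto
    have y3: "t \<le> 3 * real y"
    proof -
      have "1 / real y \<le> 1 - real x / real y" using xy by (simp add: field_simps)
      then have "real k * (1 / real y) \<le> 3 * a"
        using hyp mult_left_mono[of "1 / real y" "1 - real x / real y" "real k"] unfolding a_def by linarith
      then show ?thesis using xy a by (simp add: k field_simps)
    qed
    have Lx: "Lx \<ge> lt / 2"
    proof -
      have "3 * s \<le> s * s" using s5 by (intro mult_right_mono) auto
      then have "s \<le> real y" using y3 s by linarith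
      then have "ln s \<le> Lx" unfolding Lx_def using s(2) by simp
      then show ?thesis using lt by simp
    qed
    have ltpos: "lt > 0" using lt2 E0 J by linarith
    have Lxpos: "Lx > 0" using Lx ltpos by linarith
    \<comment> \<open>Chosen so that the denominator \<open>y^(J(U+J))\<close> stays below
      \<open>exp G\<close>: its logarithm is at most \<open>J*cU*a*s*Lx\<close>, while
      \<open>G\<close> is at least \<open>V*a*s*lt\<close>.\<close>
    define V where "V = nat \<lceil>real J * cU * Lx / lt\<rceil>"
    have V0: "real J * cU * Lx / lt > 0" using J cU Lxpos ltpos by simp
    have V: "real V \<ge> real J * cU * Lx / lt" "V \<ge> 1"
      using V0 by (auto simp: V_def real_nat_ceiling_ge Suc_le_eq)
    have V2: "real V * lt \<le> (real J * cU + 2) * Lx"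
    proof -
      have "real V \<le> real J * cU * Lx / lt + 1" unfolding V_def using V0 by linarith
      then have "real V * lt \<le> (real J * cU * Lx / lt + 1) * lt" using ltpos by (intro mult_right_mono) auto
      also have "\<dots> = real J * cU * Lx + lt" using ltpos by (simp add: field_simps)
      finally show ?thesis using Lx by (simp add: algebra_simps)
    qed
    \<comment> \<open>Balances two ratios: since \<open>k*V = a*t*V\<close>, both
      \<open>R/K <= s\<close> and \<open>V*a/K <= 1/s\<close> hold. The first keeps the binomials
      below \<open>exp G\<close>, the second makes the Newton coefficients decay.\<close>
    define Ka where "Ka = real V * (a * s)"
    have Ka1: "Ka \<ge> 1" unfolding Ka_def using V as mult_mono[of 1 "real V" 1 "a * s"] by auto
    define K where "K = nat \<lceil>Ka\<rceil>"
    have K: "real K \<ge> Ka" "real K \<le> 2 * Ka" "K \<ge> 1"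
      using Ka1 by (auto simp: K_def real_nat_ceiling_ge Suc_le_eq) linarith
    \<comment> \<open>Just large enough for the condition \<open>U*V > 2^J*K\<close> of the zero
      estimate, given \<open>K <= 2*Ka\<close>.\<close>
    define U where "U = nat \<lceil>2 ^ J * 2 * (a * s)\<rceil> + 1"
    have as0: "2 ^ J * 2 * (a * s) > 0" using a s(2) by (intro mult_pos_pos) auto
    have U1: "real U > 2 ^ J * 2 * (a * s)" "real U \<le> 2 ^ J * 2 * (a * s) + 2"
      unfolding U_def using as0 by linarith+
    have UJ: "real (U + J) \<le> cU * (a * s)"
    proof -
      have "(2::real) \<le> 2 ^ J * 2 * (a * s)" using mult_mono[of 1 "2 ^ J * 1" 2 "2 * (a * s)"] as by (simp add: mult_ac)
      moreover have "real J \<le> real J * (a * s)" using as mult_left_mono[of 1 "a * s" "real J"] by simp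
      ultimately show ?thesis using U1 by (simp add: cU_def algebra_simps)
    qed
    define G where "G = real K * lt"
    have KG: "real K * (real J + 4 + E0) \<le> G" unfolding G_def using lt2 by (intro mult_left_mono) auto
    have K1: "real K \<ge> 1" using K by simp
    have G1: "real K \<le> G" "E0 \<le> G" "real K + real J \<le> G" "G \<ge> 4"
    proof -
      have "real J \<le> real K * real J" "E0 \<le> real K * E0" using K1 J E0 mult_right_mono[of 1 "real K"] by fastforce+
      moreover have "0 \<le> real K * real J" "0 \<le> real K * E0" "4 \<le> real K * 4" using K1 E0 J by auto
      ultimately show "real K \<le> G" "E0 \<le> G" "real K + real J \<le> G" "G \<ge> 4"
        using KG E0 J(4) K1 unfolding distrib_left by linarith+
    qed
    have le_exp: "u \<le> exp u" for u :: real using exp_ge_add_one_self[of u] by linarith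
    have exp2: "2 \<le> exp G" using le_exp[of G] G1(4) by linarith
    have KJe: "real K * real J \<le> exp G"
    proof -
      have "real K * real J \<le> exp (real K) * exp (real J)"
        by (intro mult_mono le_exp) auto
      also have "\<dots> \<le> exp G" using G1 by (simp flip: exp_add)
      finally show ?thesis .
    qed
    have sJ: "s \<ge> 9 * (real J)\<^sup>2" using ss s0 by linarith
    have JVa: "4 * (real J * (real V * a)) \<le> real K"
    proof -
      have "real J * 1 \<le> real J * real J" using J(4) by (intro mult_left_mono) auto
      then have "4 * real J \<le> s" using sJ unfolding power2_eq_square by linarith
      then have "(4 * real J) * (real V * a) \<le> s * (real V * a)" using a by (intro mult_right_mono) auto
      then show ?thesis using K(1) by (simp add: Ka_def mult_ac)
    qed
    have KsG: "exp (real K) * s ^ K \<le> exp G"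
    proof -
      have "s ^ K = exp (real K * ln s)" using s(2) by (simp add: exp_of_nat_mult)
      moreover have "real K * 1 \<le> real K * ln s" using lns E0 J by (intro mult_left_mono) auto
      ultimately show ?thesis by (simp add: G_def lt flip: exp_add)
    qed
    define R where "R = k * V"
    have RK: "real R \<le> real K * s"
    proof -
      have "real R = Ka * s" by (simp add: R_def k Ka_def s(1)[symmetric] mult_ac)
      then show ?thesis using K(1) s(2) by (simp add: mult_right_mono)
    qed
    define l where "l = 3 * a / real k"
    have k0: "real k > 0" using k a tpos by simp
    have l: "1 - real x / real y \<le> l" "l > 0"
      using hyp k0 a by (auto simp: l_def a_def field_simps)
    define z where "z = real R * (real J * l)"
    have z: "z = 3 * (real J * (real V * a))" "z \<ge> 0" using k0 a by (auto simp: z_def R_def l_def)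
    have zK: "z \<le> real K" using z JVa a by (simp add: mult_nonneg_nonneg)
    have cbound: "real (R choose n) * real (n choose i) * (real J * l) ^ (n - i)
       \<le> exp G * (z ^ (n - i) / fact (n - i))" if "i < K" for n i
    proof -
      have "real (R choose n) * real (n choose i) * (real J * l) ^ (n - i)
        \<le> exp (real K) * s ^ K * (z ^ (n - i) / fact (n - i))"
        unfolding z_def using RK st(2) l that by (intro newton_coefficient_bound) auto
      also have "\<dots> \<le> exp G * (z ^ (n - i) / fact (n - i))"
        using KsG z(2) by (intro mult_right_mono) auto
      finally show ?thesis .
    qed
    define N where "N = K * J'"
    define H where "H = nat \<lceil>exp (11 * G)\<rceil>"
    define Bx where "Bx = H ^ \<nu>"
    have H: "real H \<ge> exp (11 * G)" "real H \<le> exp (12 * G)" "H \<ge> 1"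
    proof -
      show "real H \<ge> exp (11 * G)" by (simp add: H_def real_nat_ceiling_ge)
      have "real H \<le> exp (11 * G) + 1" unfolding H_def using exp_gt_zero[of "11 * G"] by linarith
      also have "\<dots> \<le> exp (11 * G) + exp (11 * G)" using G1 by simp
      also have "\<dots> \<le> exp (11 * G) * exp G" using exp2 by (simp add: mult_2_right[symmetric])
      finally show "real H \<le> exp (12 * G)" by (simp flip: exp_add)
      show "H \<ge> 1" using exp_gt_zero[of "11 * G"] by (simp add: H_def Suc_le_eq)
    qed
    \<comment> \<open>15 = 1 + 12 + 2: the power of \<open>y\<close>, the upper bound for
      \<open>H\<close>, and the sum of binomials times \<open>J\<close>.\<close>
    define Bd where "Bd = \<lceil>exp (15 * G)\<rceil>"
    have Bd: "real_of_int Bd \<ge> exp (15 * G)" "real_of_int Bd \<le> exp (16 * G)" "Bd \<ge> 1"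
    proof -
      show "real_of_int Bd \<ge> exp (15 * G)" by (simp add: Bd_def)
      have "real_of_int Bd \<le> exp (15 * G) + 1" unfolding Bd_def by linarith
      also have "\<dots> \<le> exp (15 * G) + exp (15 * G)" using G1 by simp
      also have "\<dots> \<le> exp (15 * G) * exp G" using exp2 by (simp add: mult_2_right[symmetric])
      finally show "real_of_int Bd \<le> exp (16 * G)" by (simp flip: exp_add)
      show "Bd \<ge> 1" using exp_gt_zero[of "15 * G"] by (simp add: Bd_def)
    qed
    have yG: "real y ^ (J * (U + J)) \<le> exp G"
    proof -
      have "real y ^ (J * (U + J)) = exp (real (J * (U + J)) * Lx)"
        using xy by (simp only: exp_of_nat_mult Lx_def) simp
      also have "\<dots> \<le> exp G"
      proof -
        have "real (J * (U + J)) * Lx = real (U + J) * (real J * Lx)" by simp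
        also have "\<dots> \<le> cU * (a * s) * (real J * Lx)" using UJ Lxpos by (intro mult_right_mono) auto
        also have "\<dots> = (real J * cU * Lx / lt) * (a * s) * lt" using ltpos by (simp add: mult_ac)
        also have "\<dots> \<le> real V * (a * s) * lt" using V as ltpos by (intro mult_right_mono) auto
        also have "\<dots> \<le> real K * lt" using K(1) ltpos by (intro mult_right_mono) (auto simp: Ka_def)
        finally show ?thesis by (simp add: G_def)
      qed
      finally show ?thesis .
    qed
    define L where "L = real r * (2 * (real r + 1) * real_of_int Bd ^ r * (2 * real_of_int A) ^ (J * V * r)) ^ (2 * r)"
    have L: "L \<le> exp ((1 + 34 * (real r)\<^sup>2) * G)"
    proof -
      have "L = E0 * (real_of_int Bd ^ r * (2 * real_of_int A) ^ (J * V * r)) ^ (2 * r)"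
        by (simp add: L_def E0_def power_mult_distrib mult_ac)
      also have "\<dots> \<le> exp G * (exp (16 * G) ^ r * exp G ^ r) ^ (2 * r)"
      proof (intro mult_mono power_mono)
        show "E0 \<le> exp G" using G1 exp_ge_add_one_self[of G] by linarith
        have "(2 * real_of_int A) ^ (J * V) = exp (real (J * V) * ln (2 * real_of_int A))"
          using hyp by (simp only: exp_of_nat_mult) simp
        also have "\<dots> \<le> exp G"
        proof -
          have "ln (2 * real_of_int A) \<le> ln (real_of_int A * real_of_int A)" using hyp by (intro ln_mono mult_right_mono) auto
          also have "\<dots> = 2 * a" using hyp by (simp add: a_def ln_mult)
          finally have "real (J * V) * ln (2 * real_of_int A) \<le> real (J * V) * (2 * a)" by (intro mult_left_mono) auto
          also have "\<dots> \<le> G" using JVa G1 a by (simp add: mult_ac)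
          finally show ?thesis by simp
        qed
        finally show "(2 * real_of_int A) ^ (J * V * r) \<le> exp G ^ r"
          using hyp by (simp only: power_mult) (intro power_mono, auto)
      qed (use Bd hyp E0 in auto)
      also have "\<dots> = exp (G + real (2 * r) * (real r * (16 * G) + real r * G))"
        by (simp only: exp_add exp_of_nat_mult power_mult_distrib)
      also have "\<dots> = exp ((1 + 34 * (real r)\<^sup>2) * G)"
        by (simp add: algebra_simps power2_eq_square)
      finally show ?thesis .
    qed
    have Lpos: "L \<ge> 0" using Bd hyp by (simp add: L_def)
    have Umain: "U + J \<le> k"
    proof -
      have "cU * (a * s) \<le> s * (a * s)" using ss s0 as by (intro mult_right_mono) auto
      also have "\<dots> = real k" by (simp add: k s(1)[symmetric] mult_ac)
      finally have "real (U + J) \<le> real k" using UJ by linarith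
      then show ?thesis by (simp only: of_nat_le_iff)
    qed
    have UV: "U * V > 2 ^ J * K"
    proof -
      have "real (2 ^ J * K) \<le> 2 ^ J * (2 * Ka)" using K by simp
      also have "\<dots> = 2 ^ J * 2 * (a * s) * real V" by (simp add: Ka_def)
      also have "\<dots> < real U * real V" using U1 V by (intro mult_strict_right_mono) auto
      finally have "real (2 ^ J * K) < real (U * V)" by simp
      then show ?thesis by (simp only: of_nat_less_iff)
    qed
    define \<delta> where "\<delta> = real y powr (- \<epsilon> * real k)"
    have \<delta>: "\<delta> \<le> exp (- (real m + 1) * G)"
    proof -
      have "(real m + 1) * G \<le> (real m + 1) * (2 * Ka * lt)"
        unfolding G_def using K ltpos by (intro mult_left_mono mult_right_mono) auto
      also have "\<dots> = 2 * (real m + 1) * (a * s) * (real V * lt)" by (simp add: Ka_def)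
      also have "\<dots> \<le> 2 * (real m + 1) * (a * s) * ((real J * cU + 2) * Lx)"
        using V2 as by (intro mult_left_mono) auto
      also have "\<dots> = (2 * (real m + 1) * (real J * cU + 2) / \<epsilon>) * (\<epsilon> * (a * s) * Lx)" using \<epsilon> by (simp add: field_simps)
      also have "\<dots> \<le> s * (\<epsilon> * (a * s) * Lx)" using ss s0 \<epsilon> as Lxpos by (intro mult_right_mono) auto
      also have "\<dots> = \<epsilon> * real k * Lx" by (simp add: k s(1)[symmetric] mult_ac)
      finally show ?thesis using xy by (simp add: \<delta>_def powr_def Lx_def algebra_simps)
    qed
    define M where "M = exp (3 * G)"
    define tl where "tl = exp ((3 - real m) * G)"
    have final: "(real y ^ (J * (U + J)) * (real N * (2 * real H * M / real Bx) + real H * tl)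
        + real_of_int Bd * (real (J * V) * 2 ^ (J * V) * \<delta>)) * L < 1"
    proof -
      define \<Lambda> where "\<Lambda> = (1 + 34 * (real r)\<^sup>2) * G"
      have mG: "real m * G = \<Lambda> + 18 * G" by (simp add: m_def \<Lambda>_def algebra_simps)
      have N1: "real N \<le> exp G"
      proof -
        have "J' \<le> J" unfolding J_def using J(3) by simp
        then have "N \<le> K * J" unfolding N_def by simp
        then have "real N \<le> real K * real J" by (metis of_nat_le_iff of_nat_mult)
        then show ?thesis using KJe by linarith
      qed
      have "2 * real H * M / real Bx \<le> 2 * M * exp (- (4 * (real r)\<^sup>2 * (11 * G)))"
      proof -
        have "real Bx = real H * real H ^ (4 * r\<^sup>2)" by (simp add: Bx_def \<nu>_def)
        then have "2 * real H * M / real Bx = 2 * M / real H ^ (4 * r\<^sup>2)" using H by simp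
        also have "\<dots> \<le> 2 * M / exp (11 * G) ^ (4 * r\<^sup>2)"
          using H by (intro divide_left_mono power_mono mult_pos_pos zero_less_power) (auto simp: M_def)
        also have "exp (11 * G) ^ (4 * r\<^sup>2) = exp (4 * (real r)\<^sup>2 * (11 * G))"
          by (simp flip: exp_of_nat_mult)
        finally show ?thesis by (simp add: exp_minus field_simps)
      qed
      also have "\<dots> \<le> exp G * M * exp (- (4 * (real r)\<^sup>2 * (11 * G)))"
        using exp2 by (intro mult_right_mono) (auto simp: M_def)
      also have "\<dots> = exp (4 * G - 44 * (real r)\<^sup>2 * G)" by (simp add: M_def flip: exp_add)
      also have "\<dots> \<le> exp (- \<Lambda> - 4 * G)"
      proof -
        define u where "u = (real r)\<^sup>2 * G"
        have "1 * G \<le> u" unfolding u_def using r G1 by (intro mult_right_mono) auto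
        moreover have "44 * (real r)\<^sup>2 * G = 44 * u" by (simp add: u_def)
        moreover have "\<Lambda> = G + 34 * u" by (simp add: \<Lambda>_def u_def algebra_simps)
        ultimately have "4 * G - 44 * (real r)\<^sup>2 * G \<le> - \<Lambda> - 4 * G" using G1(4) by linarith
        then show ?thesis by simp
      qed
      finally have t1: "real N * (2 * real H * M / real Bx) \<le> exp G * exp (- \<Lambda> - 4 * G)"
        using N1 by (intro mult_mono) (auto simp: M_def)
      have t2: "real H * tl \<le> exp (12 * G) * exp ((3 - real m) * G)"
        using H by (intro mult_mono) (auto simp: tl_def)
      have t12: "real y ^ (J * (U + J)) * (real N * (2 * real H * M / real Bx) + real H * tl)
         \<le> exp G * (exp G * exp (- \<Lambda> - 4 * G) + exp (12 * G) * exp ((3 - real m) * G))"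
        by (intro mult_mono[OF yG add_mono[OF t1 t2]]) (auto simp: M_def tl_def)
      have JV: "real (J * V) * 2 ^ (J * V) \<le> exp G"
      proof -
        have "(2::real) ^ (J * V) \<le> exp 1 ^ (J * V)" using exp_ge_add_one_self[of 1] by (intro power_mono) auto
        then have "real (J * V) * 2 ^ (J * V) \<le> exp (real (J * V)) * exp (real (J * V))"
          by (intro mult_mono le_exp) (auto simp: exp_of_nat_mult[symmetric] simp del: of_nat_mult)
        also have "\<dots> = exp (2 * real (J * V))" by (simp flip: exp_add)
        also have "\<dots> \<le> exp G"
        proof -
          have "2 * (real J * real V) * 1 \<le> 2 * (real J * real V) * (2 * a)" using a by (intro mult_left_mono) auto
          moreover have "2 * (real J * real V) * (2 * a) = 4 * (real J * (real V * a))" by simp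
          ultimately have "2 * real (J * V) \<le> G" unfolding of_nat_mult using JVa G1(1) by linarith
          then show ?thesis by simp
        qed
        finally show ?thesis .
      qed
      have t3: "real_of_int Bd * (real (J * V) * 2 ^ (J * V) * \<delta>) \<le> exp (16 * G) * (exp G * exp (- (real m + 1) * G))"
        using Bd JV \<delta> by (intro mult_mono) (auto simp: \<delta>_def)
      have "(real y ^ (J * (U + J)) * (real N * (2 * real H * M / real Bx) + real H * tl)
        + real_of_int Bd * (real (J * V) * 2 ^ (J * V) * \<delta>)) * L
        \<le> (exp G * (exp G * exp (- \<Lambda> - 4 * G) + exp (12 * G) * exp ((3 - real m) * G))
          + exp (16 * G) * (exp G * exp (- (real m + 1) * G))) * exp \<Lambda>"
        by (rule mult_mono[OF add_mono[OF t12 t3] L[folded \<Lambda>_def]]) (use Lpos in auto)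
      also have "\<dots> = exp (G + (G + (- \<Lambda> - 4 * G)) + \<Lambda>) + exp (G + (12 * G + (3 - real m) * G) + \<Lambda>)
          + exp (16 * G + (G + - (real m + 1) * G) + \<Lambda>)"
        by (simp only: exp_add distrib_left distrib_right)
      also have "\<dots> = 3 * exp (- 2 * G)"
      proof -
        have e1: "G + (G + (- \<Lambda> - 4 * G)) + \<Lambda> = - 2 * G" by simp
        have e2: "G + (12 * G + (3 - real m) * G) + \<Lambda> = - 2 * G" using mG by (simp add: left_diff_distrib)
        have e3: "16 * G + (G + - (real m + 1) * G) + \<Lambda> = - 2 * G" using mG by (simp add: algebra_simps)
        show ?thesis unfolding e1 e2 e3 by simp
      qed
      also have "\<dots> < 1"
      proof -
        have "exp (2 * G) > 3" using le_exp[of "2 * G"] G1 by linarith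
        then show ?thesis by (simp add: exp_minus field_simps)
      qed
      finally show ?thesis .
    qed
    show False
    proof (rule auxiliary_function_contradiction[where f = f and \<theta> = \<theta> and A = A and Bd = Bd and x = x and y = y
          and k = k and K = K and J = J and U = U and V = V and N = N and H = H and Bx = Bx and \<epsilon> = \<delta>
          and l = l and M = M and tail = tl and r = r])
      show "2 ^ J * K < U * V" by (rule UV)
    next
      fix n
      have "real J * (\<Sum>i<K. real (k * V choose n) * real (n choose i) * (real J * l) ^ (n - i))
        \<le> real J * (\<Sum>i<K. exp G * exp G)"
      proof (intro mult_left_mono sum_mono)
        fix i assume i: "i \<in> {..<K}"
        have "z ^ (n - i) / fact (n - i) \<le> exp z" by (rule power_over_fact_le_exp[OF z(2)])
        also have "\<dots> \<le> exp G" using zK G1 by simp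
        finally have "exp G * (z ^ (n - i) / fact (n - i)) \<le> exp G * exp G" by (intro mult_left_mono) auto
        then show "real (k * V choose n) * real (n choose i) * (real J * l) ^ (n - i) \<le> exp G * exp G"
          using cbound[of i n] i by (simp add: R_def)
      qed auto
      also have "\<dots> = (real K * real J) * (exp G * exp G)" by simp
      also have "\<dots> \<le> exp G * (exp G * exp G)" using KJe by (intro mult_right_mono) auto
      also have "\<dots> = M" by (simp add: M_def flip: exp_add)
      finally show "real J * (\<Sum>i<K. real (k * V choose n) * real (n choose i) * (real J * l) ^ (n - i)) \<le> M" .
    next
      define Q where "Q = K * (4 * m)"
      \<comment> \<open>\<open>\<rho>\<close> is \<open>t^(-1/4)\<close>, so its square is
        \<open>1/s\<close>. The ratio to be bounded is of order \<open>1/s\<close>; half of this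
        decay is spent on the constants containing \<open>J\<close>.\<close>
      define \<rho> where "\<rho> = exp (- lt / 4)"
      have m0: "m \<ge> 1" by (simp add: m_def)
      have Q: "Q > 0" "N = Q + K" using m0 K by (auto simp: Q_def N_def J'_def)
      have \<rho>: "0 < \<rho>" "\<rho> \<le> 1" using ltpos by (auto simp: \<rho>_def)
      have \<rho>Q: "\<rho> ^ Q = exp (- (real m * G))" by (simp add: \<rho>_def Q_def G_def flip: exp_of_nat_mult)
      have \<rho>s: "\<rho> * \<rho> = 1 / s"
      proof -
        have "\<rho> * \<rho> = exp (- ln s)" by (simp add: \<rho>_def lt flip: exp_add)
        then show ?thesis using s(2) by (simp add: exp_minus inverse_eq_divide)
      qed
      have \<rho>J: "3 * real J \<le> 1 / \<rho>"
      proof (rule power2_le_imp_le)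
        have "(1 / \<rho>)\<^sup>2 = s" using \<rho>s \<rho> s(2) by (simp add: power2_eq_square field_simps)
        then show "(3 * real J)\<^sup>2 \<le> (1 / \<rho>)\<^sup>2" using sJ by (simp add: power_mult_distrib)
      qed (use \<rho> in auto)
      have ratio: "exp 1 * z / real Q \<le> \<rho>"
      proof -
        have "s * (real V * a) \<le> real K" using K(1) by (simp add: Ka_def mult_ac)
        then have "real V * a \<le> real K / s" using s(2) by (simp add: pos_le_divide_eq mult_ac)
        then have Va: "real V * a \<le> real K * (\<rho> * \<rho>)" by (simp add: \<rho>s)
        have "exp 1 * z \<le> 3 * (3 * (real J * (real V * a)))"
          using exp_le z by (intro mult_mono) auto
        also have "\<dots> \<le> 3 * (3 * (real J * (real K * (\<rho> * \<rho>))))"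
          using Va by (intro mult_left_mono) auto
        also have "\<dots> = 3 * real K * \<rho> * ((3 * real J) * \<rho>)" by simp
        also have "\<dots> \<le> 3 * real K * \<rho> * 1"
          using \<rho>J \<rho> by (intro mult_left_mono) (auto simp: field_simps)
        also have "\<dots> \<le> real Q * \<rho>"
        proof -
          have "3 * K \<le> Q" unfolding Q_def using m0 by simp
          then have "real (3 * K) \<le> real Q" by (simp only: of_nat_le_iff)
          then show ?thesis using \<rho> by (simp add: mult_right_mono)
        qed
        finally show ?thesis using Q by (simp add: field_simps)
      qed
      have "real J * (\<Sum>n\<in>{N..k * V}. \<Sum>i<K. real (k * V choose n) * real (n choose i) * (real J * l) ^ (n - i))
        \<le> real J * (\<Sum>n\<in>{N..k * V}. \<Sum>i<K. exp G * \<rho> ^ Q)"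
      proof (intro mult_left_mono sum_mono)
        fix n i assume n: "n \<in> {N..k * V}" and i: "i \<in> {..<K}"
        have "z ^ (n - i) / fact (n - i) \<le> \<rho> ^ Q"
          using z(2) Q n i ratio \<rho> by (intro power_over_fact_small) auto
        then have "exp G * (z ^ (n - i) / fact (n - i)) \<le> exp G * \<rho> ^ Q" by (intro mult_left_mono) auto
        then show "real (k * V choose n) * real (n choose i) * (real J * l) ^ (n - i) \<le> exp G * \<rho> ^ Q"
          using cbound[of i n] i by (simp add: R_def)
      qed auto
      also have "\<dots> = real (Suc (k * V) - N) * ((real K * real J) * (exp G * \<rho> ^ Q))" by simp
      also have "\<dots> \<le> exp G * (exp G * (exp G * \<rho> ^ Q))"
      proof (intro mult_mono)
        have "Suc (k * V) - N \<le> R" unfolding R_def using Q by linarith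
        then have "real (Suc (k * V) - N) \<le> real R" by (simp only: of_nat_le_iff)
        also have "\<dots> \<le> exp (real K) * s ^ K"
        proof -
          have "real K \<le> exp (real K)" using exp_ge_add_one_self[of "real K"] by linarith
          moreover have "s ^ 1 \<le> s ^ K" using st K by (intro power_increasing) auto
          ultimately have "real K * s \<le> exp (real K) * s ^ K" using s(2) by (intro mult_mono) auto
          then show ?thesis using RK by linarith
        qed
        also have "\<dots> \<le> exp G" by (rule KsG)
        finally show "real (Suc (k * V) - N) \<le> exp G" .
      qed (use KJe \<rho> in auto)
      also have "\<dots> = tl" unfolding \<rho>Q tl_def by (simp add: algebra_simps flip: exp_add)
      finally show "real J * (\<Sum>n\<in>{N..k * V}. \<Sum>i<K. real (k * V choose n) * real (n choose i) * (real J * l) ^ (n - i)) \<le> tl" .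
    next
      have "Bx ^ N = H ^ (K * J)" by (simp add: Bx_def N_def J_def mult_ac flip: power_mult)
      also have "\<dots> < (H + 1) ^ (K * J)" using K J by (intro power_strict_mono) auto
      finally show "Bx ^ N < (H + 1) ^ (K * J)" .
    next
      have "(\<Sum>i<K. real (k * V choose i)) \<le> (\<Sum>i<K. exp G)"
      proof (intro sum_mono)
        fix i assume "i \<in> {..<K}"
        then have "real (k * V choose i) \<le> exp (real K) * s ^ K"
          using RK st by (intro binomial_le_exp) (auto simp: R_def)
        then show "real (k * V choose i) \<le> exp G" using KsG by linarith
      qed
      then have "real J * (\<Sum>i<K. real (k * V choose i)) \<le> real J * (\<Sum>i<K. exp G)" by (intro mult_left_mono) auto
      also have "\<dots> = (real K * real J) * exp G" by simp
      also have "\<dots> \<le> exp G * exp G" using KJe by (intro mult_right_mono) auto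
      finally have jb: "real J * (\<Sum>i<K. real (k * V choose i)) \<le> exp G * exp G" .
      have "real y ^ (J * (U + J)) * (real H * (real J * (\<Sum>i<K. real (k * V choose i)))) \<le>
         exp G * (exp (12 * G) * (exp G * exp G))"
        by (rule mult_mono[OF yG mult_mono[OF H(2) jb]]) (auto intro!: mult_nonneg_nonneg sum_nonneg)
      also have "\<dots> = exp (15 * G)" by (simp flip: exp_add)
      finally show "real y ^ (J * (U + J)) * (real H * (real J * (\<Sum>i<K. real (k * V choose i)))) \<le> real_of_int Bd"
        using Bd by linarith
    next
      show "(real y ^ (J * (U + J)) * (real N * (2 * real H * M / real Bx) + real H * tl)
        + real_of_int Bd * (real (J * V) * 2 ^ (J * V) * \<delta>))
       * (real r * (2 * (real r + 1) * real_of_int Bd ^ r * (2 * real_of_int A) ^ (J * V * r)) ^ (2 * r)) < 1"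
        using final by (simp only: L_def)
    qed (use hyp r J K l Umain H Bd in \<open>auto simp: M_def \<delta>_def Bx_def\<close>)
  qed
qed

section \<open>Thue's theorem\<close>

text \<open>The derivative of order \<open>i\<close> at \<open>a\<close> divided by
  \<open>i!\<close>. The division leaves binomial coefficients in place of falling factorials, so
  integrality is kept and the bounds stay exponential in the degree.\<close>

definition taylor_coeff :: "complex poly \<Rightarrow> complex \<Rightarrow> nat \<Rightarrow> complex" where
  "taylor_coeff P a i = coeff (pcompose P [:a, 1:]) i"

lemma taylor_coeff_eq_sum:
  assumes "degree P \<le> n"
  shows "taylor_coeff P a i = (\<Sum>m\<le>n. coeff P m * of_nat (m choose i) * a ^ (m - i))"
proof -
  have lin: "coeff ([:a, 1:] ^ m) i = of_nat (m choose i) * a ^ (m - i)" for m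
  proof (cases "i \<le> m")
    case False
    then show ?thesis by (simp add: coeff_eq_0 degree_linear_power binomial_eq_0)
  qed (simp add: coeff_linear_poly_power)
  have "degree (map_poly (\<lambda>x. [:x:]) P) = degree P" by (rule degree_map_poly) auto
  then have "pcompose P [:a, 1:] = (\<Sum>m\<le>degree P. smult (coeff P m) ([:a, 1:] ^ m))"
    by (simp add: pcompose_altdef poly_altdef coeff_map_poly)
  then have "taylor_coeff P a i = (\<Sum>m\<le>degree P. coeff P m * of_nat (m choose i) * a ^ (m - i))"
    by (simp add: taylor_coeff_def coeff_sum lin mult.assoc)
  also have "\<dots> = (\<Sum>m\<le>n. coeff P m * of_nat (m choose i) * a ^ (m - i))"
    using assms by (intro sum.mono_neutral_left) (auto simp: coeff_eq_0)
  finally show ?thesis .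
qed

lemma taylor_coeff_diff_smult:
  "taylor_coeff (P - smult v Q) a i = taylor_coeff P a i - v * taylor_coeff Q a i"
  by (simp add: taylor_coeff_def pcompose_diff pcompose_smult)

text \<open>Transfers vanishing at \<open>a\<close> to smallness nearby: if the first
  \<open>M\<close> coefficients at \<open>a\<close> vanish, only powers of \<open>b - a\<close> with
  exponent at least \<open>M - i\<close> remain.\<close>

lemma taylor_coeff_shift:
  assumes "degree P \<le> n"
  shows "taylor_coeff P b i = (\<Sum>m\<le>n. taylor_coeff P a m * of_nat (m choose i) * (b - a) ^ (m - i))"
proof -
  have "pcompose P [:b, 1:] = pcompose (pcompose P [:a, 1:]) [:b - a, 1:]"
    by (simp flip: pcompose_assoc add: pcompose_pCons)
  then have "taylor_coeff P b i = taylor_coeff (pcompose P [:a, 1:]) (b - a) i"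
    by (simp add: taylor_coeff_def)
  also have "\<dots> = (\<Sum>m\<le>n. coeff (pcompose P [:a, 1:]) m * of_nat (m choose i) * (b - a) ^ (m - i))"
    using assms by (intro taylor_coeff_eq_sum) simp
  finally show ?thesis by (simp add: taylor_coeff_def)
qed

lemma power_dvd_of_taylor_coeff:
  assumes "\<And>i. i < M \<Longrightarrow> taylor_coeff P a i = 0"
  shows "[:- a, 1:] ^ M dvd P"
proof -
  have "monom 1 M dvd pcompose P [:a, 1:]"
    using assms by (simp add: monom_1_dvd_iff' taylor_coeff_def)
  then obtain R where "pcompose P [:a, 1:] = monom 1 M * R" by (rule dvdE)
  then have "pcompose (pcompose P [:a, 1:]) [:- a, 1:] = [:- a, 1:] ^ M * pcompose R [:- a, 1:]"
    by (simp add: monom_altdef pcompose_mult pcompose_hom.hom_power pcompose_pCons)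
  moreover have "pcompose (pcompose P [:a, 1:]) [:- a, 1:] = P"
    by (simp flip: pcompose_assoc add: pcompose_pCons)
  ultimately show ?thesis by (metis dvd_triv_left)
qed

lemma binomial_le_two_power: "m \<le> L \<Longrightarrow> m choose i \<le> 2 ^ L"
  by (rule order_trans[OF binomial_le_pow2]) (rule power_increasing, auto)

lemma norm_taylor_coeff_le:
  assumes P: "degree P \<le> L" "\<And>m. norm (coeff P m) \<le> H" and b: "norm b \<le> B" "B \<ge> 1"
  shows "norm (taylor_coeff P b i) \<le> (real L + 1) * (H * (2 * B) ^ L)"
proof -
  have H: "H \<ge> 0" using P(2)[of 0] norm_ge_zero order_trans by blast
  have "norm (taylor_coeff P b i) \<le> (\<Sum>m\<le>L. H * (2 * B) ^ L)"
    unfolding taylor_coeff_eq_sum[OF P(1)]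
  proof (intro order_trans[OF norm_sum] sum_mono)
    fix m assume m: "m \<in> {..L}"
    have c: "real (m choose i) \<le> 2 ^ L" using binomial_le_two_power[of m L i] m by simp
    have "norm b ^ (m - i) \<le> B ^ (m - i)" using b by (intro power_mono) auto
    also have "\<dots> \<le> B ^ L" using m b by (intro power_increasing) auto
    finally have "norm (coeff P m) * real (m choose i) * norm b ^ (m - i) \<le> H * 2 ^ L * B ^ L"
      using P(2)[of m] H c b by (intro mult_mono) auto
    then show "norm (coeff P m * of_nat (m choose i) * b ^ (m - i)) \<le> H * (2 * B) ^ L"
      by (simp add: norm_mult norm_power power_mult_distrib mult_ac)
  qed
  then show ?thesis by (simp add: algebra_simps)
qed

text \<open>The auxiliary polynomial of Thue's method is \<open>P(u) - v Q(u)\<close>, of degree 1 in \<open>v\<close>.\<close>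
lemma thue_polynomials:
  fixes f :: "int poly" and A :: nat
  assumes deg: "degree f = n" "n \<ge> 1" and A: "\<And>i. \<bar>coeff f i\<bar> \<le> int A" "A \<ge> 1"
    and h: "h \<ge> 1" "(h + 2) * (M * n) \<le> h * (2 * (L + 1))"
  shows "\<exists>P Q :: int poly. (P \<noteq> 0 \<or> Q \<noteq> 0) \<and> degree P \<le> L \<and> degree Q \<le> L \<and>
    (\<forall>m. \<bar>coeff P m\<bar> \<le> (4 * (int L + 1) * 2 ^ L * (2 * int A) ^ (L + 1)) ^ h) \<and>
    (\<forall>m. \<bar>coeff Q m\<bar> \<le> (4 * (int L + 1) * 2 ^ L * (2 * int A) ^ (L + 1)) ^ h) \<and>
    (\<forall>\<alpha> :: complex. poly (of_int_poly f) \<alpha> = 0 \<longrightarrow>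
       (\<forall>i<M. taylor_coeff (of_int_poly P) \<alpha> i = \<alpha> * taylor_coeff (of_int_poly Q) \<alpha> i))"
proof -
  define S where "S = {..<2::nat} \<times> {..L}"
  define I where "I = {..<M} \<times> {..<n}"
  have cardS: "card S = 2 * (L + 1)" by (simp add: S_def)
  define Mc where "Mc = 2 * (L + 1) * 2 ^ L * (2 * A) ^ (L + 1)"
  \<comment> \<open>The unknown \<open>(b, m)\<close> is the coefficient of index \<open>m\<close>
    of \<open>P\<close> for \<open>b = 0\<close> and of \<open>Q\<close> for \<open>b = 1\<close>;
    equation \<open>(i, l)\<close> is the coordinate of index \<open>l\<close> of the condition of
    order \<open>i\<close>. These coordinates are the same for every root, so \<open>M*n\<close>
    equations serve all roots at once. The exponent \<open>m - i + b\<close> is at most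
    \<open>L + 1\<close>, the power of the leading coefficient that is cleared; for
    \<open>i > m\<close> the binomial is 0.\<close>
  define e where "e = (\<lambda>(i, l) (b, m). (-1) ^ b * int (m choose i) *
      (lead_coeff f ^ (L + 1 - (m - i + b)) * power_red f (m - i + b) l))"
  have lc: "\<bar>lead_coeff f\<bar> \<le> int A" using A by blast
  have e_bound: "\<bar>e il bm\<bar> \<le> 2 ^ L * (2 * int A) ^ (L + 1)" if "bm \<in> S" for il bm
  proof -
    obtain i l b m where eq: "il = (i, l)" "bm = (b, m)" by (metis surj_pair)
    have bm: "b < 2" "m \<le> L" using that eq by (auto simp: S_def)
    let ?x = "m - i + b"
    have c: "int (m choose i) \<le> 2 ^ L"
      using binomial_le_two_power[of m L i] bm(2) by (metis of_nat_le_iff of_nat_numeral of_nat_power)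
    have "\<bar>lead_coeff f ^ (L + 1 - ?x) * power_red f ?x l\<bar> \<le> (2 * int A) ^ (L + 1 - ?x) * (2 * int A) ^ ?x"
      unfolding abs_mult power_abs using lc A
      by (intro mult_mono power_mono power_red_bound) (auto intro: order_trans[of _ "int A"])
    also have "\<dots> = (2 * int A) ^ (L + 1)" unfolding power_add[symmetric] using bm by simp
    finally have "\<bar>lead_coeff f ^ (L + 1 - ?x) * power_red f ?x l\<bar> \<le> (2 * int A) ^ (L + 1)" .
    then show ?thesis unfolding eq e_def prod.case abs_mult[of "(-1) ^ b * int (m choose i)"]
      using c by (intro mult_mono) (auto simp: abs_mult power_abs)
  qed
  have "\<exists>p. (\<exists>s\<in>S. p s \<noteq> 0) \<and> (\<forall>s. \<bar>p s\<bar> \<le> (2 * int Mc) ^ h) \<and> (\<forall>il\<in>I. (\<Sum>s\<in>S. p s * e il s) = 0)"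
  proof (rule siegel_lemma)
    fix il
    have "(\<Sum>s\<in>S. \<bar>e il s\<bar>) \<le> (\<Sum>s\<in>S. 2 ^ L * (2 * int A) ^ (L + 1))"
      by (intro sum_mono e_bound)
    also have "\<dots> = int (2 * (L + 1)) * (2 ^ L * (2 * int A) ^ (L + 1))"
      by (simp only: sum_constant cardS)
    also have "\<dots> = int Mc" by (simp only: Mc_def of_nat_mult of_nat_power of_nat_numeral mult.assoc)
    finally show "(\<Sum>s\<in>S. \<bar>e il s\<bar>) \<le> int Mc" .
  next
    show "(h + 2) * card I \<le> h * card S" using h by (simp add: I_def S_def)
    have "(0, 0) \<in> S" by (simp add: S_def)
    then show "S \<noteq> {}" by blast
    show "1 \<le> Mc" using A by (simp add: Mc_def Suc_le_eq)
  qed (use h in \<open>auto simp: S_def I_def\<close>)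
  then obtain p where p: "\<exists>s\<in>S. p s \<noteq> 0" "\<And>s. \<bar>p s\<bar> \<le> (2 * int Mc) ^ h"
      "\<And>il. il \<in> I \<Longrightarrow> (\<Sum>s\<in>S. p s * e il s) = 0" by blast
  define P where "P b = (\<Sum>m\<le>L. monom (p (b, m)) m)" for b :: nat
  have coeffP: "coeff (P b) m = (if m \<le> L then p (b, m) else 0)" for b m
    by (simp add: P_def coeff_sum)
  have degP: "degree (P b) \<le> L" for b by (rule degree_le) (auto simp: coeffP)
  have Mc2: "2 * int Mc = 4 * (int L + 1) * 2 ^ L * (2 * int A) ^ (L + 1)"
    by (simp add: Mc_def algebra_simps)
  have bound: "\<bar>coeff (P b) m\<bar> \<le> (4 * (int L + 1) * 2 ^ L * (2 * int A) ^ (L + 1)) ^ h" for b m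
    using p(2)[of "(b, m)"] unfolding Mc2 by (simp add: coeffP)
  have ne: "P 0 \<noteq> 0 \<or> P 1 \<noteq> 0"
  proof -
    obtain b m where bm: "b < 2" "m \<le> L" "p (b, m) \<noteq> 0" using p(1) by (auto simp: S_def)
    then have "coeff (P b) m \<noteq> 0" by (simp add: coeffP)
    then have "P b \<noteq> 0" by auto
    moreover have "b = 0 \<or> b = 1" using bm by auto
    ultimately show ?thesis by auto
  qed
  have vanish: "taylor_coeff (of_int_poly (P 0)) \<alpha> i = \<alpha> * taylor_coeff (of_int_poly (P 1)) \<alpha> i"
    if \<alpha>: "poly (of_int_poly f) \<alpha> = 0" and i: "i < M" for \<alpha> i
  proof -
    define lf where "lf = (of_int (lead_coeff f) :: complex)"
    have lf: "lf \<noteq> 0" using deg by (auto simp: lf_def)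
    have tc: "taylor_coeff (of_int_poly (P b)) \<alpha> i = (\<Sum>m\<le>L. of_int (p (b, m)) * of_nat (m choose i) * \<alpha> ^ (m - i))" for b
      using taylor_coeff_eq_sum[of "of_int_poly (P b)" L \<alpha> i] degP[of b] by (simp add: coeffP)
    have pr: "lf ^ (L + 1) * \<alpha> ^ x = (\<Sum>l<n. lf ^ (L + 1 - x) * of_int (power_red f x l) * \<alpha> ^ l)" if "x \<le> L + 1" for x
    proof -
      have "lf ^ (L + 1) * \<alpha> ^ x = lf ^ (L + 1 - x) * (lf ^ x * \<alpha> ^ x)"
        using that by (simp only: mult.assoc[symmetric] power_add[symmetric]) simp
      also have "\<dots> = (\<Sum>l<n. lf ^ (L + 1 - x) * of_int (power_red f x l) * \<alpha> ^ l)"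
        unfolding lf_def using power_red[OF \<alpha>, of x] deg by (simp add: sum_distrib_left mult_ac)
      finally show ?thesis .
    qed
    have "lf ^ (L + 1) * (taylor_coeff (of_int_poly (P 0)) \<alpha> i - \<alpha> * taylor_coeff (of_int_poly (P 1)) \<alpha> i)
       = (\<Sum>b<2. \<Sum>m\<le>L. (-1) ^ b * of_int (p (b, m)) * of_nat (m choose i) * (lf ^ (L + 1) * \<alpha> ^ (m - i + b)))"
      by (simp add: tc lessThan_nat_numeral lessThan_Suc sum_distrib_left sum_negf algebra_simps)
    also have "\<dots> = (\<Sum>b<2. \<Sum>m\<le>L. \<Sum>l<n. of_int (p (b, m) * e (i, l) (b, m)) * \<alpha> ^ l)"
    proof (intro sum.cong refl)
      fix b m assume "b \<in> {..<2::nat}" "m \<in> {..L}"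
      then have x: "m - i + b \<le> L + 1" by auto
      show "(-1) ^ b * of_int (p (b, m)) * of_nat (m choose i) * (lf ^ (L + 1) * \<alpha> ^ (m - i + b)) =
         (\<Sum>l<n. of_int (p (b, m) * e (i, l) (b, m)) * \<alpha> ^ l)"
        unfolding pr[OF x] by (simp add: e_def lf_def sum_distrib_left mult_ac)
    qed
    also have "\<dots> = (\<Sum>s\<in>S. \<Sum>l<n. of_int (p s * e (i, l) s) * \<alpha> ^ l)"
      unfolding S_def by (subst sum.cartesian_product) (simp add: case_prod_unfold)
    also have "\<dots> = (\<Sum>l<n. of_int (\<Sum>s\<in>S. p s * e (i, l) s) * \<alpha> ^ l)"
      by (subst sum.swap) (simp add: sum_distrib_right)
    also have "\<dots> = 0" using p(3) i by (intro sum.neutral) (auto simp: I_def)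
    finally show ?thesis using lf by simp
  qed
  show ?thesis
    using ne degP bound vanish by (intro exI[of _ "P 0"] exI[of _ "P 1"]) blast
qed

section \<open>Wronskians and nonvanishing\<close>

lemma power_dvd_pderiv:
  fixes p :: "complex poly"
  shows "p ^ m dvd pderiv (p ^ Suc m * R)"
  by (simp only: pderiv_mult pderiv_power_Suc)
     (intro dvd_add dvd_mult[of _ _ R] dvd_mult2 dvd_smult, auto intro: le_imp_power_dvd)

text \<open>The Wronskian does not change when a constant multiple of \<open>Q\<close> is subtracted
  from \<open>P\<close>, and differentiation costs one order of vanishing.\<close>

lemma power_dvd_wronskian:
  fixes P Q :: "complex poly"
  assumes "[:- a, 1:] ^ M dvd P - smult v Q"
  shows "[:- a, 1:] ^ (M - 1) dvd P * pderiv Q - pderiv P * Q"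
proof (cases M)
  case (Suc m)
  obtain R where R: "P - smult v Q = [:- a, 1:] ^ M * R" using assms by (rule dvdE)
  have "P * pderiv Q - pderiv P * Q = (P - smult v Q) * pderiv Q - pderiv (P - smult v Q) * Q"
    by (simp add: pderiv_diff pderiv_smult algebra_simps)
  moreover have "[:- a, 1:] ^ m dvd (P - smult v Q)"
    unfolding R by (intro dvd_mult2 le_imp_power_dvd) (simp add: Suc)
  moreover have "[:- a, 1:] ^ m dvd pderiv (P - smult v Q)"
    unfolding R Suc by (rule power_dvd_pderiv)
  ultimately show ?thesis using Suc by (metis diff_Suc_1 dvd_diff dvd_mult2)
qed simp

text \<open>Subtract the multiple of \<open>Q\<close> that kills the coefficient of index
  \<open>degree Q\<close>. If the difference \<open>R\<close> were nonzero, leading coefficients in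
  \<open>R * pderiv Q = pderiv R * Q\<close> would force \<open>R\<close> and \<open>Q\<close> to
  have the same degree.\<close>

lemma wronskian_zero_imp_proportional:
  fixes P Q :: "complex poly"
  assumes W: "P * pderiv Q - pderiv P * Q = 0" and Q: "Q \<noteq> 0"
  shows "\<exists>c. P = smult c Q"
proof -
  define c where "c = coeff P (degree Q) / lead_coeff Q"
  define R where "R = P - smult c Q"
  have RQ: "R * pderiv Q = pderiv R * Q"
    using W by (simp add: R_def pderiv_diff pderiv_smult algebra_simps)
  have cR: "coeff R (degree Q) = 0" using Q by (simp add: R_def c_def)
  have "R = 0"
  proof (rule ccontr)
    assume R: "R \<noteq> 0"
    have dne: "degree R \<noteq> degree Q" using cR R by (metis leading_coeff_0_iff)
    show False
    proof (cases "degree Q = 0 \<or> degree R = 0")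
      case True
      then have "pderiv Q = 0 \<or> pderiv R = 0" by (auto simp: pderiv_eq_0_iff)
      then have "pderiv Q = 0 \<and> pderiv R = 0" using RQ R Q by auto
      then show False using dne by (simp add: pderiv_eq_0_iff)
    next
      case False
      then obtain q s where qs: "degree Q = Suc q" "degree R = Suc s" by (metis not0_implies_Suc)
      have dq: "degree (pderiv Q) = q" "degree (pderiv R) = s" by (simp_all add: degree_pderiv qs)
      have "coeff (R * pderiv Q) (Suc s + q) = lead_coeff R * (of_nat (Suc q) * lead_coeff Q)"
        using coeff_mult_degree_sum[of R "pderiv Q"] by (simp add: qs dq coeff_pderiv)
      moreover have "coeff (pderiv R * Q) (s + Suc q) = of_nat (Suc s) * lead_coeff R * lead_coeff Q"
        using coeff_mult_degree_sum[of "pderiv R" Q] by (simp add: qs dq coeff_pderiv)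
      ultimately have "(of_nat (Suc q) :: complex) * (lead_coeff R * lead_coeff Q) = of_nat (Suc s) * (lead_coeff R * lead_coeff Q)"
        using RQ by (simp add: mult_ac)
      then have "(of_nat (Suc q) :: complex) = of_nat (Suc s)" using R Q by (subst (asm) mult_right_cancel) auto
      then have "Suc q = Suc s" by (simp only: of_nat_eq_iff)
      then show False using dne qs by simp
    qed
  qed
  then show ?thesis by (auto simp: R_def)
qed

lemma sum_orders_le_degree:
  fixes P :: "complex poly"
  assumes "finite Z" "P \<noteq> 0" "\<And>a. a \<in> Z \<Longrightarrow> [:- a, 1:] ^ e a dvd P"
  shows "(\<Sum>a\<in>Z. e a) \<le> degree P"
proof -
  have e: "e a \<le> order a P" if "a \<in> Z" for a using assms(2) assms(3)[OF that] by (simp add: order_divides)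
  have "(\<Sum>a\<in>Z. e a) \<le> (\<Sum>a\<in>Z. order a P)" by (intro sum_mono e)
  also have "\<dots> = (\<Sum>a\<in>Z \<inter> {a. poly P a = 0}. order a P)"
    using assms(1,2) by (intro sum.mono_neutral_right) (auto simp: order_root)
  also have "\<dots> \<le> (\<Sum>a | poly P a = 0. order a P)"
    using assms(2) by (intro sum_mono2 poly_roots_finite) auto
  also have "\<dots> \<le> degree P" by (rule sum_order_le_degree[OF assms(2)])
  finally show ?thesis .
qed

text \<open>
  The Wronskian of \<open>P\<close> and \<open>Q\<close> vanishes to order \<open>M - 1\<close> at all \<open>n\<close> roots, which leaves little room for a
  zero at \<open>b\<close>.
\<close>
lemma thue_nonvanishing:
  fixes P Q :: "complex poly"
  assumes Z: "finite Z" "card Z = n" and ne: "P \<noteq> 0 \<or> Q \<noteq> 0" and deg: "degree P \<le> L" "degree Q \<le> L"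
    and L: "L < (n - 1) * M" and b: "b \<notin> Z"
    and dvd: "\<And>a. a \<in> Z \<Longrightarrow> [:- a, 1:] ^ M dvd P - smult a Q"
  shows "\<exists>i. i + n * (M - 1) \<le> 2 * L + 1 \<and> taylor_coeff P b i \<noteq> v * taylor_coeff Q b i"
proof (rule ccontr)
  assume contr: "\<not> ?thesis"
  define W where "W = P * pderiv Q - pderiv P * Q"
  have W: "W \<noteq> 0"
  proof
    assume W0: "W = 0"
    have Q0: "Q \<noteq> 0"
    proof
      assume Q: "Q = 0"
      then have "(\<Sum>a\<in>Z. M) \<le> degree P" using Z ne dvd by (intro sum_orders_le_degree) auto
      then have "n * M \<le> L" using Z deg by simp
      moreover have "(n - 1) * M \<le> n * M" by simp
      ultimately show False using L by linarith
    qed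
    \<comment> \<open>Then \<open>P - smult a Q\<close> is a nonzero multiple of \<open>Q\<close>
      for every root \<open>a\<close> other than \<open>c\<close>. So \<open>Q\<close> vanishes to
      order \<open>M\<close> at no fewer than \<open>n - 1\<close> points, too often for its
      degree.\<close>
    obtain c where c: "P = smult c Q" using wronskian_zero_imp_proportional W0 Q0 unfolding W_def by blast
    have "(\<Sum>a\<in>Z - {c}. M) \<le> degree Q"
    proof (rule sum_orders_le_degree)
      fix a assume a: "a \<in> Z - {c}"
      have "P - smult a Q = smult (c - a) Q" by (simp add: c smult_diff_left)
      then show "[:- a, 1:] ^ M dvd Q" using dvd[of a] a dvd_smult_cancel[of _ "c - a" Q] by auto
    qed (use Z Q0 in auto)
    moreover have "n - 1 \<le> card (Z - {c})" using Z by (metis diff_card_le_card_Diff card.empty card_insert_disjoint empty_iff finite.emptyI finite_insert One_nat_def)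
    ultimately have "(n - 1) * M \<le> degree Q" by (metis le_trans mult_le_mono1 sum_constant of_nat_id)
    then show False using L deg by linarith
  qed
  \<comment> \<open>The number of orders \<open>i\<close> in the claimed range. If equality held for
    all of them, \<open>b\<close> would give the Wronskian a zero of order \<open>s - 1\<close>, and
    the orders would add up to \<open>2*L + 1\<close>.\<close>
  define s where "s = 2 * L + 2 - n * (M - 1)"
  show False
  proof (cases "n * (M - 1) \<le> 2 * L + 1")
    case True
    have van: "taylor_coeff (P - smult v Q) b i = 0" if "i < s" for i
      using contr that True unfolding taylor_coeff_diff_smult s_def by auto
    have b1: "[:- b, 1:] ^ (s - 1) dvd W"
      unfolding W_def by (rule power_dvd_wronskian[OF power_dvd_of_taylor_coeff[OF van]])
    have "(\<Sum>a\<in>insert b Z. if a = b then s - 1 else M - 1) \<le> degree W"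
      using Z W b1 power_dvd_wronskian[OF dvd] b by (intro sum_orders_le_degree) (auto simp: W_def)
    also have "(\<Sum>a\<in>insert b Z. if a = b then s - 1 else M - 1) = s - 1 + (\<Sum>a\<in>Z. M - 1)"
    proof -
      have "(\<Sum>a\<in>Z. if a = b then s - 1 else M - 1) = (\<Sum>a\<in>Z. M - 1)"
        using b by (intro sum.cong) auto
      then show ?thesis using Z b by simp
    qed
    finally have ge: "s - 1 + n * (M - 1) \<le> degree W" using Z by simp
    have le: "degree W \<le> 2 * L"
      unfolding W_def using deg degree_pderiv[of P] degree_pderiv[of Q]
      by (intro degree_diff_le order_trans[OF degree_mult_le]) auto
    show False using ge le True by (simp add: s_def)
  next
    case False
    have "(\<Sum>a\<in>Z. M - 1) \<le> degree W"
      using Z W power_dvd_wronskian[OF dvd] by (intro sum_orders_le_degree) (auto simp: W_def)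
    moreover have "degree W \<le> 2 * L"
      unfolding W_def using deg degree_pderiv[of P] degree_pderiv[of Q]
      by (intro degree_diff_le order_trans[OF degree_mult_le]) auto
    ultimately show False using False Z by simp
  qed
qed

section \<open>Two good approximations and the improved exponent\<close>

lemma coeff_le_l1_norm: "\<bar>coeff p i\<bar> \<le> l1_norm p"
proof (cases "i \<le> degree p")
  case True
  then show ?thesis unfolding l1_norm_def by (intro member_le_sum[of i "{..degree p}" "\<lambda>i. \<bar>coeff p i\<bar>"]) auto
qed (simp add: coeff_eq_0 l1_norm_nonneg)

text \<open>With \<open>L\<close> about \<open>(n/2 + 1/40) M\<close> and \<open>i\<close> at most
  about \<open>M/20\<close>, the left side is about \<open>(0.95 n - 0.1) M\<close> and the right
  side about \<open>(0.505 n + 1.03) M\<close>. The condition \<open>n >= 3\<close> decides, and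
  \<open>M >= 60 n\<close> absorbs the terms without \<open>M\<close>.\<close>

lemma thue_exponent_arithmetic:
  fixes n M L i :: nat
  assumes n: "n \<ge> 3" and M: "M \<ge> 60 * n" and L: "40 * L \<le> (20 * n + 1) * M + 40"
    and i: "20 * i \<le> M + 60 + 20 * n"
  shows "(real n - 1/10) * (real M - real i) > real L + real L / 100 + real M + 1"
proof -
  define b where "b = 445/1000 * real n - 112025/100000"
  have n3: "real n \<ge> 3" using n by simp
  have b: "b > 0" using n3 by (simp add: b_def)
  have M': "real M \<ge> 60 * real n" using M by linarith
  have "real (40 * L) \<le> real ((20 * n + 1) * M + 40)" using L by (simp only: of_nat_le_iff)
  then have L': "real L \<le> (real n / 2 + 1/40) * real M + 1" by (simp add: algebra_simps)
  have "real (20 * i) \<le> real (M + 60 + 20 * n)" using i by (simp only: of_nat_le_iff)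
  then have i': "real M - real i \<ge> 95/100 * real M - 3 - real n" by simp
  define nm nn Mb where "nm = real n * real M" and "nn = real n * real n" and "Mb = real M * b"
  have "60 * real n * b \<le> Mb" unfolding Mb_def using M' b by (intro mult_right_mono) auto
  moreover have "60 * real n * b = 267/10 * nn - 67215/1000 * real n"
    by (simp add: b_def nn_def field_simps)
  moreover have "3 * real n \<le> nn" unfolding nn_def using n3 by (intro mult_right_mono) auto
  ultimately have key: "Mb > nn + 29/10 * real n + 2" using n3 by linarith
  have "(real n - 1/10) * (real M - real i) \<ge> (real n - 1/10) * (95/100 * real M - 3 - real n)"
    using i' n3 by (intro mult_left_mono) auto
  moreover have "(real n - 1/10) * (95/100 * real M - 3 - real n) =
      95/100 * nm - 95/1000 * real M - nn - 29/10 * real n + 3/10"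
    by (simp add: nm_def nn_def field_simps)
  ultimately have lhs: "(real n - 1/10) * (real M - real i) \<ge> 95/100 * nm - 95/1000 * real M - nn - 29/10 * real n + 3/10"
    by (simp only:)
  have "real L + real L / 100 \<le> 101/100 * ((real n / 2 + 1/40) * real M + 1)"
    using mult_left_mono[OF L', of "101/100"] by simp
  moreover have "101/100 * ((real n / 2 + 1/40) * real M + 1) = 505/1000 * nm + 2525/100000 * real M + 101/100"
    by (simp add: nm_def field_simps)
  ultimately have rhs: "real L + real L / 100 \<le> 505/1000 * nm + 2525/100000 * real M + 101/100"
    by (simp only:)
  have "Mb = 445/1000 * nm - 112025/100000 * real M"
    by (simp add: Mb_def b_def nm_def field_simps)
  then show ?thesis using key lhs rhs by linarith
qed

text \<open>Multiplied by \<open>q1^L * q2\<close> the difference is a nonzero integer.\<close>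

lemma rational_lower_bound:
  fixes P Q :: "int poly"
  assumes deg: "degree P \<le> L" "degree Q \<le> L" and q: "q1 \<ge> 1" "q2 \<ge> (1::nat)"
    and ne: "taylor_coeff (of_int_poly P) (of_int p1 / of_nat q1) i \<noteq>
        of_int p2 / of_nat q2 * taylor_coeff (of_int_poly Q) (of_int p1 / of_nat q1) i"
  shows "1 \<le> real q1 ^ L * real q2 * norm (taylor_coeff (of_int_poly P) (of_int p1 / of_nat q1) i -
        of_int p2 / of_nat q2 * taylor_coeff (of_int_poly Q) (of_int p1 / of_nat q1) i)"
proof -
  let ?b = "of_int p1 / of_nat q1 :: complex"
  define t where "t R = (\<Sum>m\<le>L. coeff R m * int (m choose i) * (p1 ^ (m - i) * int q1 ^ (L - (m - i))))" for R :: "int poly"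
  have t: "of_nat q1 ^ L * taylor_coeff (of_int_poly R) ?b i = of_int (t R)" if "degree R \<le> L" for R
  proof -
    have "of_nat q1 ^ L * taylor_coeff (of_int_poly R) ?b i =
        (\<Sum>m\<le>L. of_int (coeff R m) * of_nat (m choose i) * (of_nat q1 ^ L * ?b ^ (m - i)))"
      using taylor_coeff_eq_sum[of "of_int_poly R" L ?b i] that by (simp add: sum_distrib_left mult_ac)
    also have "\<dots> = (\<Sum>m\<le>L. of_int (coeff R m) * of_nat (m choose i) * (of_int p1 ^ (m - i) * of_nat q1 ^ (L - (m - i))))"
    proof (intro sum.cong refl)
      fix m assume "m \<in> {..L}"
      then have "(of_nat q1 :: complex) ^ L = of_nat q1 ^ (L - (m - i)) * of_nat q1 ^ (m - i)"
        by (simp flip: power_add)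
      then show "of_int (coeff R m) * of_nat (m choose i) * (of_nat q1 ^ L * ?b ^ (m - i)) =
         of_int (coeff R m) * of_nat (m choose i) * (of_int p1 ^ (m - i) * of_nat q1 ^ (L - (m - i)))"
        using q by (simp add: power_divide)
    qed
    finally show ?thesis by (simp add: t_def)
  qed
  let ?D = "taylor_coeff (of_int_poly P) ?b i - of_int p2 / of_nat q2 * taylor_coeff (of_int_poly Q) ?b i"
  have "of_nat q1 ^ L * of_nat q2 * ?D = of_nat q2 * (of_nat q1 ^ L * taylor_coeff (of_int_poly P) ?b i) -
       of_int p2 * (of_nat q1 ^ L * taylor_coeff (of_int_poly Q) ?b i)"
    using q by (simp add: field_simps)
  also have "\<dots> = of_int (int q2 * t P - p2 * t Q)" by (simp add: t deg)
  finally have eq: "of_nat q1 ^ L * of_nat q2 * ?D = of_int (int q2 * t P - p2 * t Q)" .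
  have "of_nat q1 ^ L * of_nat q2 * ?D \<noteq> 0" using ne q by simp
  then have "int q2 * t P - p2 * t Q \<noteq> 0" unfolding eq by (metis of_int_0)
  then have "1 \<le> \<bar>int q2 * t P - p2 * t Q\<bar>" by linarith
  then have "1 \<le> norm (of_int (int q2 * t P - p2 * t Q) :: complex)"
    unfolding norm_of_int by linarith
  then show ?thesis unfolding eq[symmetric] by (simp add: norm_mult norm_power)
qed

text \<open>Let \<open>M\<close> satisfy \<open>q1^M <= q2 < q1^(M+1)\<close>. Then the error of the
  first approximation to the power \<open>M - i\<close> and the error of the second have the same
  upper bound, a power of \<open>q1\<close>. The nonzero rational number built from both is at least
  \<open>1/(q1^L * q2)\<close>, and this is larger. Thue's method reaches every exponent above
  \<open>n/2 + 1\<close>; \<open>n - 1/10\<close> leaves room for crude constants down to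
  \<open>n = 3\<close>.\<close>

lemma thue_two_approximations:
  fixes f :: "int poly" and \<alpha> :: complex
  defines "Z \<equiv> {z :: complex. poly (of_int_poly f) z = 0}"
  assumes deg: "degree f = n" "n \<ge> 3" and Z: "card Z = n" and \<alpha>: "\<alpha> \<in> Z"
  shows "\<exists>q0::nat. q0 \<ge> 2 \<and> (\<forall>p1 p2 :: int. \<forall>q1 q2 :: nat. q1 \<ge> q0 \<longrightarrow> q2 \<ge> q1 ^ (60 * n) \<longrightarrow>
     of_int p1 / of_nat q1 \<notin> Z \<longrightarrow>
     norm (of_int p1 / of_nat q1 - \<alpha>) < real q1 powr - (real n - 1/10) \<longrightarrow>
     norm (of_int p2 / of_nat q2 - \<alpha>) < real q2 powr - (real n - 1/10) \<longrightarrow> False)"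
proof -
  define A where "A = nat (l1_norm f) + 1"
  have A: "\<bar>coeff f i\<bar> \<le> int A" "A \<ge> 1" for i
    using coeff_le_l1_norm[of f i] l1_norm_nonneg[of f] by (auto simp: A_def)
  have finZ: "finite Z" using Z deg by (metis card.infinite not_numeral_le_zero)
  define B where "B = 2 + norm \<alpha>"
  define D where "D = (64 * real A ^ 2) ^ (40 * n)"
  define c where "c = 16 * B\<^sup>2 * D"
  have B: "B \<ge> 2" "norm \<alpha> \<le> B" "1 + norm \<alpha> \<le> B" by (auto simp: B_def)
  have D: "D \<ge> 1" unfolding D_def using A
    by (intro one_le_power) (metis (no_types, opaque_lifting) mult_ge1_I one_le_numeral one_le_power of_nat_1 of_nat_le_iff)
  have c: "c \<ge> 1" "4 * B * D \<le> c"
  proof -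
    have "1 * 1 \<le> 16 * B * B" using B by (intro mult_mono) auto
    then have "1 * 1 \<le> 16 * B * B * D" using D by (intro mult_mono) auto
    then show "c \<ge> 1" by (simp add: c_def power2_eq_square)
    have "4 * B * D * 1 \<le> 4 * B * D * (4 * B)" using B D by (intro mult_left_mono) auto
    then show "4 * B * D \<le> c" by (simp add: c_def power2_eq_square mult_ac)
  qed
  \<comment> \<open>For \<open>q1 >= q0\<close> the factor \<open>2 * c^L\<close> costs at most
    \<open>q1^(L/100)\<close>, the term \<open>L/100\<close> in
    \<open>thue_exponent_arithmetic\<close>.\<close>
  define q0 where "q0 = nat \<lceil>(2 * c) ^ 100\<rceil> + 2"
  have q0: "real q0 \<ge> (2 * c) ^ 100" "q0 \<ge> 2" by (auto simp: q0_def) linarith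
  define \<kappa> where "\<kappa> = real n - 1/10"
  have \<kappa>: "\<kappa> > 0" using deg by (simp add: \<kappa>_def)
  show ?thesis
  proof (intro exI[of _ q0] conjI allI impI q0(2))
    fix p1 p2 :: int and q1 q2 :: nat
    assume q1: "q1 \<ge> q0" and q2: "q2 \<ge> q1 ^ (60 * n)" and b1Z: "of_int p1 / of_nat q1 \<notin> Z"
      and near1: "norm (of_int p1 / of_nat q1 - \<alpha>) < real q1 powr - (real n - 1/10)"
      and near2: "norm (of_int p2 / of_nat q2 - \<alpha>) < real q2 powr - (real n - 1/10)"
    define b1 b2 where "b1 = (of_int p1 / of_nat q1 :: complex)" and "b2 = (of_int p2 / of_nat q2 :: complex)"
    have q1_2: "q1 \<ge> 2" using q1 q0 by simp
    have "1 \<le> q1 ^ (60 * n)" using q1_2 by simp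
    then have q2_1: "q2 \<ge> 1" using q2 by linarith
    obtain M where M: "q1 ^ M \<le> q2" "q2 < q1 ^ (M + 1)" using ex_power_ivl1[OF q1_2 q2_1] by blast
    have "q1 ^ (60 * n) < q1 ^ (M + 1)" using q2 M by linarith
    then have "60 * n < M + 1" using q1_2 power_less_imp_less_exp[of q1 "60 * n" "M + 1"] by simp
    then have M60: "M \<ge> 60 * n" by simp
    \<comment> \<open>The number \<open>2*(L + 1)\<close> of unknowns exceeds the number
      \<open>M*n\<close> of equations by at least \<open>M/20\<close>, as Siegel's lemma requires
      for the exponent \<open>h = 40*n\<close>.\<close>
    define L where "L = (20 * n * M + M) div 40 + 1"
    have L: "40 * L \<le> (20 * n + 1) * M + 40" "40 * L \<ge> (20 * n + 1) * M" "L \<ge> 1"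
      by (auto simp: L_def algebra_simps)
    have siegel: "(40 * n + 2) * (M * n) \<le> (40 * n) * (2 * (L + 1))"
    proof -
      have "2 * n * ((20 * n + 1) * M) \<le> 2 * n * (40 * L)" by (rule mult_le_mono2[OF L(2)])
      then show ?thesis by (simp add: algebra_simps)
    qed
    define H where "H = (4 * (int L + 1) * 2 ^ L * (2 * int A) ^ (L + 1)) ^ (40 * n)"
    have n1: "n \<ge> 1" "40 * n \<ge> 1" using deg by auto
    obtain P Q :: "int poly" where pq: "P \<noteq> 0 \<or> Q \<noteq> 0" "degree P \<le> L" "degree Q \<le> L"
       "\<forall>m. \<bar>coeff P m\<bar> \<le> H" "\<forall>m. \<bar>coeff Q m\<bar> \<le> H"
       "\<forall>a :: complex. poly (of_int_poly f) a = 0 \<longrightarrow>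
          (\<forall>i<M. taylor_coeff (of_int_poly P) a i = a * taylor_coeff (of_int_poly Q) a i)"
      using thue_polynomials[OF deg(1) n1(1) A n1(2) siegel, folded H_def] by (elim exE conjE) (rule that)
    have PQ: "P \<noteq> 0 \<or> Q \<noteq> 0" "degree P \<le> L" "degree Q \<le> L"
       "\<And>m. \<bar>coeff P m\<bar> \<le> H" "\<And>m. \<bar>coeff Q m\<bar> \<le> H"
       "\<And>a i. a \<in> Z \<Longrightarrow> i < M \<Longrightarrow> taylor_coeff (of_int_poly P) a i = a * taylor_coeff (of_int_poly Q) a i"
      using pq unfolding Z_def by blast+
    have HD: "real_of_int H \<le> D ^ L"
    proof -
      have "real L + 1 \<le> 2 ^ L" using of_nat_le_iff[of "Suc L" "2 ^ L", where 'a = real] less_exp[of L] by simp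
      moreover have "(4::real) ^ 1 \<le> 4 ^ L" using L(3) by (intro power_increasing) auto
      moreover have "(2 * real A) ^ (L + 1) \<le> (2 * real A) ^ (2 * L)" using L(3) A by (intro power_increasing) auto
      ultimately have "4 * (real L + 1) * 2 ^ L * (2 * real A) ^ (L + 1) \<le> 4 ^ L * 2 ^ L * 2 ^ L * (2 * real A) ^ (2 * L)"
        by (intro mult_mono) auto
      also have "\<dots> = (4 * 2 * 2 * (2 * real A) ^ 2) ^ L"
        by (simp only: power_mult_distrib power_mult)
      also have "\<dots> = (64 * real A ^ 2) ^ L" by (simp add: power2_eq_square mult_ac)
      finally have "(4 * (real L + 1) * 2 ^ L * (2 * real A) ^ (L + 1)) ^ (40 * n) \<le> ((64 * real A ^ 2) ^ L) ^ (40 * n)"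
        by (intro power_mono) auto
      moreover have "((64 * real A ^ 2) ^ L) ^ (40 * n) = D ^ L"
        by (simp only: D_def power_mult[symmetric] mult.commute)
      moreover have "real_of_int H = (4 * (real L + 1) * 2 ^ L * (2 * real A) ^ (L + 1)) ^ (40 * n)"
        by (simp add: H_def)
      ultimately show ?thesis by (simp only:)
    qed
    let ?P = "of_int_poly P :: complex poly" and ?Q = "of_int_poly Q :: complex poly"
    have dvd: "[:- a, 1:] ^ M dvd ?P - smult a ?Q" if "a \<in> Z" for a
      by (rule power_dvd_of_taylor_coeff) (simp add: taylor_coeff_diff_smult PQ(6)[OF that])
    have Lless: "L < (n - 1) * M"
    proof -
      have "3 \<le> M" using M60 deg by linarith
      obtain n' where n': "n = n' + 3" using deg(2) by (metis add.commute le_Suc_ex)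
      have "40 * L < 40 * ((n - 1) * M)" using L(1) \<open>3 \<le> M\<close> by (simp add: n' algebra_simps)
      then show ?thesis by simp
    qed
    obtain i where i: "i + n * (M - 1) \<le> 2 * L + 1" "taylor_coeff ?P b1 i \<noteq> b2 * taylor_coeff ?Q b1 i"
      using thue_nonvanishing[of Z n ?P ?Q L M b1 b2] finZ Z PQ Lless b1Z dvd by (auto simp: b1_def)
    have i20: "20 * i \<le> M + 60 + 20 * n"
    proof -
      obtain M' where M': "M = Suc M'" using M60 deg by (cases M) auto
      show ?thesis using i(1) L(1) unfolding M' by (simp add: algebra_simps)
    qed
    have iM: "i \<le> M" using i20 M60 deg by linarith
    define \<delta>1 \<delta>2 where "\<delta>1 = norm (b1 - \<alpha>)" and "\<delta>2 = norm (b2 - \<alpha>)"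
    have rq1: "real q1 \<ge> 2" "real q1 > 1" using q1_2 by auto
    have \<delta>1: "\<delta>1 < real q1 powr - \<kappa>" using near1 by (simp add: \<delta>1_def b1_def \<kappa>_def)
    have "real q1 powr - \<kappa> \<le> 1" using rq1 \<kappa> by (simp add: powr_le_one_le powr_minus field_simps ge_one_powr_ge_zero)
    then have \<delta>1_1: "\<delta>1 \<le> 1" "\<delta>1 \<ge> 0" using \<delta>1 by (auto simp: \<delta>1_def)
    have nb1: "norm b1 \<le> B" using \<delta>1_1 norm_triangle_ineq2[of b1 \<alpha>] by (simp add: \<delta>1_def B_def)
    have Hn: "norm (coeff ?P m) \<le> D ^ L" "norm (coeff ?Q m) \<le> D ^ L" for m
    proof -
      have "real_of_int \<bar>coeff P m\<bar> \<le> real_of_int H" "real_of_int \<bar>coeff Q m\<bar> \<le> real_of_int H"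
        using PQ(4,5) by (simp_all only: of_int_le_iff)
      then show "norm (coeff ?P m) \<le> D ^ L" "norm (coeff ?Q m) \<le> D ^ L" using HD by simp_all
    qed
    have L2: "real L + 1 \<le> 2 ^ L" using of_nat_le_iff[of "Suc L" "2 ^ L", where 'a = real] less_exp[of L] by simp
    have tcb: "norm (taylor_coeff R b l) \<le> (4 * B * D) ^ L"
      if "R = ?P \<or> R = ?Q" "norm b \<le> B" for R b l
    proof -
      have "norm (taylor_coeff R b l) \<le> (real L + 1) * (D ^ L * (2 * B) ^ L)"
        using that PQ(2,3) Hn B by (intro norm_taylor_coeff_le) auto
      also have "\<dots> \<le> 2 ^ L * (D ^ L * (2 * B) ^ L)" using L2 D B by (intro mult_right_mono) auto
      also have "\<dots> = (4 * B * D) ^ L" by (simp add: power_mult_distrib mult_ac flip: power_mult_distrib[of 2 2])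
      finally show ?thesis .
    qed
    define R where "R = ?P - smult \<alpha> ?Q"
    have degR: "degree R \<le> L" unfolding R_def using PQ(2,3)
      by (intro degree_diff_le order_trans[OF degree_smult_le]) auto
    have tR: "norm (taylor_coeff R b1 i) \<le> c ^ L * \<delta>1 ^ (M - i)"
    proof -
      have "norm (taylor_coeff R b1 i) \<le> (\<Sum>m\<le>L. (B * (4 * B * D) ^ L) * 2 ^ L * \<delta>1 ^ (M - i))"
        unfolding taylor_coeff_shift[OF degR, of b1 i \<alpha>]
      proof (intro order_trans[OF norm_sum] sum_mono)
        fix m assume m: "m \<in> {..L}"
        show "norm (taylor_coeff R \<alpha> m * of_nat (m choose i) * (b1 - \<alpha>) ^ (m - i)) \<le> (B * (4 * B * D) ^ L) * 2 ^ L * \<delta>1 ^ (M - i)"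
        proof (cases "m < M")
          case True
          then have "taylor_coeff R \<alpha> m = 0" using PQ(6)[OF \<alpha>] by (simp add: R_def taylor_coeff_diff_smult)
          then show ?thesis using B D \<delta>1_1 by simp
        next
          case False
          have "norm (taylor_coeff R \<alpha> m) \<le> norm (taylor_coeff ?P \<alpha> m) + norm \<alpha> * norm (taylor_coeff ?Q \<alpha> m)"
            unfolding R_def taylor_coeff_diff_smult using norm_triangle_ineq4 by (metis norm_mult)
          also have "\<dots> \<le> (4 * B * D) ^ L + norm \<alpha> * (4 * B * D) ^ L"
            using tcb B by (intro add_mono mult_left_mono) auto
          also have "\<dots> = (1 + norm \<alpha>) * (4 * B * D) ^ L" by (simp add: algebra_simps)
          also have "\<dots> \<le> B * (4 * B * D) ^ L" using B D by (intro mult_right_mono) auto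
          finally have e1: "norm (taylor_coeff R \<alpha> m) \<le> B * (4 * B * D) ^ L" .
          have e2: "real (m choose i) \<le> 2 ^ L" using binomial_le_two_power[of m L i] m by simp
          have e3: "\<delta>1 ^ (m - i) \<le> \<delta>1 ^ (M - i)" using False \<delta>1_1 by (intro power_decreasing) auto
          have "norm (taylor_coeff R \<alpha> m) * real (m choose i) * \<delta>1 ^ (m - i) \<le> (B * (4 * B * D) ^ L) * 2 ^ L * \<delta>1 ^ (M - i)"
            using e1 e2 e3 B D \<delta>1_1 by (intro mult_mono) auto
          then show ?thesis by (simp add: norm_mult norm_power \<delta>1_def)
        qed
      qed
      also have "\<dots> = (real L + 1) * (B * ((4 * B * D) ^ L * 2 ^ L)) * \<delta>1 ^ (M - i)" by (simp add: algebra_simps)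
      also have "\<dots> \<le> c ^ L * \<delta>1 ^ (M - i)"
      proof (intro mult_right_mono)
        have "B \<le> B ^ L" using B L(3) power_increasing[of 1 L B] by auto
        then have "(real L + 1) * (B * ((4 * B * D) ^ L * 2 ^ L)) \<le> 2 ^ L * (B ^ L * ((4 * B * D) ^ L * 2 ^ L))"
          using L2 B D by (intro mult_mono mult_right_mono) auto
        also have "\<dots> = (2 * (B * (4 * B * D * 2))) ^ L" by (simp only: power_mult_distrib)
        also have "2 * (B * (4 * B * D * 2)) = c" by (simp add: c_def power2_eq_square)
        finally show "(real L + 1) * (B * ((4 * B * D) ^ L * 2 ^ L)) \<le> c ^ L" .
      qed (use \<delta>1_1 in auto)
      finally show ?thesis .
    qed
    have "taylor_coeff ?P b1 i - b2 * taylor_coeff ?Q b1 i = taylor_coeff R b1 i - (b2 - \<alpha>) * taylor_coeff ?Q b1 i"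
      by (simp add: R_def taylor_coeff_diff_smult algebra_simps)
    then have "norm (taylor_coeff ?P b1 i - b2 * taylor_coeff ?Q b1 i) \<le> norm (taylor_coeff R b1 i) + \<delta>2 * norm (taylor_coeff ?Q b1 i)"
      unfolding \<delta>2_def using norm_triangle_ineq4 by (metis norm_mult)
    also have "\<dots> \<le> c ^ L * \<delta>1 ^ (M - i) + \<delta>2 * c ^ L"
    proof (intro add_mono tR mult_left_mono)
      have "norm (taylor_coeff ?Q b1 i) \<le> (4 * B * D) ^ L" using tcb nb1 by blast
      also have "\<dots> \<le> c ^ L" using c B D by (intro power_mono) auto
      finally show "norm (taylor_coeff ?Q b1 i) \<le> c ^ L" .
    qed (simp add: \<delta>2_def)
    finally have upper: "norm (taylor_coeff ?P b1 i - b2 * taylor_coeff ?Q b1 i) \<le> c ^ L * (\<delta>1 ^ (M - i) + \<delta>2)"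
      by (simp add: algebra_simps)
    define x where "x = \<kappa> * (real M - real i)"
    have d1: "\<delta>1 ^ (M - i) \<le> real q1 powr - x"
    proof -
      have "\<delta>1 ^ (M - i) \<le> (real q1 powr - \<kappa>) ^ (M - i)" using \<delta>1 \<delta>1_1 by (intro power_mono) auto
      also have "\<dots> = real q1 powr (- \<kappa> * real (M - i))" using rq1 by (simp add: powr_power mult.commute)
      finally show ?thesis using iM by (simp add: x_def of_nat_diff)
    qed
    have d2: "\<delta>2 \<le> real q1 powr - x"
    proof -
      have "\<delta>2 \<le> real q2 powr - \<kappa>" using near2 by (simp add: \<delta>2_def b2_def \<kappa>_def)
      also have "\<dots> \<le> (real q1 ^ M) powr - \<kappa>"
      proof (rule powr_mono2')
        show "real q1 ^ M \<le> real q2" using M(1) by (metis of_nat_le_iff of_nat_power)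
      qed (use \<kappa> rq1 in auto)
      also have "\<dots> = real q1 powr (- (\<kappa> * real M))" using rq1 by (simp add: powr_powr mult.commute flip: powr_realpow)
      also have "\<dots> \<le> real q1 powr - x" using rq1 \<kappa> by (intro powr_mono) (auto simp: x_def algebra_simps)
      finally show ?thesis .
    qed
    have "1 \<le> real q1 ^ L * real q2 * norm (taylor_coeff ?P b1 i - b2 * taylor_coeff ?Q b1 i)"
      unfolding b1_def b2_def using PQ(2,3) q1_2 q2_1 i(2) by (intro rational_lower_bound) (auto simp: b1_def b2_def)
    also have "\<dots> \<le> real q1 ^ L * real q1 ^ (M + 1) * (c ^ L * (\<delta>1 ^ (M - i) + \<delta>2))"
    proof -
      have "real q2 \<le> real q1 ^ (M + 1)" using M(2) by (metis less_imp_le of_nat_le_iff of_nat_power)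
      then show ?thesis using upper c by (intro mult_mono) (auto simp: \<delta>1_def \<delta>2_def)
    qed
    also have "\<dots> \<le> real q1 ^ L * real q1 ^ (M + 1) * (c ^ L * (2 * real q1 powr - x))"
      using d1 d2 c by (intro mult_left_mono) auto
    also have "\<dots> = real q1 powr (real L + real M + 1) * (2 * c ^ L) * real q1 powr - x"
      using rq1 by (simp add: powr_add powr_realpow mult_ac)
    also have "\<dots> \<le> real q1 powr (real L + real M + 1) * real q1 powr (real L / 100) * real q1 powr - x"
    proof (intro mult_right_mono mult_left_mono)
      have p100: "(2 * c) powr real 100 = (2 * c) ^ 100" using c by (intro powr_realpow) auto
      have "2 * c ^ L \<le> 2 ^ L * c ^ L" using c L(3) power_increasing[of 1 L "2::real"] by (intro mult_right_mono) auto
      also have "\<dots> = (2 * c) ^ L" by (simp add: power_mult_distrib)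
      also have "\<dots> = (2 * c) powr real L" using c by (subst powr_realpow) auto
      also have "\<dots> = ((2 * c) ^ 100) powr (real L / 100)" unfolding p100[symmetric] powr_powr by simp
      also have "\<dots> \<le> real q1 powr (real L / 100)" using q0 q1 c by (intro powr_mono2) auto
      finally show "2 * c ^ L \<le> real q1 powr (real L / 100)" .
    qed auto
    also have "\<dots> = real q1 powr (real L + real M + 1 + real L / 100 - x)"
      by (simp flip: powr_add add: algebra_simps)
    finally have "real L + real M + 1 + real L / 100 - x \<ge> 0"
      using rq1 powr_less_one[of "real q1" "real L + real M + 1 + real L / 100 - x"] by (meson less_le_not_le linorder_not_le)
    moreover have "x > real L + real L / 100 + real M + 1"
      unfolding x_def \<kappa>_def using thue_exponent_arithmetic[OF deg(2) M60 L(1) i20] .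
    ultimately show False by linarith
  qed
qed

text \<open>The constant is ineffective: the bound \<open>Q\<close> for the denominators of bad
  approximations comes from one unknown bad approximation of large denominator, if there is any. The
  finitely many bad ones then enter \<open>c\<close> through a minimum.\<close>

lemma thue_approximation:
  fixes f :: "int poly" and \<alpha> :: complex
  defines "Z \<equiv> {z :: complex. poly (of_int_poly f) z = 0}"
  assumes deg: "degree f = n" "n \<ge> 3" and Z: "card Z = n" and \<alpha>: "\<alpha> \<in> Z"
  shows "\<exists>c>0. \<forall>(p :: int) (q :: nat). q \<ge> 1 \<longrightarrow> of_int p / of_nat q \<notin> Z \<longrightarrow>
     norm (of_int p / of_nat q - \<alpha>) \<ge> c * real q powr - (real n - 1/10)"
proof -
  define \<kappa> where "\<kappa> = real n - 1/10"
  define bad where "bad = {(p :: int, q :: nat). q \<ge> 1 \<and> of_int p / of_nat q \<notin> Z \<and>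
      norm (of_int p / of_nat q - \<alpha>) < real q powr - \<kappa>}"
  obtain q0 :: nat where q0: "q0 \<ge> 2" "\<And>(p1 :: int) (p2 :: int) q1 q2. q1 \<ge> q0 \<Longrightarrow> q2 \<ge> q1 ^ (60 * n) \<Longrightarrow>
     of_int p1 / of_nat q1 \<notin> Z \<Longrightarrow> norm (of_int p1 / of_nat q1 - \<alpha>) < real q1 powr - \<kappa> \<Longrightarrow>
     norm (of_int p2 / of_nat q2 - \<alpha>) < real q2 powr - \<kappa> \<Longrightarrow> False"
    using thue_two_approximations[OF deg, of \<alpha>] Z \<alpha> unfolding Z_def \<kappa>_def by blast
  have "\<exists>Q. \<forall>(p, q)\<in>bad. q \<le> Q"
  proof (cases "\<exists>(p, q)\<in>bad. q \<ge> q0")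
    case True
    then obtain p1 q1 where "(p1, q1) \<in> bad" "q1 \<ge> q0" by auto
    then have "q \<le> q1 ^ (60 * n)" if "(p, q) \<in> bad" for p q
      using q0(2)[of q1 q p1 p] that unfolding bad_def by (smt (verit) mem_Collect_eq nat_le_linear old.prod.case)
    then show ?thesis by blast
  next
    case False
    then have "\<forall>(p, q)\<in>bad. q \<le> q0" by auto
    then show ?thesis by blast
  qed
  then obtain Q where Q: "\<And>p q. (p, q) \<in> bad \<Longrightarrow> q \<le> Q" by blast
  have "bad \<subseteq> {- \<lceil>real Q * (1 + norm \<alpha>)\<rceil>..\<lceil>real Q * (1 + norm \<alpha>)\<rceil>} \<times> {..Q}"
  proof clarify
    fix p q assume pq: "(p, q) \<in> bad"
    have q: "q \<ge> 1" "q \<le> Q" using pq Q by (auto simp: bad_def)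
    have "norm (of_int p / of_nat q - \<alpha>) < real q powr - \<kappa>" using pq by (auto simp: bad_def)
    also have "\<dots> \<le> real q powr 0" using q deg by (intro powr_mono) (auto simp: \<kappa>_def)
    finally have "norm (of_int p / of_nat q - \<alpha>) < 1" using q by simp
    then have "norm (of_int p / of_nat q :: complex) \<le> 1 + norm \<alpha>"
      using norm_triangle_ineq2[of "of_int p / of_nat q" \<alpha>] by linarith
    then have "\<bar>real_of_int p\<bar> \<le> real q * (1 + norm \<alpha>)" using q by (simp add: norm_divide field_simps)
    also have "\<dots> \<le> real Q * (1 + norm \<alpha>)" using q by (intro mult_right_mono) auto
    finally show "p \<in> {- \<lceil>real Q * (1 + norm \<alpha>)\<rceil>..\<lceil>real Q * (1 + norm \<alpha>)\<rceil>} \<and> q \<in> {..Q}"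
      using q by (auto simp: abs_le_iff) linarith+
  qed
  then have fin: "finite bad" by (rule finite_subset) auto
  define g where "g = (\<lambda>(p :: int, q :: nat). norm (of_int p / of_nat q - \<alpha>) * real q powr \<kappa>)"
  define c where "c = Min (insert 1 (g ` bad))"
  have gpos: "g s > 0" if "s \<in> bad" for s
    using that \<alpha> by (auto simp: bad_def g_def intro!: mult_pos_pos)
  have c: "c > 0" "c \<le> 1" "\<And>s. s \<in> bad \<Longrightarrow> c \<le> g s"
    unfolding c_def using fin gpos by (auto simp: Min_gr_iff)
  show ?thesis
  proof (intro exI[of _ c] conjI allI impI c(1))
    fix p :: int and q :: nat assume q: "q \<ge> 1" and nZ: "of_int p / of_nat q \<notin> Z"
    have qpos: "real q powr \<kappa> > 0" using q by simp
    show "norm (of_int p / of_nat q - \<alpha>) \<ge> c * real q powr - (real n - 1/10)"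
    proof (cases "(p, q) \<in> bad")
      case True
      then have "c \<le> norm (of_int p / of_nat q - \<alpha>) * real q powr \<kappa>" using c(3) by (auto simp: g_def)
      then show ?thesis using qpos unfolding \<kappa>_def[symmetric] by (simp add: powr_minus field_simps)
    next
      case False
      then have "norm (of_int p / of_nat q - \<alpha>) \<ge> 1 * real q powr - \<kappa>" using q nZ by (auto simp: bad_def)
      moreover have "c * real q powr - \<kappa> \<le> 1 * real q powr - \<kappa>" using c by (intro mult_right_mono) auto
      ultimately show ?thesis by (simp add: \<kappa>_def)
    qed
  qed
qed

section \<open>Small values of binary forms\<close>

definition hom_form :: "int poly \<Rightarrow> int \<Rightarrow> int \<Rightarrow> int" where
  "hom_form f x y = (\<Sum>i\<le>degree f. coeff f i * x ^ i * y ^ (degree f - i))"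

lemma hom_form_scale: "hom_form f (g * x) (g * y) = g ^ degree f * hom_form f x y"
  unfolding hom_form_def sum_distrib_left
proof (intro sum.cong refl)
  fix i assume "i \<in> {..degree f}"
  then have "g ^ degree f = g ^ i * g ^ (degree f - i)" by (simp flip: power_add)
  then show "coeff f i * (g * x) ^ i * (g * y) ^ (degree f - i) = g ^ degree f * (coeff f i * x ^ i * y ^ (degree f - i))"
    by (simp add: power_mult_distrib)
qed

lemma card_roots_rsquarefree:
  fixes p :: "complex poly"
  assumes "rsquarefree p"
  shows "card {z. poly p z = 0} = degree p"
proof -
  have p: "p \<noteq> 0" using assms by (simp add: rsquarefree_def)
  have "degree p = degree (smult (lead_coeff p) (\<Prod>z | poly p z = 0. [:- z, 1:]))"
    using complex_poly_decompose_rsquarefree[OF assms] by simp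
  also have "\<dots> = degree (\<Prod>z | poly p z = 0. [:- z, 1:])" using p by simp
  also have "\<dots> = card {z. poly p z = 0}" by (subst degree_prod_eq_sum_degree) auto
  finally show ?thesis ..
qed

lemma hom_form_factorization:
  assumes sq: "rsquarefree (of_int_poly f :: complex poly)"
  shows "(of_int (hom_form f x y) :: complex) =
    of_int (lead_coeff f) * (\<Prod>a | poly (of_int_poly f) a = 0. of_int x - a * of_int y)"
proof (cases "y = 0")
  case True
  have "hom_form f x y = (\<Sum>i\<in>{degree f}. coeff f i * x ^ i * y ^ (degree f - i))"
    unfolding hom_form_def by (rule sum.mono_neutral_right) (auto simp: True)
  then show ?thesis using card_roots_rsquarefree[OF sq] True by simp
next
  case False
  let ?n = "degree f" and ?Z = "{a :: complex. poly (of_int_poly f) a = 0}"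
  have "(of_int (hom_form f x y) :: complex) = of_int y ^ ?n * poly (of_int_poly f) (of_int x / of_int y)"
    unfolding poly_of_int_poly_eq_sum[OF order_refl] hom_form_def sum_distrib_left of_int_sum
  proof (intro sum.cong refl)
    fix i assume "i \<in> {..?n}"
    then have "(of_int y :: complex) ^ ?n = of_int y ^ i * of_int y ^ (?n - i)" by (simp flip: power_add)
    then show "(of_int (coeff f i * x ^ i * y ^ (?n - i)) :: complex) = of_int y ^ ?n * (of_int (coeff f i) * (of_int x / of_int y) ^ i)"
      using False by (simp add: power_divide)
  qed
  also have "poly (of_int_poly f) (of_int x / of_int y) = of_int (lead_coeff f) * (\<Prod>a\<in>?Z. of_int x / of_int y - a)"
    by (subst complex_poly_decompose_rsquarefree[OF sq, symmetric]) (simp add: poly_prod)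
  also have "of_int y ^ ?n * (of_int (lead_coeff f) * (\<Prod>a\<in>?Z. of_int x / of_int y - a)) =
      of_int (lead_coeff f) * (\<Prod>a\<in>?Z. of_int y * (of_int x / of_int y - a))"
    using card_roots_rsquarefree[OF sq] by (simp add: prod.distrib)
  also have "(\<Prod>a\<in>?Z. of_int y * (of_int x / of_int y - a)) = (\<Prod>a\<in>?Z. of_int x - a * of_int y)"
    using False by (intro prod.cong refl) (simp add: field_simps)
  finally show ?thesis .
qed

text \<open>Factor the form over the roots. If \<open>x\<close> dominates \<open>y\<close>, every
  factor has the order of the height. Otherwise \<open>y\<close> has the order of the height, and
  only the factor of the nearest root can be small, because the others are at least half the root
  separation times \<open>y\<close>.\<close>

lemma hom_form_near_root:
  fixes f :: "int poly"
  defines "Z \<equiv> {z :: complex. poly (of_int_poly f) z = 0}"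
  assumes sq: "rsquarefree (of_int_poly f :: complex poly)" and n: "degree f = n" "n \<ge> 1"
  shows "\<exists>C\<ge>1. \<forall>x y :: int.
    real_of_int (max \<bar>x\<bar> \<bar>y\<bar>) ^ n \<le> C * \<bar>real_of_int (hom_form f x y)\<bar> \<or>
    (y \<noteq> 0 \<and> (\<exists>a\<in>Z. norm (of_int x / of_int y - a) * real_of_int (max \<bar>x\<bar> \<bar>y\<bar>) ^ n \<le> C * \<bar>real_of_int (hom_form f x y)\<bar>))"
proof -
  have cardZ: "card Z = n" using card_roots_rsquarefree[OF sq] n by (simp add: Z_def)
  have finZ: "finite Z" using cardZ n by (metis card.infinite not_one_le_zero)
  have Zne: "Z \<noteq> {}" using cardZ n by auto
  define A where "A = 1 + (\<Sum>a\<in>Z. norm a)"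
  have A: "norm a + 1 \<le> A" if "a \<in> Z" for a
    using member_le_sum[of a Z norm] that finZ by (simp add: A_def)
  have A1: "A \<ge> 1" by (simp add: A_def sum_nonneg)
  define D where "D = (\<lambda>(a, b). norm (a - b)) ` {(a, b) \<in> Z \<times> Z. a \<noteq> b}"
  have finD: "finite D" unfolding D_def by (intro finite_imageI finite_subset[OF _ finite_cartesian_product[OF finZ finZ]]) auto
  define \<sigma> where "\<sigma> = Min (insert 1 D)"
  have \<sigma>: "\<sigma> > 0" "\<sigma> \<le> 1" unfolding \<sigma>_def using finD by (auto simp: D_def Min_gr_iff)
  have sep: "\<sigma> \<le> norm (a - b)" if "a \<in> Z" "b \<in> Z" "a \<noteq> b" for a b
    unfolding \<sigma>_def using finD that by (intro Min_le) (auto simp: D_def)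
  define C where "C = (2 * A) ^ n * (2 / \<sigma>) ^ n"
  have s2: "2 / \<sigma> \<ge> 1" using \<sigma> by simp
  have C2: "2 ^ n \<le> C" "(2 * A) ^ n * (2 / \<sigma>) ^ (n - 1) \<le> C" "C \<ge> 1"
  proof -
    have p: "(2::real) ^ n \<le> (2 * A) ^ n" using A1 by (intro power_mono) auto
    have "(2 / \<sigma>) ^ n \<ge> 1" using s2 by (rule one_le_power)
    then have "2 ^ n * 1 \<le> C" unfolding C_def using p A1 by (intro mult_mono) auto
    then show "2 ^ n \<le> C" by simp
    moreover have "(1::real) \<le> 2 ^ n" by simp
    ultimately show "C \<ge> 1" by linarith
    show "(2 * A) ^ n * (2 / \<sigma>) ^ (n - 1) \<le> C" unfolding C_def using s2 A1
      by (intro mult_left_mono power_increasing) auto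
  qed
  have lc0: "lead_coeff f \<noteq> 0" using n by auto
  have lc: "1 \<le> \<bar>real_of_int (lead_coeff f)\<bar>" using lc0 by linarith
  have hom: "\<bar>real_of_int (hom_form f x y)\<bar> \<ge> (\<Prod>a\<in>Z. norm (of_int x - a * of_int y))" for x y
  proof -
    have "\<bar>real_of_int (hom_form f x y)\<bar> = norm (of_int (hom_form f x y) :: complex)" by simp
    also have "\<dots> = \<bar>real_of_int (lead_coeff f)\<bar> * (\<Prod>a\<in>Z. norm (of_int x - a * of_int y))"
      unfolding hom_form_factorization[OF sq] norm_mult prod_norm[symmetric] Z_def by simp
    also have "\<dots> \<ge> 1 * (\<Prod>a\<in>Z. norm (of_int x - a * of_int y))"
      using lc by (intro mult_right_mono prod_nonneg) auto
    finally show ?thesis by simp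
  qed
  show ?thesis
  proof (intro exI[of _ C] conjI allI C2(3))
    fix x y :: int
    define X where "X = real_of_int (max \<bar>x\<bar> \<bar>y\<bar>)"
    show "real_of_int (max \<bar>x\<bar> \<bar>y\<bar>) ^ n \<le> C * \<bar>real_of_int (hom_form f x y)\<bar> \<or>
      (y \<noteq> 0 \<and> (\<exists>a\<in>Z. norm (of_int x / of_int y - a) * real_of_int (max \<bar>x\<bar> \<bar>y\<bar>) ^ n \<le> C * \<bar>real_of_int (hom_form f x y)\<bar>))"
      unfolding X_def[symmetric]
    proof (cases "2 * A * \<bar>real_of_int y\<bar> \<le> \<bar>real_of_int x\<bar>")
      case True
      have yx: "\<bar>real_of_int y\<bar> \<le> \<bar>real_of_int x\<bar>"
      proof -
        have "1 * \<bar>real_of_int y\<bar> \<le> 2 * A * \<bar>real_of_int y\<bar>" using A1 by (intro mult_right_mono) auto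
        then show ?thesis using True by linarith
      qed
      have "\<bar>y\<bar> \<le> \<bar>x\<bar>" using yx by linarith
      then have X: "X = \<bar>real_of_int x\<bar>" by (simp add: X_def)
      have "(\<Prod>a\<in>Z. X / 2) \<le> (\<Prod>a\<in>Z. norm (of_int x - a * of_int y))"
      proof (intro prod_mono conjI)
        fix a assume a: "a \<in> Z"
        have "norm a * \<bar>real_of_int y\<bar> \<le> A * \<bar>real_of_int y\<bar>" using A[OF a] by (intro mult_right_mono) auto
        then have "norm (a * of_int y) \<le> \<bar>real_of_int x\<bar> / 2" using True by (simp add: norm_mult)
        then show "X / 2 \<le> norm (of_int x - a * of_int y)"
          using norm_triangle_ineq2[of "of_int x" "a * of_int y"] by (simp add: X)
      qed (simp add: X)
      then have "(X / 2) ^ n \<le> \<bar>real_of_int (hom_form f x y)\<bar>" using hom[of x y] cardZ by simp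
      then have "X ^ n \<le> 2 ^ n * \<bar>real_of_int (hom_form f x y)\<bar>" by (simp add: power_divide field_simps)
      also have "\<dots> \<le> C * \<bar>real_of_int (hom_form f x y)\<bar>" using C2 by (intro mult_right_mono) auto
      finally show "X ^ n \<le> C * \<bar>real_of_int (hom_form f x y)\<bar> \<or> (y \<noteq> 0 \<and> (\<exists>a\<in>Z. norm (of_int x / of_int y - a) * X ^ n \<le> C * \<bar>real_of_int (hom_form f x y)\<bar>))" ..
    next
      case False
      have y: "y \<noteq> 0" using False by auto
      define w where "w = (of_int x / of_int y :: complex)"
      have Xy: "X \<le> 2 * A * \<bar>real_of_int y\<bar>"
      proof -
        have "1 * \<bar>real_of_int y\<bar> \<le> 2 * A * \<bar>real_of_int y\<bar>" using A1 by (intro mult_right_mono) auto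
        then show ?thesis using False by (auto simp: X_def max_def)
      qed
      obtain a where a: "a \<in> Z" "\<And>b. b \<in> Z \<Longrightarrow> norm (w - a) \<le> norm (w - b)"
        using ex_min_if_finite[of "(\<lambda>b. norm (w - b)) ` Z"] finZ Zne by (auto simp: not_less)
      have fac: "norm (of_int x - b * of_int y) = \<bar>real_of_int y\<bar> * norm (w - b)" for b
      proof -
        have "of_int x - b * of_int y = of_int y * (w - b)" using y by (simp add: w_def field_simps)
        then show ?thesis by (simp add: norm_mult)
      qed
      have "(\<Prod>b\<in>Z - {a}. \<bar>real_of_int y\<bar> * (\<sigma> / 2)) \<le> (\<Prod>b\<in>Z - {a}. norm (of_int x - b * of_int y))"
      proof (intro prod_mono conjI)
        fix b assume b: "b \<in> Z - {a}"
        have "\<sigma> \<le> norm ((w - b) - (w - a))" using sep[of a b] a(1) b by (auto simp: norm_minus_commute)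
        also have "\<dots> \<le> norm (w - b) + norm (w - a)" by (rule norm_triangle_ineq4)
        also have "\<dots> \<le> 2 * norm (w - b)" using a(2)[of b] b by simp
        finally show "\<bar>real_of_int y\<bar> * (\<sigma> / 2) \<le> norm (of_int x - b * of_int y)"
          unfolding fac by (intro mult_left_mono) auto
      qed (use \<sigma> in auto)
      then have p1: "(\<bar>real_of_int y\<bar> * (\<sigma> / 2)) ^ (n - 1) \<le> (\<Prod>b\<in>Z - {a}. norm (of_int x - b * of_int y))"
        using cardZ a(1) finZ by simp
      have "\<bar>real_of_int y\<bar> * norm (w - a) * (\<bar>real_of_int y\<bar> * (\<sigma> / 2)) ^ (n - 1) \<le>
         norm (of_int x - a * of_int y) * (\<Prod>b\<in>Z - {a}. norm (of_int x - b * of_int y))"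
        unfolding fac[of a] using p1 by (intro mult_left_mono) auto
      also have "\<dots> = (\<Prod>b\<in>Z. norm (of_int x - b * of_int y))" using finZ a(1) by (simp add: prod.remove)
      also have "\<dots> \<le> \<bar>real_of_int (hom_form f x y)\<bar>" by (rule hom)
      finally have h: "\<bar>real_of_int y\<bar> * norm (w - a) * (\<bar>real_of_int y\<bar> * (\<sigma> / 2)) ^ (n - 1) \<le> \<bar>real_of_int (hom_form f x y)\<bar>" .
      have yn: "\<bar>real_of_int y\<bar> ^ n = \<bar>real_of_int y\<bar> * \<bar>real_of_int y\<bar> ^ (n - 1)" using n by (simp add: power_eq_if)
      have e: "\<bar>real_of_int y\<bar> * norm (w - a) * (\<bar>real_of_int y\<bar> * (\<sigma> / 2)) ^ (n - 1) =
          norm (w - a) * \<bar>real_of_int y\<bar> ^ n * (\<sigma> / 2) ^ (n - 1)"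
        unfolding yn power_mult_distrib by (simp only: mult_ac)
      have "norm (w - a) * X ^ n \<le> norm (w - a) * (2 * A * \<bar>real_of_int y\<bar>) ^ n"
        using Xy by (intro mult_left_mono power_mono) (auto simp: X_def)
      also have "\<dots> = (2 * A) ^ n * (2 / \<sigma>) ^ (n - 1) * (norm (w - a) * \<bar>real_of_int y\<bar> ^ n * (\<sigma> / 2) ^ (n - 1))"
        using \<sigma> by (simp add: power_mult_distrib power_divide)
      also have "\<dots> \<le> (2 * A) ^ n * (2 / \<sigma>) ^ (n - 1) * \<bar>real_of_int (hom_form f x y)\<bar>"
        using h \<sigma> A1 unfolding e by (intro mult_left_mono) auto
      also have "\<dots> \<le> C * \<bar>real_of_int (hom_form f x y)\<bar>" using C2 by (intro mult_right_mono) auto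
      finally show "X ^ n \<le> C * \<bar>real_of_int (hom_form f x y)\<bar> \<or> (y \<noteq> 0 \<and> (\<exists>a\<in>Z. norm (of_int x / of_int y - a) * X ^ n \<le> C * \<bar>real_of_int (hom_form f x y)\<bar>))"
        using y a(1) by (auto simp: w_def)
    qed
  qed
qed

text \<open>In the nontrivial case of \<open>hom_form_near_root\<close> the distance to a root is at
  least a constant times the height to the power \<open>1/10 - n\<close>, and multiplying by the
  height to the power \<open>n\<close> leaves the exponent \<open>1/10\<close>.\<close>

theorem thue_form_lower_bound:
  fixes f :: "int poly"
  assumes sq: "rsquarefree (of_int_poly f :: complex poly)" and n: "degree f \<ge> 3"
  shows "\<exists>c>0. \<forall>x y :: int. hom_form f x y \<noteq> 0 \<longrightarrow>
    c * real_of_int (max \<bar>x\<bar> \<bar>y\<bar>) powr (1/10) \<le> \<bar>real_of_int (hom_form f x y)\<bar>"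
proof -
  define n where "n = degree f"
  define Z where "Z = {z :: complex. poly (of_int_poly f) z = 0}"
  have n3: "n \<ge> 3" using n by (simp add: n_def)
  have cardZ: "card Z = n" using card_roots_rsquarefree[OF sq] by (simp add: Z_def n_def)
  have finZ: "finite Z" using cardZ n3 by (metis card.infinite not_numeral_le_zero)
  have Zne: "Z \<noteq> {}" using cardZ n3 by auto
  define \<kappa> where "\<kappa> = real n - 1/10"
  have "\<forall>a\<in>Z. \<exists>c>0. \<forall>(p :: int) (q :: nat). q \<ge> 1 \<longrightarrow> of_int p / of_nat q \<notin> Z \<longrightarrow>
     norm (of_int p / of_nat q - a) \<ge> c * real q powr - \<kappa>"
    using thue_approximation[of f n] n3 cardZ unfolding Z_def n_def \<kappa>_def by blast
  then obtain c where c: "\<And>a. a \<in> Z \<Longrightarrow> c a > 0" "\<And>a (p :: int) (q :: nat). a \<in> Z \<Longrightarrow> q \<ge> 1 \<Longrightarrow>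
      of_int p / of_nat q \<notin> Z \<Longrightarrow> norm (of_int p / of_nat q - a) \<ge> c a * real q powr - \<kappa>"
    by metis
  define c0 where "c0 = Min (insert 1 (c ` Z))"
  have c0: "c0 > 0" "c0 \<le> 1" "\<And>a. a \<in> Z \<Longrightarrow> c0 \<le> c a"
    unfolding c0_def using finZ c(1) by (auto simp: Min_gr_iff)
  obtain C where C: "C \<ge> 1" "\<And>x y :: int.
    real_of_int (max \<bar>x\<bar> \<bar>y\<bar>) ^ n \<le> C * \<bar>real_of_int (hom_form f x y)\<bar> \<or>
    (y \<noteq> 0 \<and> (\<exists>a\<in>Z. norm (of_int x / of_int y - a) * real_of_int (max \<bar>x\<bar> \<bar>y\<bar>) ^ n \<le> C * \<bar>real_of_int (hom_form f x y)\<bar>))"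
    using hom_form_near_root[OF sq, of n] n3 unfolding Z_def n_def by auto
  show ?thesis
  proof (intro exI[of _ "c0 / C"] conjI allI impI)
    show "c0 / C > 0" using c0 C by simp
  next
    fix x y :: int assume nz: "hom_form f x y \<noteq> 0"
    define X where "X = real_of_int (max \<bar>x\<bar> \<bar>y\<bar>)"
    have "x \<noteq> 0 \<or> y \<noteq> 0"
    proof (rule ccontr)
      assume "\<not> ?thesis"
      then have "hom_form f x y = 0 ^ degree f * hom_form f x y" using hom_form_scale[of f 0 x y] by simp
      then show False using nz n3 by (simp add: n_def power_0_left)
    qed
    then have X1: "X \<ge> 1" by (auto simp: X_def max_def)
    have "c0 * X powr (1/10) \<le> C * \<bar>real_of_int (hom_form f x y)\<bar>"
      using C(2)[of x y] unfolding X_def[symmetric]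
    proof (elim disjE conjE bexE)
      assume h: "X ^ n \<le> C * \<bar>real_of_int (hom_form f x y)\<bar>"
      have "c0 * X powr (1/10) \<le> 1 * X powr real n"
        using c0 X1 n3 by (intro mult_mono powr_mono) auto
      then show ?thesis using h X1 by (simp add: powr_realpow)
    next
      fix a assume y: "y \<noteq> 0" and a: "a \<in> Z" and h: "norm (of_int x / of_int y - a) * X ^ n \<le> C * \<bar>real_of_int (hom_form f x y)\<bar>"
      have w: "(of_int x / of_int y :: complex) = of_int (x * sgn y) / of_nat (nat \<bar>y\<bar>)"
        using y by (auto simp: sgn_if)
      have notZ: "(of_int x / of_int y :: complex) \<notin> Z"
      proof
        assume z: "(of_int x / of_int y :: complex) \<in> Z"
        have "(\<Prod>b\<in>Z. of_int x - b * of_int y) = 0"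
          using z y finZ by (intro prod_zero) (auto intro!: bexI[of _ "of_int x / of_int y"])
        then have "(of_int (hom_form f x y) :: complex) = 0" unfolding hom_form_factorization[OF sq] Z_def by simp
        then show False using nz by simp
      qed
      have yX: "1 \<le> real (nat \<bar>y\<bar>)" "real (nat \<bar>y\<bar>) \<le> X" using y by (auto simp: X_def)
      have "c0 * X powr - \<kappa> \<le> c a * real (nat \<bar>y\<bar>) powr - \<kappa>"
        using c0(1) c0(3)[OF a] c(1)[OF a] yX n3 by (intro mult_mono powr_mono2') (auto simp: \<kappa>_def)
      also have "\<dots> \<le> norm (of_int x / of_int y - a)"
        using c(2)[OF a, of "nat \<bar>y\<bar>" "x * sgn y"] notZ y unfolding w by auto
      finally have "c0 * X powr - \<kappa> * X ^ n \<le> norm (of_int x / of_int y - a) * X ^ n"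
        using X1 by (intro mult_right_mono) auto
      moreover have "X powr - \<kappa> * X ^ n = X powr (1/10)"
        using X1 by (simp add: \<kappa>_def flip: powr_realpow powr_add)
      ultimately show ?thesis using h by (simp add: mult.assoc)
    qed
    then show "c0 / C * real_of_int (max \<bar>x\<bar> \<bar>y\<bar>) powr (1/10) \<le> \<bar>real_of_int (hom_form f x y)\<bar>"
      using C(1) by (simp add: X_def field_simps)
  qed
qed

section \<open>Counting points of large height\<close>

lemma card_int_box:
  fixes Y :: real
  assumes "Y \<ge> 1"
  shows "finite {(x :: int, y :: int). real_of_int (max \<bar>x\<bar> \<bar>y\<bar>) \<le> Y}"
    and "real (card {(x :: int, y :: int). real_of_int (max \<bar>x\<bar> \<bar>y\<bar>) \<le> Y}) \<le> 9 * Y\<^sup>2"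
proof -
  let ?S = "{(x :: int, y :: int). real_of_int (max \<bar>x\<bar> \<bar>y\<bar>) \<le> Y}"
  let ?I = "{- \<lfloor>Y\<rfloor>..\<lfloor>Y\<rfloor>}"
  have sub: "?S \<subseteq> ?I \<times> ?I"
    by (auto simp: le_floor_iff) linarith+
  show "finite ?S" by (rule finite_subset[OF sub]) auto
  have "card ?S \<le> card (?I \<times> ?I)" by (rule card_mono[OF _ sub]) auto
  also have "\<dots> = card ?I * card ?I" by (rule card_cartesian_product)
  finally have "real (card ?S) \<le> real (card ?I) * real (card ?I)" by (metis of_nat_le_iff of_nat_mult)
  moreover have "real (card ?I) \<le> 3 * Y"
  proof -
    have "real (card ?I) = 2 * of_int \<lfloor>Y\<rfloor> + 1" using assms by simp
    then show ?thesis using assms of_int_floor_le[of Y] by linarith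
  qed
  then have "real (card ?I) * real (card ?I) \<le> (3 * Y) * (3 * Y)" using assms by (intro mult_mono) auto
  ultimately show "real (card ?S) \<le> 9 * Y\<^sup>2" by (simp add: power2_eq_square)
qed

text \<open>Division by the common gcd leaves reduced fractions of equal value, which agree up to
  sign.\<close>

lemma int_pair_eq_of_ratio_gcd_sgn:
  fixes x y x' y' :: int
  assumes "x * y' = x' * y" "gcd x y = gcd x' y'" "sgn y = sgn y'" "y \<noteq> 0" "y' \<noteq> 0"
  shows "x = x' \<and> y = y'"
proof -
  define g where "g = gcd x y"
  have g: "g \<noteq> 0" using assms by (simp add: g_def)
  obtain u v where uv: "x = g * u" "y = g * v" "coprime u v"
    using gcd_coprime_exists[of x y] g unfolding g_def by (metis mult.commute)
  obtain u' v' where uv': "x' = g * u'" "y' = g * v'" "coprime u' v'"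
    using gcd_coprime_exists[of x' y'] g assms(2) unfolding g_def by (metis mult.commute)
  have eq: "u * v' = u' * v" using assms(1) g by (simp add: uv uv')
  have "v dvd v'" using eq uv(3) by (metis coprime_commute coprime_dvd_mult_right_iff dvd_triv_right)
  moreover have "v' dvd v" using eq uv'(3) by (metis coprime_commute coprime_dvd_mult_right_iff dvd_triv_right)
  ultimately have "\<bar>v\<bar> = \<bar>v'\<bar>" by (rule zdvd_antisym_abs)
  then have "\<bar>y\<bar> = \<bar>y'\<bar>" by (simp add: uv uv' abs_mult)
  then have y: "y = y'" using assms(3) by (metis mult_sgn_abs)
  then have "x = x'" using assms(1,5) by auto
  with y show ?thesis by blast
qed

text \<open>
  Points at which the form is unusually small are good approximations to a root. Two such
  approximations with different ratios cannot have heights in the same dyadic interval, and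
  Thue's theorem bounds the number of dyadic intervals.
\<close>
lemma card_large_points:
  fixes f :: "int poly" and lam :: real
  assumes sq: "rsquarefree (of_int_poly f :: complex poly)" and n: "degree f = n" "n \<ge> 3"
    and lam: "lam > 2" "real n * (1 - 2 / lam) > 2"
  shows "\<exists>C>0. \<forall>N\<ge>1.
    finite {(x :: int, y :: int). hom_form f x y \<noteq> 0 \<and> \<bar>real_of_int (hom_form f x y)\<bar> \<le> N \<and>
       N powr (lam / (2 * real n)) < real_of_int (max \<bar>x\<bar> \<bar>y\<bar>)} \<and>
    real (card {(x :: int, y :: int). hom_form f x y \<noteq> 0 \<and> \<bar>real_of_int (hom_form f x y)\<bar> \<le> N \<and>
       N powr (lam / (2 * real n)) < real_of_int (max \<bar>x\<bar> \<bar>y\<bar>)}) \<le> C * N powr (lam / (2 * real n))"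
proof -
  define Z where "Z = {z :: complex. poly (of_int_poly f) z = 0}"
  have cardZ: "card Z = n" using card_roots_rsquarefree[OF sq] n by (simp add: Z_def)
  have finZ: "finite Z" using cardZ n by (metis card.infinite not_numeral_le_zero)
  define X where "X = (\<lambda>(x :: int, y :: int). real_of_int (max \<bar>x\<bar> \<bar>y\<bar>))"
  \<comment> \<open>A height \<open>X\<close> above \<open>N^e\<close> turns the value bound
    \<open>N\<close> into \<open>X\<close> to the power \<open>n - \<kappa>\<close>, so
    \<open>x/y\<close> lies within \<open>C1\<close> times \<open>X\<close> to the power
    \<open>-\<kappa>\<close> of a root. The gap principle uses that this exponent exceeds 2.\<close>
  define \<kappa> where "\<kappa> = real n * (1 - 2 / lam)"
  define e where "e = lam / (2 * real n)"
  have e: "e > 1 / real n" "e > 0" using lam n by (auto simp: e_def field_simps)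
  obtain C1 where C1: "C1 \<ge> 1" "\<And>x y :: int.
    real_of_int (max \<bar>x\<bar> \<bar>y\<bar>) ^ n \<le> C1 * \<bar>real_of_int (hom_form f x y)\<bar> \<or>
    (y \<noteq> 0 \<and> (\<exists>a\<in>Z. norm (of_int x / of_int y - a) * real_of_int (max \<bar>x\<bar> \<bar>y\<bar>) ^ n \<le> C1 * \<bar>real_of_int (hom_form f x y)\<bar>))"
    using hom_form_near_root[OF sq n(1)] n(2) unfolding Z_def by auto
  obtain c' where c': "c' > 0" "\<And>x y :: int. hom_form f x y \<noteq> 0 \<Longrightarrow>
    c' * real_of_int (max \<bar>x\<bar> \<bar>y\<bar>) powr (1/10) \<le> \<bar>real_of_int (hom_form f x y)\<bar>"
    using thue_form_lower_bound[OF sq] n by blast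
  define c where "c = min c' 1"
  have c: "c > 0" "c \<le> 1" "\<And>x y :: int. hom_form f x y \<noteq> 0 \<Longrightarrow>
    c * real_of_int (max \<bar>x\<bar> \<bar>y\<bar>) powr (1/10) \<le> \<bar>real_of_int (hom_form f x y)\<bar>"
  proof -
    show "c > 0" "c \<le> 1" using c' by (auto simp: c_def)
    fix x y :: int assume "hom_form f x y \<noteq> 0"
    moreover have "c * real_of_int (max \<bar>x\<bar> \<bar>y\<bar>) powr (1/10) \<le> c' * real_of_int (max \<bar>x\<bar> \<bar>y\<bar>) powr (1/10)"
      by (intro mult_right_mono) (auto simp: c_def)
    ultimately show "c * real_of_int (max \<bar>x\<bar> \<bar>y\<bar>) powr (1/10) \<le> \<bar>real_of_int (hom_form f x y)\<bar>"
      using c'(2)[of x y] by linarith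
  qed
  have \<kappa>: "\<kappa> > 2" using lam by (simp add: \<kappa>_def)
  \<comment> \<open>The first term excludes two distinct ratios in one dyadic interval, which would
    force \<open>K\<close> to the power \<open>\<kappa> - 2\<close> to be at most
    \<open>8*C1\<close>. The term \<open>C1\<close> rules out the first alternative of
    \<open>hom_form_near_root\<close>. Lower points are counted in a box.\<close>
  define X0 where "X0 = 2 * (9 * C1) powr (1 / (\<kappa> - 2)) + C1 + 1"
  have X0: "X0 \<ge> 2 * (9 * C1) powr (1 / (\<kappa> - 2))" "X0 > C1" "X0 \<ge> 1" using C1(1) powr_ge_zero[of "9 * C1" "1 / (\<kappa> - 2)"] unfolding X0_def by linarith+
  \<comment> \<open>The spare exponent: it absorbs the logarithmic number of dyadic intervals, so
    that \<open>N^(1/n)\<close> times the logarithm is at most a constant times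
    \<open>N^e\<close>.\<close>
  define s where "s = e - 1 / real n"
  have s: "s > 0" using e by (simp add: s_def)
  define E0 where "E0 = 20 / s + 20 * ln (1 / c) + 1"
  have E0: "E0 > 0" using s c by (simp add: E0_def add_nonneg_pos)
  define C where "C = 9 * X0\<^sup>2 + real n * E0 * 2 * 3"
  show ?thesis
  proof (intro exI[of _ C] conjI allI impI)
    show "C > 0" using E0 n X0 by (auto simp: C_def intro!: add_nonneg_pos)
  next
    fix N :: real assume N: "N \<ge> 1"
    define B where "B = {(x :: int, y :: int). hom_form f x y \<noteq> 0 \<and> \<bar>real_of_int (hom_form f x y)\<bar> \<le> N \<and>
       N powr (lam / (2 * real n)) < real_of_int (max \<bar>x\<bar> \<bar>y\<bar>)}"
    define Bl where "Bl = {p \<in> B. X p > X0}"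
    have Bsub: "B \<subseteq> {(x, y). real_of_int (max \<bar>x\<bar> \<bar>y\<bar>) \<le> X0} \<union> Bl"
      by (auto simp: Bl_def X_def)
    have Ne: "N powr e \<ge> 1" using N e by (simp add: ge_one_powr_ge_zero)
    have near: "\<exists>a\<in>Z. norm (of_int (fst p) / of_int (snd p) - a) \<le> C1 * X p powr - \<kappa>" and snd0: "snd p \<noteq> 0"
      if p: "p \<in> Bl" for p
    proof -
      obtain x y where pxy: "p = (x, y)" by force
      have Xp: "X p = real_of_int (max \<bar>x\<bar> \<bar>y\<bar>)" by (simp add: X_def pxy)
      have XX0: "X p > X0" and hN: "\<bar>real_of_int (hom_form f x y)\<bar> \<le> N" and NX: "N powr e < X p"
        using p Xp by (auto simp: Bl_def B_def pxy e_def)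
      have X1: "X p > 1" using XX0 X0 by linarith
      have "N = (N powr e) powr (1 / e)" using N e by (simp add: powr_powr)
      also have "\<dots> \<le> X p powr (1 / e)" using NX e by (intro powr_mono2) auto
      also have "1 / e = real n - \<kappa>" using lam n by (simp add: e_def \<kappa>_def field_simps)
      finally have hX: "\<bar>real_of_int (hom_form f x y)\<bar> \<le> X p powr (real n - \<kappa>)" using hN by linarith
      have Xn: "X p ^ n = X p powr (real n - \<kappa>) * X p powr \<kappa>"
        using X1 by (simp flip: powr_add powr_realpow)
      have not1: "\<not> X p ^ n \<le> C1 * \<bar>real_of_int (hom_form f x y)\<bar>"
      proof
        assume "X p ^ n \<le> C1 * \<bar>real_of_int (hom_form f x y)\<bar>"
        also have "\<dots> \<le> C1 * X p powr (real n - \<kappa>)" using hX C1 by (intro mult_left_mono) auto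
        finally have "X p powr \<kappa> * X p powr (real n - \<kappa>) \<le> C1 * X p powr (real n - \<kappa>)" by (simp add: Xn mult_ac)
        then have "X p powr \<kappa> \<le> C1" using X1 by simp
        moreover have "X p powr 1 \<le> X p powr \<kappa>" using X1 \<kappa> by (intro powr_mono) auto
        ultimately show False using XX0 X0 X1 by simp
      qed
      then have y: "y \<noteq> 0" and "\<exists>a\<in>Z. norm (of_int x / of_int y - a) * X p ^ n \<le> C1 * \<bar>real_of_int (hom_form f x y)\<bar>"
        using C1(2)[of x y] by (auto simp: Xp)
      then obtain a where a: "a \<in> Z" "norm (of_int x / of_int y - a) * X p ^ n \<le> C1 * \<bar>real_of_int (hom_form f x y)\<bar>" by auto
      have "norm (of_int x / of_int y - a) * X p powr \<kappa> * X p powr (real n - \<kappa>) \<le> C1 * X p powr (real n - \<kappa>)"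
      proof -
        have "norm (of_int x / of_int y - a) * X p ^ n \<le> C1 * X p powr (real n - \<kappa>)"
          using a(2) C1(1) mult_left_mono[OF hX, of C1] by linarith
        then show ?thesis by (simp add: Xn mult_ac)
      qed
      then have "norm (of_int x / of_int y - a) * X p powr \<kappa> \<le> C1" using X1 by simp
      then have "norm (of_int x / of_int y - a) \<le> C1 * X p powr - \<kappa>" using X1 by (simp add: powr_minus field_simps)
      then show "\<exists>a\<in>Z. norm (of_int (fst p) / of_int (snd p) - a) \<le> C1 * X p powr - \<kappa>"
        using a(1) by (auto simp: pxy)
      show "snd p \<noteq> 0" using y by (simp add: pxy)
    qed
    have "\<exists>k. 2 ^ k \<le> X p \<and> X p < 2 ^ (k + 1)" if p: "p \<in> Bl" for p
    proof -
      obtain x y where pxy: "p = (x, y)" by force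
      define m where "m = nat (max \<bar>x\<bar> \<bar>y\<bar>)"
      have Xp: "X p = real m" by (simp add: X_def pxy m_def)
      have "X p > X0" using p by (simp add: Bl_def)
      then have "m \<ge> 1" using Xp X0 by linarith
      then obtain k where "2 ^ k \<le> m" "m < 2 ^ (k + 1)" using ex_power_ivl1[of 2 m] by auto
      then have "real (2 ^ k) \<le> real m" "real m < real (2 ^ (k + 1))" by (simp_all only: of_nat_le_iff of_nat_less_iff)
      then show ?thesis unfolding Xp by (intro exI[of _ k]) simp
    qed
    then obtain k where k: "\<And>p. p \<in> Bl \<Longrightarrow> 2 ^ k p \<le> X p" "\<And>p. p \<in> Bl \<Longrightarrow> X p < 2 ^ (k p + 1)" by metis
    obtain \<rho> where \<rho>: "\<And>p. p \<in> Bl \<Longrightarrow> \<rho> p \<in> Z"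
      "\<And>p. p \<in> Bl \<Longrightarrow> norm (of_int (fst p) / of_int (snd p) - \<rho> p) \<le> C1 * X p powr - \<kappa>"
      using near by metis
    \<comment> \<open>Root and dyadic exponent determine the ratio, gcd and sign then determine the
      point. The gcd \<open>g\<close> satisfies \<open>g^n <= N\<close>, which gives the main factor
      \<open>N^(1/n)\<close> in the count.\<close>
    define \<phi> where "\<phi> p = (\<rho> p, k p, nat (gcd (fst p) (snd p)), sgn (snd p))" for p
    have inj: "inj_on \<phi> Bl"
    proof (rule inj_onI)
      fix p p' assume p: "p \<in> Bl" and p': "p' \<in> Bl" and eq: "\<phi> p = \<phi> p'"
      define x y x' y' where xy: "x = fst p" "y = snd p" "x' = fst p'" "y' = snd p'"
      have y0: "y \<noteq> 0" "y' \<noteq> 0" using snd0 p p' by (auto simp: xy)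
      define K where "K = (2::real) ^ k p"
      have kk: "k p' = k p" "\<rho> p' = \<rho> p" using eq by (auto simp: \<phi>_def)
      have XK: "K \<le> X p" "X p < 2 * K" "K \<le> X p'" "X p' < 2 * K"
        using k[OF p] k[OF p'] by (auto simp: K_def kk)
      have K1: "K \<ge> 1" by (simp add: K_def)
      have "X0 < 2 * K" using XK p by (auto simp: Bl_def)
      then have "(9 * C1) powr (1 / (\<kappa> - 2)) < K" using X0 by linarith
      then have "((9 * C1) powr (1 / (\<kappa> - 2))) powr (\<kappa> - 2) < K powr (\<kappa> - 2)"
        using \<kappa> by (intro powr_less_mono2) auto
      then have K9: "9 * C1 < K powr (\<kappa> - 2)" using C1 \<kappa> by (simp add: powr_powr)
      have ratio: "x * y' = x' * y"
      proof (rule ccontr)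
        assume ne: "x * y' \<noteq> x' * y"
        have "(of_int x / of_int y - of_int x' / of_int y' :: complex) = of_int (x * y' - x' * y) / of_int (y * y')"
          using y0 by (simp add: field_simps)
        then have "norm (of_int x / of_int y - of_int x' / of_int y' :: complex) = \<bar>real_of_int (x * y' - x' * y)\<bar> / \<bar>real_of_int (y * y')\<bar>"
          by (simp only: norm_divide norm_of_int)
        moreover have "1 \<le> \<bar>real_of_int (x * y' - x' * y)\<bar>" using ne by linarith
        ultimately have "1 / \<bar>real_of_int (y * y')\<bar> \<le> norm (of_int x / of_int y - of_int x' / of_int y' :: complex)"
          by (simp add: divide_right_mono del: of_int_diff of_int_mult)
        also have "\<dots> \<le> norm (of_int x / of_int y - \<rho> p) + norm (of_int x' / of_int y' - \<rho> p)"
        proof -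
          have "(of_int x / of_int y - \<rho> p) - (of_int x' / of_int y' - \<rho> p) = of_int x / of_int y - of_int x' / of_int y'" by simp
          then show ?thesis using norm_triangle_ineq4[of "of_int x / of_int y - \<rho> p" "of_int x' / of_int y' - \<rho> p"] by (simp only:)
        qed
        also have "\<dots> \<le> C1 * X p powr - \<kappa> + C1 * X p' powr - \<kappa>"
          using \<rho>(2)[OF p] \<rho>(2)[OF p'] by (auto simp: kk xy intro!: add_mono)
        also have "\<dots> \<le> C1 * K powr - \<kappa> + C1 * K powr - \<kappa>"
          using XK K1 \<kappa> C1 by (intro add_mono mult_left_mono powr_mono2') auto
        finally have le: "1 / \<bar>real_of_int (y * y')\<bar> \<le> 2 * C1 * K powr - \<kappa>" by simp
        have "\<bar>real_of_int (snd q)\<bar> \<le> X q" for q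
          unfolding X_def case_prod_unfold by (simp only: of_int_abs[symmetric] of_int_le_iff max.cobounded2)
        from this[of p] this[of p'] have "\<bar>real_of_int y\<bar> \<le> 2 * K" "\<bar>real_of_int y'\<bar> \<le> 2 * K"
          using XK unfolding xy by linarith+
        then have "\<bar>real_of_int (y * y')\<bar> \<le> (2 * K) * (2 * K)" unfolding of_int_mult abs_mult using K1
          by (intro mult_mono) auto
        moreover have "\<bar>real_of_int (y * y')\<bar> > 0" using y0 by simp
        ultimately have "1 / (4 * K\<^sup>2) \<le> 1 / \<bar>real_of_int (y * y')\<bar>"
          using K1 by (intro divide_left_mono) (auto simp: power2_eq_square)
        then have "1 / (4 * K\<^sup>2) \<le> 2 * C1 * K powr - \<kappa>" using le by linarith
        then have "1 \<le> 2 * C1 * K powr - \<kappa> * (4 * K\<^sup>2)" using K1 by (subst (asm) pos_divide_le_eq) auto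
        also have "\<dots> = 8 * C1 * (K powr - \<kappa> * K powr 2)" using K1 by simp
        also have "K powr - \<kappa> * K powr 2 = 1 / K powr (\<kappa> - 2)" 
          by (simp only: powr_add[symmetric] powr_minus_divide[symmetric]) simp
        finally have "K powr (\<kappa> - 2) \<le> 8 * C1" using K1 by (simp add: field_simps)
        then show False using K9 C1 by linarith
      qed
      have "gcd x y = gcd x' y'" using eq by (simp add: \<phi>_def xy eq_nat_nat_iff)
      moreover have "sgn y = sgn y'" using eq by (simp add: \<phi>_def xy)
      ultimately have "x = x' \<and> y = y'" using int_pair_eq_of_ratio_gcd_sgn ratio y0 by blast
      then show "p = p'" by (simp add: xy prod_eq_iff)
    qed
    \<comment> \<open>Thue's theorem gives \<open>c\<close> times the height to the power
      \<open>1/10\<close> at most \<open>N\<close>, so the logarithm of the height is at most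
      \<open>10 * ln (N / c)\<close>; \<open>ln 2 > 1/2\<close> doubles the constant for the dyadic
      exponent.\<close>
    define Emax where "Emax = 20 * ln (N / c)"
    define gmax where "gmax = N powr (1 / real n)"
    have Emax: "Emax \<ge> 0" using N c by (simp add: Emax_def)
    have gmax: "gmax \<ge> 1" using N by (simp add: gmax_def ge_one_powr_ge_zero)
    have "\<phi> ` Bl \<subseteq> Z \<times> {..nat \<lfloor>Emax\<rfloor>} \<times> {1..nat \<lfloor>gmax\<rfloor>} \<times> {-1, 0, 1}"
    proof
      fix q assume "q \<in> \<phi> ` Bl"
      then obtain p where p: "p \<in> Bl" "q = \<phi> p" by auto
      define w where "w = nat (gcd (fst p) (snd p))"
      define x y where xy: "x = fst p" "y = snd p"
      have h: "hom_form f x y \<noteq> 0" "\<bar>real_of_int (hom_form f x y)\<bar> \<le> N"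
        using p(1) by (auto simp: Bl_def B_def xy case_prod_unfold)
      have Xp: "X p = real_of_int (max \<bar>x\<bar> \<bar>y\<bar>)" by (simp add: X_def xy case_prod_unfold)
      have X1: "X p \<ge> 1" using p(1) X0 by (simp add: Bl_def)
      have "c * X p powr (1/10) \<le> N" using c(3)[OF h(1)] h(2) by (simp add: Xp)
      then have "X p powr (1/10) \<le> N / c" using c by (simp add: field_simps)
      then have "ln (X p powr (1/10)) \<le> ln (N / c)" using X1 N c by (subst ln_le_cancel_iff) auto
      then have "ln (X p) \<le> 10 * ln (N / c)" using X1 by (simp add: ln_powr)
      moreover have "real (k p) * ln 2 \<le> ln (X p)"
        using k(1)[OF p(1)] X1 by (simp add: ln_realpow[symmetric])
      moreover have "real (k p) * (1/2) \<le> real (k p) * ln 2"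
        using half_less_ln_2 by (intro mult_left_mono) auto
      ultimately have "real (k p) \<le> Emax" by (simp add: Emax_def)
      then have "k p \<le> nat \<lfloor>Emax\<rfloor>" by (simp add: le_nat_floor)
      moreover have "1 \<le> w \<and> w \<le> nat \<lfloor>gmax\<rfloor>"
      proof -
        define g where "g = gcd x y"
        have y0: "y \<noteq> 0" using snd0[OF p(1)] by (simp add: xy)
        then have g0: "g > 0" by (simp add: g_def)
        obtain x1 y1 where 1: "x = g * x1" "y = g * y1" unfolding g_def by (meson dvdE gcd_dvd1 gcd_dvd2)
        have hg: "hom_form f x y = g ^ n * hom_form f x1 y1" unfolding 1 by (simp add: hom_form_scale n)
        then have "hom_form f x1 y1 \<noteq> 0" using h by auto
        then have "\<bar>hom_form f x1 y1\<bar> \<ge> 1" by linarith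
        then have "g ^ n * 1 \<le> g ^ n * \<bar>hom_form f x1 y1\<bar>" using g0 by (intro mult_left_mono) auto
        also have "\<dots> = \<bar>hom_form f x y\<bar>" using g0 by (simp add: hg abs_mult)
        finally have "real_of_int (g ^ n) \<le> real_of_int \<bar>hom_form f x y\<bar>" by (simp only: of_int_le_iff mult_1_right)
        then have "real_of_int g ^ n \<le> N" using h by simp
        then have "(real_of_int g ^ n) powr (1 / real n) \<le> N powr (1 / real n)" using g0 by (intro powr_mono2) auto
        then have "real_of_int g \<le> gmax" using g0 n by (simp add: gmax_def powr_powr flip: powr_realpow)
        then have "real (nat g) \<le> gmax" using g0 by simp
        then have "nat g \<le> nat \<lfloor>gmax\<rfloor>" by (simp add: le_nat_floor)
        moreover have "1 \<le> nat g" using g0 by linarith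
        moreover have "w = nat g" by (simp add: w_def g_def xy)
        ultimately show ?thesis by (simp only:)
      qed
      ultimately show "q \<in> Z \<times> {..nat \<lfloor>Emax\<rfloor>} \<times> {1..nat \<lfloor>gmax\<rfloor>} \<times> {-1, 0, 1}"
        using \<rho>(1)[OF p(1)] unfolding p(2) \<phi>_def w_def[symmetric] by (auto simp: sgn_if)
    qed
    moreover have fin4: "finite (Z \<times> {..nat \<lfloor>Emax\<rfloor>} \<times> {1..nat \<lfloor>gmax\<rfloor>} \<times> {-1, 0, 1::int})" using finZ by auto
    ultimately have finim: "finite (\<phi> ` Bl)" and cim: "card (\<phi> ` Bl) \<le> card (Z \<times> {..nat \<lfloor>Emax\<rfloor>} \<times> {1..nat \<lfloor>gmax\<rfloor>} \<times> {-1, 0, 1::int})"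
      by (auto intro: finite_subset card_mono)
    have "card Bl \<le> n * ((nat \<lfloor>Emax\<rfloor> + 1) * (nat \<lfloor>gmax\<rfloor> * 3))"
    proof -
      have c3: "card {-1, 0, 1::int} = 3" by simp
      have "card (Z \<times> {..nat \<lfloor>Emax\<rfloor>} \<times> {1..nat \<lfloor>gmax\<rfloor>} \<times> {-1, 0, 1::int}) = n * ((nat \<lfloor>Emax\<rfloor> + 1) * (nat \<lfloor>gmax\<rfloor> * 3))"
        by (simp only: card_cartesian_product cardZ c3 card_atMost card_atLeastAtMost) simp
      then show ?thesis using cim card_image[OF inj] by (simp only:)
    qed
    then have "real (card Bl) \<le> real (n * ((nat \<lfloor>Emax\<rfloor> + 1) * (nat \<lfloor>gmax\<rfloor> * 3)))" by (simp only: of_nat_le_iff)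
    also have "\<dots> = real n * ((real (nat \<lfloor>Emax\<rfloor>) + 1) * (real (nat \<lfloor>gmax\<rfloor>) * 3))"
      by (simp only: of_nat_mult of_nat_add of_nat_1 of_nat_numeral)
    also have "\<dots> \<le> real n * ((Emax + 1) * (gmax * 3))"
      using Emax gmax by (intro mult_left_mono mult_mono add_mono mult_right_mono) auto
    also have "\<dots> \<le> real n * ((E0 * N powr s) * (gmax * 3))"
    proof (intro mult_left_mono mult_right_mono)
      have Ns: "N powr s \<ge> 1" using N s by (simp add: ge_one_powr_ge_zero)
      have "ln N \<le> N powr s / s" using ln_powr_bound[of N s] N s by simp
      moreover have "ln (N / c) = ln N + ln (1 / c)" using N c by (simp add: ln_div)
      ultimately have "Emax + 1 \<le> 20 * (N powr s / s) + (20 * ln (1 / c) + 1) * 1" by (simp add: Emax_def)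
      also have "\<dots> \<le> 20 * (N powr s / s) + (20 * ln (1 / c) + 1) * N powr s"
        using Ns c by (intro add_left_mono mult_left_mono) (auto simp: add_nonneg_nonneg)
      also have "\<dots> = E0 * N powr s" by (simp add: E0_def algebra_simps)
      finally show "Emax + 1 \<le> E0 * N powr s" .
    qed (use gmax in auto)
    also have "\<dots> = real n * E0 * 3 * (N powr s * gmax)" by simp
    also have "N powr s * gmax = N powr e" by (simp add: gmax_def s_def flip: powr_add)
    finally have cl: "real (card Bl) \<le> real n * E0 * 2 * 3 * N powr e"
      using E0 Ne by (auto intro: order_trans)
    have finBl: "finite Bl" using finim inj by (rule finite_imageD)
    have finB: "finite B" using finite_subset[OF Bsub] finBl card_int_box(1)[OF X0(3)] by blast
    have "real (card B) \<le> real (card ({(x :: int, y :: int). real_of_int (max \<bar>x\<bar> \<bar>y\<bar>) \<le> X0} \<union> Bl))"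
      using Bsub finBl card_int_box(1)[OF X0(3)] by (intro of_nat_mono card_mono) auto
    also have "\<dots> \<le> real (card {(x :: int, y :: int). real_of_int (max \<bar>x\<bar> \<bar>y\<bar>) \<le> X0}) + real (card Bl)"
      unfolding of_nat_add[symmetric] of_nat_le_iff by (rule card_Un_le)
    also have "\<dots> \<le> 9 * X0\<^sup>2 + real n * E0 * 2 * 3 * N powr e"
      using card_int_box(2)[OF X0(3)] cl by linarith
    also have "\<dots> \<le> 9 * X0\<^sup>2 * N powr e + real n * E0 * 2 * 3 * N powr e"
      using Ne mult_left_mono[OF Ne, of "9 * X0\<^sup>2"] by simp
    also have "\<dots> = C * N powr e" by (simp add: C_def algebra_simps)
    finally have "real (card B) \<le> C * N powr (lam / (2 * real n))" by (simp add: e_def)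
    then show "finite {(x :: int, y :: int). hom_form f x y \<noteq> 0 \<and> \<bar>real_of_int (hom_form f x y)\<bar> \<le> N \<and>
       N powr (lam / (2 * real n)) < real_of_int (max \<bar>x\<bar> \<bar>y\<bar>)}"
      "real (card {(x :: int, y :: int). hom_form f x y \<noteq> 0 \<and> \<bar>real_of_int (hom_form f x y)\<bar> \<le> N \<and>
       N powr (lam / (2 * real n)) < real_of_int (max \<bar>x\<bar> \<bar>y\<bar>)}) \<le> C * N powr (lam / (2 * real n))"
      using finB unfolding B_def by blast+
  qed
qed

section \<open>Lower bounds for forms in powers\<close>

text \<open>Over the roots with multiplicity, each of the \<open>r\<close> factors of
  \<open>p\<close> at \<open>z\<close> is at least the distance to the nearest root, which explains
  the exponent \<open>r\<close>.\<close>

lemma exists_close_root: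
  fixes p :: "complex poly" and z :: complex
  assumes deg: "degree p = r" "r \<ge> 1" and lc: "norm (lead_coeff p) \<ge> 1"
  shows "\<exists>\<theta>. poly p \<theta> = 0 \<and> norm (z - \<theta>) ^ r \<le> norm (poly p z)"
proof -
  obtain A where A: "size A = degree p" "p = smult (lead_coeff p) (\<Prod>x\<in>#A. [:- x, 1:])"
    using alg_closed_imp_factorization[of p] deg by (metis degree_0 not_one_le_zero)
  have Ane: "set_mset A \<noteq> {}" using A deg by auto
  define m where "m = Min ((\<lambda>x. norm (z - x)) ` set_mset A)"
  have fin: "finite ((\<lambda>x. norm (z - x)) ` set_mset A)" by simp
  have "m \<in> (\<lambda>x. norm (z - x)) ` set_mset A" unfolding m_def using Ane by (intro Min_in) auto
  then obtain \<theta> where \<theta>: "\<theta> \<in># A" "m = norm (z - \<theta>)" by auto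
  have m_le: "m \<le> norm (z - x)" if "x \<in># A" for x unfolding m_def using that by (intro Min_le) auto
  have m0: "m \<ge> 0" using \<theta> by simp
  have prod: "m ^ size B \<le> norm (\<Prod>x\<in>#B. z - x)" if "B \<subseteq># A" for B
    using that
  proof (induction B)
    case (add x B)
    have "x \<in># A" using add.prems by (meson insert_subset_eq_iff mset_subset_eqD union_single_eq_member)
    then have "m * m ^ size B \<le> norm (z - x) * norm (\<Prod>x\<in>#B. z - x)"
      using add.IH add.prems m_le m0 by (intro mult_mono) (auto dest: mset_subset_eq_insertD)
    then show ?case by (simp add: norm_mult)
  qed simp
  have ev: "poly (\<Prod>x\<in>#B. [:- x, 1:]) w = (\<Prod>x\<in>#B. w - x)" for B and w :: complex
    by (induction B) (auto simp: algebra_simps)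
  have pz: "poly p w = lead_coeff p * (\<Prod>x\<in>#A. w - x)" for w
    by (subst A(2)) (simp add: ev)
  have "poly p \<theta> = 0" using \<theta>(1) unfolding pz by (simp add: prod_mset_zero_iff) 
  moreover have "norm (z - \<theta>) ^ r \<le> norm (poly p z)"
  proof -
    have "1 * m ^ r \<le> norm (lead_coeff p) * norm (\<Prod>x\<in>#A. z - x)"
      using lc prod[of A] A(1) deg m0 by (intro mult_mono) auto
    then show ?thesis by (simp add: pz norm_mult \<theta>(2))
  qed
  ultimately show ?thesis by blast
qed

lemma hom_form_eq_poly:
  fixes x y :: int
  assumes "y \<noteq> 0"
  shows "real_of_int (hom_form f x y) = real_of_int y ^ degree f * poly (of_int_poly f) (real_of_int x / real_of_int y)"
  unfolding poly_of_int_poly_eq_sum[OF order_refl] hom_form_def sum_distrib_left of_int_sum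
proof (intro sum.cong refl)
  fix i assume "i \<in> {..degree f}"
  then have "real_of_int y ^ degree f = real_of_int y ^ i * real_of_int y ^ (degree f - i)" by (simp flip: power_add)
  then show "real_of_int (coeff f i * x ^ i * y ^ (degree f - i)) =
      real_of_int y ^ degree f * (real_of_int (coeff f i) * (real_of_int x / real_of_int y) ^ i)"
    using assms by (simp add: power_divide)
qed

text \<open>The constant coefficient is a nonzero integer, and for \<open>\<tau> < 1/2\<close> the
  other terms add up to at most \<open>2 * A * \<tau>\<close> by a geometric series. A value of size
  at most 1/2 therefore needs \<open>2 * A * \<tau> >= 1/2\<close>.\<close>

lemma small_value_lower_bound:
  fixes f :: "int poly" and A \<tau> :: real
  assumes A: "\<And>i. \<bar>real_of_int (coeff f i)\<bar> \<le> A" "A \<ge> 1" and c0: "coeff f 0 \<noteq> 0"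
    and \<tau>: "0 < \<tau>" and small: "\<bar>poly (of_int_poly f) \<tau>\<bar> \<le> 1/2"
  shows "1 / (4 * A) \<le> \<tau>"
proof (cases "\<tau> \<ge> 1/2")
  case True
  have "1 / (4 * A) \<le> 1 / 4" using A by (intro divide_left_mono) auto
  then show ?thesis using True by linarith
next
  case False
  let ?n = "degree f"
  have "poly (of_int_poly f) \<tau> = (\<Sum>i\<le>?n. real_of_int (coeff f i) * \<tau> ^ i)"
    by (rule poly_of_int_poly_eq_sum) simp
  also have "\<dots> = real_of_int (coeff f 0) + (\<Sum>i=1..?n. real_of_int (coeff f i) * \<tau> ^ i)"
    unfolding atMost_atLeast0 by (subst sum.atLeast_Suc_atMost) auto
  finally have eq: "poly (of_int_poly f) \<tau> = real_of_int (coeff f 0) + (\<Sum>i=1..?n. real_of_int (coeff f i) * \<tau> ^ i)" .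
  have "\<bar>\<Sum>i=1..?n. real_of_int (coeff f i) * \<tau> ^ i\<bar> \<le> (\<Sum>i=1..?n. A * \<tau> ^ i)"
  proof (intro order_trans[OF sum_abs] sum_mono)
    fix i
    show "\<bar>real_of_int (coeff f i) * \<tau> ^ i\<bar> \<le> A * \<tau> ^ i"
      unfolding abs_mult using A(1)[of i] \<tau> by (intro mult_mono) auto
  qed
  also have "\<dots> \<le> (\<Sum>i=1..?n. A * \<tau> * (1/2) ^ (i - 1))"
  proof (intro sum_mono)
    fix i assume "i \<in> {1..?n}"
    then obtain j where j: "i = Suc j" by (cases i) auto
    have "\<tau> ^ j \<le> (1/2) ^ j" using \<tau> False by (intro power_mono) auto
    then have "A * \<tau> * \<tau> ^ j \<le> A * \<tau> * (1/2) ^ j" using A \<tau> by (intro mult_left_mono) auto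
    then show "A * \<tau> ^ i \<le> A * \<tau> * (1/2) ^ (i - 1)" by (simp add: j mult_ac)
  qed
  also have "\<dots> = A * \<tau> * (\<Sum>i<?n. (1/2) ^ i)"
    unfolding sum_distrib_left by (rule sum.reindex_bij_witness[of _ Suc "\<lambda>i. i - 1"]) auto
  also have "\<dots> \<le> A * \<tau> * 2"
  proof (intro mult_left_mono)
    have "(\<Sum>i<?n. (1/2) ^ i) = 2 * (1 - (1/2::real) ^ ?n)" by (subst sum_gp_strict) auto
    then show "(\<Sum>i<?n. (1/2::real) ^ i) \<le> 2" by simp
  qed (use A \<tau> in auto)
  finally have "\<bar>real_of_int (coeff f 0)\<bar> \<le> 1/2 + A * \<tau> * 2" using small eq by linarith
  moreover have "1 \<le> \<bar>real_of_int (coeff f 0)\<bar>" using c0 by linarith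
  ultimately have "1 \<le> 4 * (A * \<tau>)" by linarith
  then show ?thesis using A by (simp add: field_simps)
qed

text \<open>A smaller value puts \<open>(x/y)^k\<close> within \<open>y\<close> to the power
  \<open>-\<epsilon> * k\<close> of a root, by \<open>exists_close_root\<close>, and bounds
  \<open>(x/y)^k\<close> from below, by \<open>small_value_lower_bound\<close>. The second fact
  supplies the condition that \<open>x/y\<close> is close to 1 in
  \<open>power_near_root_contradiction\<close>.\<close>

lemma power_form_lower_bound_aux:
  fixes r :: nat and \<epsilon> :: real
  assumes r: "r \<ge> 1" and \<epsilon>: "\<epsilon> > 0"
  shows "\<exists>T>0. \<forall>(f :: int poly) (A :: int) (k :: nat) (x :: nat) (y :: nat).
    degree f = r \<longrightarrow> coeff f 0 \<noteq> 0 \<longrightarrow> (\<forall>i. \<bar>coeff f i\<bar> \<le> A) \<longrightarrow> A \<ge> 2 \<longrightarrow> 0 < x \<longrightarrow> x < y \<longrightarrow>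
    T * ln (real_of_int A) \<le> real k \<longrightarrow>
    real y powr (real (k * r) * (1 - \<epsilon>)) \<le> \<bar>real_of_int (hom_form f (int x ^ k) (int y ^ k))\<bar>"
proof -
  obtain T0 where T0: "T0 > 0" "\<And>(f :: int poly) (A :: int) (\<theta> :: complex) (k :: nat) (x :: nat) (y :: nat).
    degree f = r \<and> (\<forall>i. \<bar>coeff f i\<bar> \<le> A) \<and> A \<ge> 2 \<and> poly (of_int_poly f) \<theta> = 0 \<and>
    \<theta> \<noteq> 0 \<and> norm \<theta> \<le> 2 \<and> 0 < x \<and> x < y \<and> T0 * ln (real_of_int A) \<le> real k \<and>
    real k * (1 - real x / real y) \<le> 3 * ln (real_of_int A) \<and>
    norm (of_real ((real x / real y) ^ k) - \<theta>) \<le> real y powr (- \<epsilon> * real k) \<Longrightarrow> False"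
    using power_near_root_contradiction[OF r \<epsilon>] by blast
  \<comment> \<open>The second entry of the maximum gives \<open>\<epsilon> * k >= 1\<close>, so
    that \<open>y >= 2\<close> to the power \<open>-\<epsilon> * k\<close> is at most 1/2.\<close>
  define T where "T = max T0 (1 / (\<epsilon> * ln 2))"
  show ?thesis
  proof (intro exI[of _ T] conjI allI impI)
    show "T > 0" using T0 by (simp add: T_def)
  next
    fix f :: "int poly" and A :: int and k x y :: nat
    assume deg: "degree f = r" and f0: "coeff f 0 \<noteq> 0" and A: "\<forall>i. \<bar>coeff f i\<bar> \<le> A" "A \<ge> 2"
      and xy: "0 < x" "x < y" and k: "T * ln (real_of_int A) \<le> real k"
    have lnA: "ln (real_of_int A) \<ge> ln 2" "ln (2::real) > 0" "ln (real_of_int A) \<ge> 0" using A by auto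
    have k0: "T0 * ln (real_of_int A) \<le> real k"
    proof -
      have "T0 * ln (real_of_int A) \<le> T * ln (real_of_int A)" using lnA by (intro mult_right_mono) (auto simp: T_def)
      then show ?thesis using k by linarith
    qed
    have k1: "1 \<le> \<epsilon> * real k"
    proof -
      have "1 / (\<epsilon> * ln 2) * ln 2 \<le> T * ln (real_of_int A)"
        using lnA \<epsilon> T0(1) by (intro mult_mono) (auto simp: T_def le_max_iff_disj)
      then have "1 / \<epsilon> \<le> real k" using k lnA by simp
      then show ?thesis using \<epsilon> by (simp add: field_simps)
    qed
    define \<tau> where "\<tau> = (real x / real y) ^ k"
    have \<tau>: "0 < \<tau>" "\<tau> \<le> 1" using xy by (auto simp: \<tau>_def intro!: power_le_one)
    have hom: "real_of_int (hom_form f (int x ^ k) (int y ^ k)) = real y ^ (k * r) * poly (of_int_poly f) \<tau>"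
      using hom_form_eq_poly[of "int y ^ k" f "int x ^ k"] xy deg
      by (simp add: \<tau>_def power_divide flip: power_mult)
    show "real y powr (real (k * r) * (1 - \<epsilon>)) \<le> \<bar>real_of_int (hom_form f (int x ^ k) (int y ^ k))\<bar>"
    proof (rule ccontr)
      assume "\<not> ?thesis"
      then have "real y ^ (k * r) * \<bar>poly (of_int_poly f) \<tau>\<bar> < real y powr (real (k * r) * (1 - \<epsilon>))"
        by (simp add: hom abs_mult)
      also have "\<dots> = real y ^ (k * r) * real y powr (- \<epsilon> * real k * real r)"
        using xy by (simp add: algebra_simps flip: powr_realpow powr_add)
      finally have "\<bar>poly (of_int_poly f) \<tau>\<bar> < real y powr (- \<epsilon> * real k * real r)"
        using xy by simp
      moreover have "real y powr (- \<epsilon> * real k * real r) = (real y powr (- \<epsilon> * real k)) ^ r"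
        using xy by (simp add: powr_power mult_ac)
      ultimately have small: "\<bar>poly (of_int_poly f) \<tau>\<bar> < (real y powr (- \<epsilon> * real k)) ^ r" by simp
      have half: "real y powr (- \<epsilon> * real k) \<le> 1/2"
      proof -
        have "real y powr (- \<epsilon> * real k) \<le> real y powr (- 1)" using xy k1 by (intro powr_mono) auto
        also have "\<dots> \<le> 1/2" using xy by (simp add: powr_minus field_simps)
        finally show ?thesis .
      qed
      have "(real y powr (- \<epsilon> * real k)) ^ r \<le> (real y powr (- \<epsilon> * real k)) ^ 1"
        using half r by (intro power_decreasing) auto
      then have small2: "\<bar>poly (of_int_poly f) \<tau>\<bar> \<le> 1/2" using small half by simp
      have Ar: "\<bar>real_of_int (coeff f i)\<bar> \<le> real_of_int A" for i
        using A(1) by (metis of_int_abs of_int_le_iff)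
      have \<tau>A: "1 / (4 * real_of_int A) \<le> \<tau>"
        using small_value_lower_bound[OF Ar _ f0 \<tau>(1) small2] A by simp
      have kd: "real k * (1 - real x / real y) \<le> 3 * ln (real_of_int A)"
      proof -
        have "real x / real y \<le> exp (- (1 - real x / real y))"
          using exp_ge_add_one_self[of "- (1 - real x / real y)"] by simp
        then have "\<tau> \<le> exp (- (1 - real x / real y)) ^ k" unfolding \<tau>_def by (intro power_mono) auto
        also have "\<dots> = exp (- (real k * (1 - real x / real y)))" by (simp add: algebra_simps flip: exp_of_nat_mult)
        finally have "1 / (4 * real_of_int A) \<le> exp (- (real k * (1 - real x / real y)))" using \<tau>A by linarith
        moreover have "exp w \<le> 4 * real_of_int A" if "1 / (4 * real_of_int A) \<le> exp (- w)" for w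
          using that A by (simp add: exp_minus field_simps)
        ultimately have "exp (real k * (1 - real x / real y)) \<le> 4 * real_of_int A" by blast
        \<comment> \<open>\<open>A >= 2\<close> gives \<open>4 * A <= A ^ 3\<close>, the origin of
          the 3 in \<open>3 * ln A\<close>.\<close>
        also have "\<dots> \<le> real_of_int A ^ 3"
        proof -
          have "2 * 2 \<le> real_of_int A * real_of_int A" using A by (intro mult_mono) auto
          then have "4 * real_of_int A \<le> real_of_int A * real_of_int A * real_of_int A" using A by (intro mult_right_mono) auto
          then show ?thesis by (simp add: power3_eq_cube)
        qed
        finally have "ln (exp (real k * (1 - real x / real y))) \<le> ln (real_of_int A ^ 3)"
          using A by (subst ln_le_cancel_iff) auto
        then show ?thesis using A by (simp add: ln_realpow)
      qed
      have lc: "norm (lead_coeff (of_int_poly f :: complex poly)) \<ge> 1"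
      proof -
        have "lead_coeff f \<noteq> 0" using deg r by auto
        then have "1 \<le> \<bar>real_of_int (lead_coeff f)\<bar>" by linarith
        then show ?thesis by simp
      qed
      obtain \<theta> :: complex where \<theta>: "poly (of_int_poly f) \<theta> = 0" "norm (of_real \<tau> - \<theta>) ^ r \<le> norm (poly (of_int_poly f) (of_real \<tau> :: complex))"
        using exists_close_root[of "of_int_poly f" r "of_real \<tau>"] deg r lc by auto
      have "poly (of_int_poly f) (of_real \<tau> :: complex) = of_real (poly (of_int_poly f) \<tau>)"
        by (simp add: poly_of_int_poly_eq_sum[OF order_refl])
      then have "norm (of_real \<tau> - \<theta>) ^ r \<le> (real y powr (- \<epsilon> * real k)) ^ r"
        using \<theta>(2) small by simp
      then have close: "norm (of_real \<tau> - \<theta>) \<le> real y powr (- \<epsilon> * real k)"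
        using r by (subst (asm) power_mono_iff) auto
      have "norm \<theta> \<le> 2"
      proof -
        have "norm \<theta> \<le> norm (of_real \<tau> :: complex) + norm (of_real \<tau> - \<theta>)"
          using norm_triangle_ineq4[of "of_real \<tau>" "of_real \<tau> - \<theta>"] by simp
        then show ?thesis using close half \<tau> by simp
      qed
      moreover have "\<theta> \<noteq> 0"
      proof
        assume "\<theta> = 0"
        then have "poly (of_int_poly f) (0 :: complex) = 0" using \<theta> by simp
        then show False using f0 by (simp add: poly_0_coeff_0)
      qed
      ultimately show False
        using T0(2)[of f A \<theta> x y k] deg A \<theta>(1) xy k0 kd close unfolding \<tau>_def by auto
    qed
  qed
qed

text \<open>The signs of \<open>x ^ k\<close> and \<open>y ^ k\<close> are moved into the
  coefficients: up to sign \<open>g\<close> is \<open>f\<close> at plus or minus the variable. The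
  lower bounds depend only on the absolute values of the coefficients, so nonnegative
  \<open>x\<close> and \<open>y\<close> suffice.\<close>

lemma abs_hom_form_power_signs:
  fixes f :: "int poly" and x y :: int
  shows "\<exists>g :: int poly. degree g = degree f \<and> (\<forall>i. \<bar>coeff g i\<bar> = \<bar>coeff f i\<bar>) \<and>
    \<bar>hom_form f (x ^ k) (y ^ k)\<bar> = \<bar>hom_form g (\<bar>x\<bar> ^ k) (\<bar>y\<bar> ^ k)\<bar>"
proof -
  define s1 s2 :: int where "s1 = (if x < 0 then - 1 else 1) ^ k" and "s2 = (if y < 0 then - 1 else 1) ^ k"
  have s: "\<bar>s1\<bar> = 1" "\<bar>s2\<bar> = 1" by (auto simp: s1_def s2_def power_abs)
  have xs: "x ^ k = s1 * \<bar>x\<bar> ^ k" "y ^ k = s2 * \<bar>y\<bar> ^ k"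
    by (auto simp: s1_def s2_def simp flip: power_mult_distrib)
  define g where "g = pcompose f [:0, s1 * s2:]"
  have ss: "\<bar>s1 * s2\<bar> = 1" "s1 * s2 \<noteq> 0" using s by (auto simp: abs_mult)
  have cg: "coeff g i = (s1 * s2) ^ i * coeff f i" for i by (simp add: g_def coeff_pcompose_linear)
  have dg: "degree g = degree f" unfolding g_def using ss(2) by simp
  have s22: "s2 * s2 = 1" using s(2) by (metis abs_mult_self_eq mult_1_left)
  have "hom_form f (x ^ k) (y ^ k) = hom_form f (s2 * (s1 * s2 * \<bar>x\<bar> ^ k)) (s2 * \<bar>y\<bar> ^ k)"
  proof -
    have "s2 * (s1 * s2 * \<bar>x\<bar> ^ k) = (s2 * s2) * (s1 * \<bar>x\<bar> ^ k)" by (simp only: mult_ac)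
    then have "s2 * (s1 * s2 * \<bar>x\<bar> ^ k) = s1 * \<bar>x\<bar> ^ k" by (simp only: s22 mult_1_left)
    then show ?thesis by (simp only: xs)
  qed
  also have "\<dots> = s2 ^ degree f * hom_form f (s1 * s2 * \<bar>x\<bar> ^ k) (\<bar>y\<bar> ^ k)" by (rule hom_form_scale)
  also have "hom_form f (s1 * s2 * \<bar>x\<bar> ^ k) (\<bar>y\<bar> ^ k) = hom_form g (\<bar>x\<bar> ^ k) (\<bar>y\<bar> ^ k)"
    unfolding hom_form_def dg by (intro sum.cong refl) (simp add: cg power_mult_distrib mult_ac)
  finally have "\<bar>hom_form f (x ^ k) (y ^ k)\<bar> = \<bar>hom_form g (\<bar>x\<bar> ^ k) (\<bar>y\<bar> ^ k)\<bar>"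
    using s by (simp add: abs_mult power_abs)
  moreover have "\<bar>coeff g i\<bar> = \<bar>coeff f i\<bar>" for i using ss by (simp add: cg abs_mult power_abs)
  ultimately show ?thesis using dg by blast
qed

text \<open>Exchanges the variables, so that \<open>x < y\<close> can be assumed; the nonzero
  constant term keeps the degree.\<close>

lemma hom_form_reflect:
  assumes "coeff f 0 \<noteq> 0"
  shows "hom_form (reflect_poly f) x y = hom_form f y x"
proof -
  have d: "degree (reflect_poly f) = degree f" using assms by simp
  have "hom_form (reflect_poly f) x y = (\<Sum>i\<le>degree f. coeff f (degree f - i) * x ^ i * y ^ (degree f - i))"
    unfolding hom_form_def d by (intro sum.cong refl) (simp add: coeff_reflect_poly)
  also have "\<dots> = (\<Sum>i\<le>degree f. coeff f i * x ^ (degree f - i) * y ^ i)"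
    by (rule sum.reindex_bij_witness[of _ "\<lambda>i. degree f - i" "\<lambda>i. degree f - i"]) auto
  finally show ?thesis by (simp add: hom_form_def mult_ac)
qed

theorem power_form_lower_bound:
  fixes r :: nat and \<epsilon> :: real
  assumes r: "r \<ge> 1" and \<epsilon>: "\<epsilon> > 0"
  shows "\<exists>T>0. \<forall>(f :: int poly) (A :: int) (k :: nat) (x :: int) (y :: int).
    degree f = r \<longrightarrow> coeff f 0 \<noteq> 0 \<longrightarrow> (\<forall>i. \<bar>coeff f i\<bar> \<le> A) \<longrightarrow> A \<ge> 2 \<longrightarrow>
    T * ln (real_of_int A) \<le> real k \<longrightarrow> hom_form f (x ^ k) (y ^ k) \<noteq> 0 \<longrightarrow>
    real_of_int (max \<bar>x\<bar> \<bar>y\<bar>) powr (real (k * r) * (1 - \<epsilon>)) \<le> \<bar>real_of_int (hom_form f (x ^ k) (y ^ k))\<bar>"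
proof -
  obtain T where T: "T > 0" "\<And>(f :: int poly) (A :: int) (k :: nat) (x :: nat) (y :: nat).
    degree f = r \<Longrightarrow> coeff f 0 \<noteq> 0 \<Longrightarrow> (\<forall>i. \<bar>coeff f i\<bar> \<le> A) \<Longrightarrow> A \<ge> 2 \<Longrightarrow> 0 < x \<Longrightarrow> x < y \<Longrightarrow>
    T * ln (real_of_int A) \<le> real k \<Longrightarrow>
    real y powr (real (k * r) * (1 - \<epsilon>)) \<le> \<bar>real_of_int (hom_form f (int x ^ k) (int y ^ k))\<bar>"
    using power_form_lower_bound_aux[OF r \<epsilon>] by blast
  show ?thesis
  proof (intro exI[of _ T] conjI allI impI T(1))
    fix f :: "int poly" and A :: int and k :: nat and x y :: int
    assume deg: "degree f = r" and f0: "coeff f 0 \<noteq> 0" and A: "\<forall>i. \<bar>coeff f i\<bar> \<le> A" "A \<ge> 2"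
      and k: "T * ln (real_of_int A) \<le> real k" and nz: "hom_form f (x ^ k) (y ^ k) \<noteq> 0"
    have kpos: "k > 0"
    proof -
      have "0 < T * ln (real_of_int A)" using T A by (intro mult_pos_pos) auto
      then show ?thesis using k by linarith
    qed
    obtain g :: "int poly" where g: "degree g = degree f" "\<And>i. \<bar>coeff g i\<bar> = \<bar>coeff f i\<bar>"
      "\<bar>hom_form f (x ^ k) (y ^ k)\<bar> = \<bar>hom_form g (\<bar>x\<bar> ^ k) (\<bar>y\<bar> ^ k)\<bar>"
      using abs_hom_form_power_signs by metis
    define u v where "u = nat \<bar>x\<bar>" and "v = nat \<bar>y\<bar>"
    have uv: "\<bar>x\<bar> = int u" "\<bar>y\<bar> = int v" by (auto simp: u_def v_def)
    have g0: "coeff g 0 \<noteq> 0" using g(2)[of 0] f0 by auto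
    have gA: "\<forall>i. \<bar>coeff g i\<bar> \<le> A" using g A by simp
    have eq: "\<bar>real_of_int (hom_form f (x ^ k) (y ^ k))\<bar> = \<bar>real_of_int (hom_form g (int u ^ k) (int v ^ k))\<bar>"
      using g(3) unfolding uv by (metis of_int_abs)
    have gnz: "hom_form g (int u ^ k) (int v ^ k) \<noteq> 0" using eq nz by auto
    \<comment> \<open>Covers the degenerate points \<open>u = 0\<close>, \<open>v = 0\<close> and
      \<open>u = v\<close>, where the value is a nonzero integer multiple of
      \<open>w ^ (k * r)\<close>.\<close>
    have trivial: "real w powr (real (k * r) * (1 - \<epsilon>)) \<le> \<bar>real_of_int (hom_form g (int u ^ k) (int v ^ k))\<bar>"
      if h: "hom_form g (int u ^ k) (int v ^ k) = (int w ^ k) ^ r * c" for w c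
    proof -
      have c: "c \<noteq> 0" and w: "w > 0" using gnz h kpos r by (auto simp: power_0_left)
      have "real w powr (real (k * r) * (1 - \<epsilon>)) \<le> real w powr (real (k * r))"
        using w \<epsilon> by (intro powr_mono) (auto simp: algebra_simps)
      also have "\<dots> = real w ^ (k * r) * 1" using w by (simp add: powr_realpow del: of_nat_mult)
      also have "\<dots> \<le> real w ^ (k * r) * \<bar>real_of_int c\<bar>" using c by (intro mult_left_mono) auto
      also have "\<dots> = \<bar>real_of_int (hom_form g (int u ^ k) (int v ^ k))\<bar>" by (simp add: h abs_mult power_mult)
      finally show ?thesis .
    qed
    have gr: "degree g = r" using g deg by simp
    have "real (max u v) powr (real (k * r) * (1 - \<epsilon>)) \<le> \<bar>real_of_int (hom_form g (int u ^ k) (int v ^ k))\<bar>"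
    proof -
      consider "u = 0" | "v = 0" | "u = v" | "0 < u" "u < v" | "0 < v" "v < u" by linarith
      then show ?thesis
      proof cases
        case 1
        have "hom_form g 0 (int v ^ k) = (\<Sum>i\<in>{0}. coeff g i * 0 ^ i * (int v ^ k) ^ (degree g - i))"
          unfolding hom_form_def by (rule sum.mono_neutral_right) auto
        then show ?thesis using trivial[of v "coeff g 0"] 1 kpos gr by (simp add: mult.commute power_0_left)
      next
        case 2
        have "hom_form g (int u ^ k) 0 = (\<Sum>i\<in>{degree g}. coeff g i * (int u ^ k) ^ i * 0 ^ (degree g - i))"
          unfolding hom_form_def by (rule sum.mono_neutral_right) auto
        then show ?thesis using trivial[of u "lead_coeff g"] 2 kpos gr by (simp add: mult.commute power_0_left)
      next
        case 3
        have "hom_form g (int v ^ k * 1) (int v ^ k * 1) = (int v ^ k) ^ degree g * hom_form g 1 1" by (rule hom_form_scale)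
        then show ?thesis using trivial[of v "hom_form g 1 1"] 3 gr by simp
      next
        case 4
        then show ?thesis using T(2)[OF gr g0 gA A(2) 4 k] by simp
      next
        case 5
        have lg: "lead_coeff g \<noteq> 0" using gr r by auto
        have "real u powr (real (k * r) * (1 - \<epsilon>)) \<le> \<bar>real_of_int (hom_form (reflect_poly g) (int v ^ k) (int u ^ k))\<bar>"
          using g0 gr lg gA A by (intro T(2)[of "reflect_poly g" A v u k] 5 k) (auto simp: coeff_reflect_poly)
        then show ?thesis using 5 by (simp add: hom_form_reflect[OF g0])
      qed
    qed
    moreover have "real_of_int (max \<bar>x\<bar> \<bar>y\<bar>) = real (max u v)" unfolding uv by simp
    ultimately show "real_of_int (max \<bar>x\<bar> \<bar>y\<bar>) powr (real (k * r) * (1 - \<epsilon>)) \<le> \<bar>real_of_int (hom_form f (x ^ k) (y ^ k))\<bar>"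
      using eq by (simp only:)
  qed
qed

section \<open>Fewnomials\<close>

text \<open>The vector of descending powers of the common root is a nonzero element of the kernel of
  the Sylvester matrix.\<close>

lemma resultant_eq_0_if_common_root:
  fixes p q :: "complex poly"
  assumes root: "poly p z = 0" "poly q z = 0" and deg: "degree p + degree q > 0"
  shows "resultant p q = 0"
proof -
  define m n where "m = degree p" and "n = degree q"
  define v where "v = vec (m + n) (\<lambda>j. z ^ (m + n - 1 - j))"
  have dim: "v \<in> carrier_vec (m + n)" by (simp add: v_def)
  have carr: "sylvester_mat p q \<in> carrier_mat (m + n) (m + n)"
    by (simp add: m_def n_def sylvester_carrier_mat)
  have "v $ (m + n - 1) = 1" using deg by (simp add: v_def m_def n_def)
  then have v0: "v \<noteq> 0\<^sub>v (m + n)" using deg by (auto simp: m_def n_def)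
  \<comment> \<open>The Sylvester entries are coefficients of \<open>monom 1 (Suc t) * h\<close> at
    \<open>m + n - j\<close>, while \<open>v\<close> carries the exponent
    \<open>m + n - 1 - j\<close>. Dropping one factor of the variable aligns them, and the row times
    \<open>v\<close> is \<open>z^t\<close> times the value of \<open>h\<close> at
    \<open>z\<close>.\<close>
  have row: "(\<Sum>j<m+n. coeff (monom 1 (Suc t) * h) (m + n - j) * z ^ (m + n - 1 - j)) = 0"
    if "poly h z = 0" "t + degree h < m + n" for t and h :: "complex poly"
  proof -
    have "(\<Sum>j<m+n. coeff (monom 1 (Suc t) * h) (m + n - j) * z ^ (m + n - 1 - j)) =
       (\<Sum>j<m+n. coeff (monom 1 t * h) j * z ^ j)"
    proof (rule sum.reindex_bij_witness[of _ "\<lambda>j. m + n - 1 - j" "\<lambda>j. m + n - 1 - j"])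
      fix j assume j: "j \<in> {..<m + n}"
      then have "m + n - j = Suc (m + n - 1 - j)" by auto
      then show "coeff (monom 1 t * h) (m + n - 1 - j) * z ^ (m + n - 1 - j) =
          coeff (monom 1 (Suc t) * h) (m + n - j) * z ^ (m + n - 1 - j)"
        by (simp add: coeff_monom_mult)
    qed auto
    also have "\<dots> = (\<Sum>j\<le>degree (monom 1 t * h). coeff (monom 1 t * h) j * z ^ j)"
    proof (rule sum.mono_neutral_right)
      show "{..degree (monom 1 t * h)} \<subseteq> {..<m + n}"
        using degree_mult_le[of "monom (1::complex) t" h] degree_monom_le[of "1::complex" t] that(2) by auto
    qed (auto simp: coeff_eq_0)
    also have "\<dots> = poly (monom 1 t * h) z" by (simp add: poly_altdef)
    also have "\<dots> = 0" using that by simp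
    finally show ?thesis .
  qed
  have "sylvester_mat p q *\<^sub>v v = 0\<^sub>v (m + n)"
  proof (rule eq_vecI)
    fix i assume "i < dim_vec (0\<^sub>v (m + n) :: complex vec)"
    then have i: "i < m + n" by simp
    have "(sylvester_mat p q *\<^sub>v v) $ i = (\<Sum>j<m+n. sylvester_mat p q $$ (i, j) * z ^ (m + n - 1 - j))"
      using i carr by (simp add: v_def scalar_prod_def m_def n_def atLeast0LessThan)
    also have "\<dots> = (\<Sum>j<m+n. (if i < n then coeff (monom 1 (n - i) * p) (m + n - j)
        else coeff (monom 1 (m + n - i) * q) (m + n - j)) * z ^ (m + n - 1 - j))"
      using i by (intro sum.cong refl) (simp add: sylvester_index_mat2 m_def n_def)
    also have "\<dots> = 0"
    proof (cases "i < n")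
      case True
      then have "n - i = Suc (n - i - 1)" by simp
      then show ?thesis using row[of p "n - i - 1"] root True by (simp add: m_def)
    next
      case False
      then have "m + n - i = Suc (m + n - i - 1)" using i by simp
      then show ?thesis using row[of q "m + n - i - 1"] root False i by (simp add: n_def)
    qed
    finally show "(sylvester_mat p q *\<^sub>v v) $ i = 0\<^sub>v (m + n) $ i" using i by simp
  qed (use carr in auto)
  then show ?thesis
    unfolding resultant_def using det_0_iff_vec_prod_zero[OF carr] dim v0 by blast
qed

text \<open>A common root makes the resultant zero, and then the quotient in
  \<open>discriminant\<close> is 0.\<close>

lemma discriminant_no_common_root:
  fixes z :: complex
  assumes "discriminant f \<noteq> 0" "degree f \<ge> 1" "poly (of_int_poly f) z = 0"
  shows "poly (pderiv (of_int_poly f)) z \<noteq> 0"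
proof
  assume z: "poly (pderiv (of_int_poly f)) z = 0"
  have pd: "pderiv (of_int_poly f :: complex poly) = of_int_poly (pderiv f)"
    by (simp add: of_int_hom.map_poly_pderiv)
  have "resultant (of_int_poly f :: complex poly) (of_int_poly (pderiv f)) = 0"
    using assms z by (intro resultant_eq_0_if_common_root[of _ z]) (auto simp: pd)
  then have "resultant f (pderiv f) = 0" by (simp add: of_int_hom.resultant_hom)
  then show False using assms(1) by (simp add: discriminant_def)
qed

lemma coeff_coeff_poly: "coeff (coeff_poly r a) j = (if j \<le> r then a ! (r - j) else 0)"
proof -
  have "coeff (coeff_poly r a) j = (\<Sum>i\<le>r. if i = r - j \<and> j \<le> r then a ! i else 0)"
    unfolding coeff_poly_def coeff_sum by (intro sum.cong refl) auto
  then show ?thesis by auto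
qed

lemma degree_coeff_poly:
  assumes "a ! 0 \<noteq> 0"
  shows "degree (coeff_poly r a) = r"
proof (rule antisym)
  show "degree (coeff_poly r a) \<le> r" by (rule degree_le) (simp add: coeff_coeff_poly)
  show "r \<le> degree (coeff_poly r a)" by (rule le_degree) (use assms in \<open>simp add: coeff_coeff_poly\<close>)
qed

lemma eval2_eq_hom_form:
  assumes "a ! 0 \<noteq> 0"
  shows "eval2 (fewnomial r k a) x y = hom_form (coeff_poly r a) (x ^ k) (y ^ k)"
proof -
  have "hom_form (coeff_poly r a) (x ^ k) (y ^ k) = (\<Sum>j\<le>r. a ! (r - j) * (x ^ k) ^ j * (y ^ k) ^ (r - j))"
    unfolding hom_form_def degree_coeff_poly[OF assms] by (intro sum.cong refl) (simp add: coeff_coeff_poly)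
  also have "\<dots> = (\<Sum>i\<le>r. a ! i * (x ^ k) ^ (r - i) * (y ^ k) ^ i)"
    by (rule sum.reindex_bij_witness[of _ "\<lambda>i. r - i" "\<lambda>i. r - i"]) auto
  also have "\<dots> = eval2 (fewnomial r k a) x y" unfolding eval2_fewnomial by (simp only: power_mult)
  finally show ?thesis by (rule sym)
qed

lemma abs_nth_le_Astar:
  assumes "i < length a"
  shows "\<bar>a ! i\<bar> \<le> Astar a"
  unfolding Astar_def using assms by (intro Max_ge) auto

lemma two_le_Astar: "2 \<le> Astar a"
  unfolding Astar_def by (intro Max_ge) auto

lemma abs_coeff_coeff_poly_le:
  assumes "length a = r + 1"
  shows "\<bar>coeff (coeff_poly r a) j\<bar> \<le> Astar a"
  using abs_nth_le_Astar[of "r - j" a] two_le_Astar[of a] assms by (auto simp: coeff_coeff_poly)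

text \<open>The polynomial \<open>f(T^k)\<close>, whose homogenization is the fewnomial itself. It
  makes the results on \<open>hom_form\<close> in degree \<open>k * r\<close> available; the bounds
  uniform in \<open>k\<close> use \<open>coeff_poly\<close> at \<open>x ^ k\<close> and
  \<open>y ^ k\<close> instead.\<close>

definition power_poly :: "nat \<Rightarrow> nat \<Rightarrow> int list \<Rightarrow> int poly" where
  "power_poly r k a = pcompose (coeff_poly r a) (monom 1 k)"

context
  fixes r k :: nat and a :: "int list"
  assumes r: "r \<ge> 1" and k: "k \<ge> 1" and a0: "a ! 0 \<noteq> 0" and ar: "a ! r \<noteq> 0"
begin

lemma degree_power_poly: "degree (power_poly r k a) = k * r"
  unfolding power_poly_def using k by (simp add: degree_pcompose degree_monom_eq degree_coeff_poly[OF a0])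

lemma eval2_eq_hom_form_power_poly: "eval2 (fewnomial r k a) x y = hom_form (power_poly r k a) x y"
proof (cases "y = 0")
  case True
  have lead: "lead_coeff (power_poly r k a) = lead_coeff (coeff_poly r a)"
    unfolding power_poly_def using k by (subst lead_coeff_comp) (auto simp: degree_monom_eq)
  then have lead': "coeff (power_poly r k a) (k * r) = coeff (coeff_poly r a) r"
    by (simp only: degree_power_poly degree_coeff_poly[OF a0])
  have top: "hom_form f u 0 = lead_coeff f * u ^ degree f" for f :: "int poly" and u
  proof -
    have "hom_form f u 0 = (\<Sum>i\<in>{degree f}. coeff f i * u ^ i * 0 ^ (degree f - i))"
      unfolding hom_form_def by (rule sum.mono_neutral_right) auto
    then show ?thesis by simp
  qed
  show ?thesis
    unfolding eval2_eq_hom_form[OF a0] True using k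
    by (simp add: power_0_left top lead' degree_power_poly degree_coeff_poly[OF a0] flip: power_mult)
next
  case False
  have "real_of_int (eval2 (fewnomial r k a) x y) =
      (real_of_int y ^ k) ^ r * poly (of_int_poly (coeff_poly r a)) ((real_of_int x / real_of_int y) ^ k)"
    unfolding eval2_eq_hom_form[OF a0] using hom_form_eq_poly[of "y ^ k" "coeff_poly r a" "x ^ k"] False
    by (simp add: degree_coeff_poly[OF a0] power_divide)
  also have "poly (of_int_poly (coeff_poly r a)) ((real_of_int x / real_of_int y) ^ k) =
      poly (of_int_poly (power_poly r k a)) (real_of_int x / real_of_int y)"
    by (simp add: power_poly_def of_int_hom.map_poly_pcompose poly_pcompose poly_monom)
  also have "(real_of_int y ^ k) ^ r * \<dots> = real_of_int (hom_form (power_poly r k a) x y)"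
    using hom_form_eq_poly[of y "power_poly r k a" x] False by (simp add: degree_power_poly power_mult)
  finally show ?thesis by (simp only: of_int_eq_iff)
qed

text \<open>By the chain rule a double root of \<open>f(T^k)\<close> is either 0, excluded by the
  nonzero last coefficient, or has a power that is a double root of \<open>f\<close>.\<close>

lemma rsquarefree_power_poly:
  assumes disc: "discriminant (coeff_poly r a) \<noteq> 0"
  shows "rsquarefree (of_int_poly (power_poly r k a) :: complex poly)"
  unfolding rsquarefree_roots
proof (intro allI notI, elim conjE)
  fix z :: complex
  let ?f = "of_int_poly (coeff_poly r a) :: complex poly"
  have g: "of_int_poly (power_poly r k a) = pcompose ?f (monom 1 k)"
    by (simp add: power_poly_def of_int_hom.map_poly_pcompose)
  assume z: "poly (of_int_poly (power_poly r k a)) z = 0" "poly (pderiv (of_int_poly (power_poly r k a))) z = 0"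
  have fz: "poly ?f (z ^ k) = 0" using z(1) by (simp add: g poly_pcompose poly_monom)
  have "z \<noteq> 0"
  proof
    assume "z = 0"
    then have "poly ?f 0 = 0" using fz k by (simp add: power_0_left)
    then show False using ar by (simp add: poly_0_coeff_0 coeff_coeff_poly)
  qed
  moreover have "poly (pderiv ?f) (z ^ k) * (of_nat k * z ^ (k - 1)) = 0"
    using z(2) unfolding g pderiv_pcompose by (simp add: poly_pcompose poly_monom pderiv_monom)
  ultimately have "poly (pderiv ?f) (z ^ k) = 0" using k by simp
  moreover have "poly (pderiv ?f) (z ^ k) \<noteq> 0"
    using discriminant_no_common_root[OF disc _ fz] r by (simp add: degree_coeff_poly[OF a0])
  ultimately show False by contradiction
qed

end

text \<open>For fixed \<open>y\<close> the equation is a polynomial in \<open>x\<close> with leading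
  coefficient that of \<open>f\<close>, so it has at most \<open>n\<close> solutions. The count is
  therefore linear in \<open>Y\<close>, which gives the exponent \<open>lam / (2 * d)\<close> for a
  fixed value, half of that for all values up to \<open>N\<close>.\<close>

lemma card_solutions_in_box:
  fixes f :: "int poly" and Y :: real
  assumes deg: "degree f = n" "n \<ge> 1" and Y: "Y \<ge> 1"
  shows "finite {(x, y). hom_form f x y = m \<and> real_of_int (max \<bar>x\<bar> \<bar>y\<bar>) \<le> Y}"
    and "real (card {(x, y). hom_form f x y = m \<and> real_of_int (max \<bar>x\<bar> \<bar>y\<bar>) \<le> Y}) \<le> 3 * real n * Y"
proof -
  let ?S = "{(x, y). hom_form f x y = m \<and> real_of_int (max \<bar>x\<bar> \<bar>y\<bar>) \<le> Y}"
  let ?I = "{- \<lfloor>Y\<rfloor>..\<lfloor>Y\<rfloor>}"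
  define g where "g y = (\<Sum>i\<le>n. monom (coeff f i * y ^ (n - i)) i) - [:m:]" for y
  have poly_g: "poly (g y) x = hom_form f x y - m" for x y
    by (simp add: g_def poly_sum poly_monom hom_form_def deg mult_ac)
  have coeff_g: "coeff (g y) n = lead_coeff f" for y
  proof -
    have "coeff [:m:] n = 0" using deg by (cases n) auto
    then show ?thesis using deg by (simp add: g_def coeff_sum)
  qed
  have g0: "g y \<noteq> 0" for y
  proof
    assume "g y = 0"
    then have "lead_coeff f = 0" using coeff_g[of y] by simp
    then show False using deg by auto
  qed
  have degg: "degree (g y) \<le> n" for y
    unfolding g_def by (intro degree_diff_le degree_sum_le) (auto intro: order_trans[OF degree_monom_le])
  let ?T = "SIGMA y:?I. {x. poly (g y) x = 0}"
  have fin: "finite ?T" using g0 poly_roots_finite by (intro finite_SigmaI) auto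
  have sub: "?S \<subseteq> prod.swap ` ?T"
  proof
    fix p assume "p \<in> ?S"
    then obtain x y where p: "p = (x, y)" "hom_form f x y = m" "real_of_int (max \<bar>x\<bar> \<bar>y\<bar>) \<le> Y" by auto
    then have "\<bar>real_of_int y\<bar> \<le> Y" by (auto simp: max_def split: if_splits)
    then have "(y, x) \<in> ?T" using p(2) by (auto simp: poly_g le_floor_iff) linarith+
    then show "p \<in> prod.swap ` ?T" by (auto simp: p(1) image_iff)
  qed
  then show "finite ?S" using fin finite_subset by blast
  have "card ?S \<le> card (prod.swap ` ?T)" using sub fin by (intro card_mono) auto
  also have "\<dots> \<le> card ?T" using fin by (rule card_image_le)
  also have "\<dots> = (\<Sum>y\<in>?I. card {x. poly (g y) x = 0})"
    using g0 poly_roots_finite by (intro card_SigmaI) auto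
  also have "\<dots> \<le> (\<Sum>y\<in>?I. n)"
    by (intro sum_mono) (rule order_trans[OF card_poly_roots_bound[OF g0] degg])
  finally have "card ?S \<le> card ?I * n" by (simp only: sum_constant of_nat_id)
  then have "real (card ?S) \<le> real (card ?I) * real n" unfolding of_nat_mult[symmetric] of_nat_le_iff .
  also have "real (card ?I) = 2 * of_int \<lfloor>Y\<rfloor> + 1" using Y by simp
  also have "(2 * of_int \<lfloor>Y\<rfloor> + 1) * real n \<le> (3 * Y) * real n"
    using Y of_int_floor_le[of Y] by (intro mult_right_mono) linarith+
  finally show "real (card ?S) \<le> 3 * real n * Y" by (simp add: mult_ac)
qed

section \<open>Counting\<close>

text \<open>The summation over forms, common to both counts: \<open>p\<close> is \<open>m\<close> in
  part (a) and \<open>N\<close> in part (b). Below \<open>K0\<close> there are finitely many forms,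
  each with its own constant. From \<open>K0\<close> on only \<open>k <= L * ln (sz p)\<close>
  matter, with at most \<open>sz p\<close> to the power \<open>\<sigma>\<close> vectors each; the
  sum over \<open>k\<close> and the factor \<open>k\<close> cost one logarithm each. Three losses of
  exponent \<open>\<sigma>\<close> result.\<close>

lemma card_union_bound:
  fixes W :: "'p \<Rightarrow> nat \<Rightarrow> 'a \<Rightarrow> 'b set" and sz :: "'p \<Rightarrow> real"
  assumes fin: "\<And>k. k \<in> Ks \<Longrightarrow> finite (Adm k)"
    and small: "\<And>k a. k \<in> Ks \<Longrightarrow> k < K0 \<Longrightarrow> a \<in> Adm k \<Longrightarrow>
      \<exists>C\<ge>0. \<forall>p\<in>P. finite (W p k a) \<and> real (card (W p k a)) \<le> C * sz p powr e"
    and large: "\<And>k a p. k \<in> Ks \<Longrightarrow> k \<ge> K0 \<Longrightarrow> a \<in> Adm k \<Longrightarrow> p \<in> P \<Longrightarrow>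
      finite (W p k a) \<and> (W p k a \<noteq> {} \<longrightarrow> real k \<le> L * ln (sz p)) \<and>
      real (card (W p k a)) \<le> D * real k * sz p powr e'"
    and adm: "\<And>k. k \<in> Ks \<Longrightarrow> k \<ge> K0 \<Longrightarrow> real (card (Adm k)) \<le> exp (\<delta> * real k)"
    and sz: "\<And>p. p \<in> P \<Longrightarrow> sz p \<ge> 2"
    and par: "L > 0" "\<delta> \<ge> 0" "\<delta> * L \<le> \<sigma>" "\<sigma> > 0" "e' + 3 * \<sigma> \<le> e" "D \<ge> 0"
  shows "\<exists>C\<ge>0. \<forall>p\<in>P. finite (\<Union>k\<in>Ks. \<Union>a\<in>Adm k. W p k a) \<and>
    real (card (\<Union>k\<in>Ks. \<Union>a\<in>Adm k. W p k a)) \<le> C * sz p powr e"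
proof -
  define I where "I = (SIGMA k:{k \<in> Ks. k < K0}. Adm k)"
  have finI: "finite I" unfolding I_def using fin by (intro finite_SigmaI) auto
  have "\<forall>i\<in>I. \<exists>C\<ge>0. \<forall>p\<in>P. finite (W p (fst i) (snd i)) \<and> real (card (W p (fst i) (snd i))) \<le> C * sz p powr e"
    using small by (auto simp: I_def)
  then obtain c where c: "\<And>i. i \<in> I \<Longrightarrow> c i \<ge> 0" "\<And>i p. i \<in> I \<Longrightarrow> p \<in> P \<Longrightarrow> finite (W p (fst i) (snd i))"
      "\<And>i p. i \<in> I \<Longrightarrow> p \<in> P \<Longrightarrow> real (card (W p (fst i) (snd i))) \<le> c i * sz p powr e"
    by metis
  define C1 where "C1 = (\<Sum>i\<in>I. c i)"
  define C2 where "C2 = (L / \<sigma> + 1) * D * (L / \<sigma>)"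
  have C1: "C1 \<ge> 0" unfolding C1_def using c by (intro sum_nonneg) auto
  have C2: "C2 \<ge> 0" unfolding C2_def using par by auto
  show ?thesis
  proof (intro exI[of _ "C1 + C2"] conjI ballI)
    show "C1 + C2 \<ge> 0" using C1 C2 by simp
  next
    fix p assume p: "p \<in> P"
    define N where "N = sz p"
    have N: "N \<ge> 2" using sz[OF p] by (simp add: N_def)
    have lnN: "ln N \<ge> 0" using N by simp
    define kmax where "kmax = nat \<lfloor>L * ln N\<rfloor>"
    have kmax: "real kmax \<le> L * ln N" using par lnN by (simp add: kmax_def)
    define J where "J = {k \<in> Ks. K0 \<le> k \<and> k \<le> kmax}"
    have finJ: "finite J" by (rule finite_subset[of _ "{..kmax}"]) (auto simp: J_def)
    have cardJ: "card J \<le> kmax + 1" using card_mono[of "{..kmax}" J] by (auto simp: J_def)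
    define U1 where "U1 = (\<Union>i\<in>I. W p (fst i) (snd i))"
    define U2 where "U2 = (\<Union>k\<in>J. \<Union>a\<in>Adm k. W p k a)"
    have U: "(\<Union>k\<in>Ks. \<Union>a\<in>Adm k. W p k a) \<subseteq> U1 \<union> U2"
    proof clarify
      fix k a w assume k: "k \<in> Ks" "a \<in> Adm k" "w \<in> W p k a" "w \<notin> U2"
      show "w \<in> U1"
      proof (cases "k < K0")
        case True
        then have "(k, a) \<in> I" using k by (simp add: I_def)
        then show ?thesis using k unfolding U1_def by force
      next
        case False
        then have "real k \<le> L * ln N" using large[of k a p] k p by (auto simp: N_def)
        then have "k \<le> kmax" by (simp add: kmax_def le_nat_floor)
        then have "k \<in> J" using k False by (simp add: J_def)
        then show ?thesis using k unfolding U2_def by blast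
      qed
    qed
    have finU1: "finite U1" unfolding U1_def using finI c(2) p by blast
    have finU2: "finite U2" unfolding U2_def using finJ fin large p by (auto simp: J_def)
    have cU1: "real (card U1) \<le> C1 * N powr e"
    proof -
      have "card U1 \<le> (\<Sum>i\<in>I. card (W p (fst i) (snd i)))" unfolding U1_def by (rule card_UN_le[OF finI])
      then have "real (card U1) \<le> (\<Sum>i\<in>I. real (card (W p (fst i) (snd i))))" by (simp only: of_nat_sum[symmetric] of_nat_le_iff)
      also have "\<dots> \<le> (\<Sum>i\<in>I. c i * N powr e)" unfolding N_def using c(3) p by (intro sum_mono) auto
      finally show ?thesis by (simp add: C1_def sum_distrib_right)
    qed
    define M where "M = N powr \<sigma> * (D * (L * ln N) * N powr e')"
    have cU2: "real (card U2) \<le> (L * ln N + 1) * M"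
    proof -
      have one: "real (card (\<Union>a\<in>Adm k. W p k a)) \<le> M" if k: "k \<in> J" for k
      proof -
        have kK: "k \<in> Ks" "k \<ge> K0" "real k \<le> L * ln N" using k kmax by (auto simp: J_def)
        have "card (\<Union>a\<in>Adm k. W p k a) \<le> (\<Sum>a\<in>Adm k. card (W p k a))" by (rule card_UN_le[OF fin[OF kK(1)]])
        then have "real (card (\<Union>a\<in>Adm k. W p k a)) \<le> (\<Sum>a\<in>Adm k. real (card (W p k a)))" by (simp only: of_nat_sum[symmetric] of_nat_le_iff)
        also have "\<dots> \<le> (\<Sum>a\<in>Adm k. D * real k * N powr e')"
          unfolding N_def using large[OF kK(1,2) _ p] by (intro sum_mono) auto
        also have "\<dots> = real (card (Adm k)) * (D * real k * N powr e')" by simp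
        also have "\<dots> \<le> N powr \<sigma> * (D * (L * ln N) * N powr e')"
        proof (intro mult_mono)
          have "real (card (Adm k)) \<le> exp (\<delta> * real k)" by (rule adm[OF kK(1,2)])
          also have "\<dots> \<le> exp (\<sigma> * ln N)"
          proof -
            have "\<delta> * real k \<le> \<delta> * (L * ln N)" using kK par by (intro mult_left_mono) auto
            also have "\<dots> \<le> \<sigma> * ln N" using mult_right_mono[OF par(3) lnN] by (simp add: mult_ac)
            finally show ?thesis by simp
          qed
          also have "\<dots> = N powr \<sigma>" using N by (simp add: powr_def)
          finally show "real (card (Adm k)) \<le> N powr \<sigma>" .
        qed (use kK par in auto)
        finally show ?thesis by (simp add: M_def)
      qed
      have M0: "M \<ge> 0" using par lnN by (simp add: M_def)
      have "card U2 \<le> (\<Sum>k\<in>J. card (\<Union>a\<in>Adm k. W p k a))" unfolding U2_def by (rule card_UN_le[OF finJ])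
      then have "real (card U2) \<le> (\<Sum>k\<in>J. real (card (\<Union>a\<in>Adm k. W p k a)))" by (simp only: of_nat_sum[symmetric] of_nat_le_iff)
      also have "\<dots> \<le> (\<Sum>k\<in>J. M)" by (intro sum_mono one)
      also have "\<dots> = real (card J) * M" by simp
      also have "\<dots> \<le> (L * ln N + 1) * M"
      proof (intro mult_right_mono M0)
        have "real (card J) \<le> real (kmax + 1)" using cardJ by (simp only: of_nat_le_iff)
        then show "real (card J) \<le> L * ln N + 1" using kmax by simp
      qed
      finally show ?thesis .
    qed
    have Ns: "N powr \<sigma> \<ge> 1" using N par by (simp add: ge_one_powr_ge_zero)
    have lnb: "ln N \<le> N powr \<sigma> / \<sigma>" using ln_powr_bound[of N \<sigma>] N par by simp
    have Llnb: "L * ln N \<le> L / \<sigma> * N powr \<sigma>" using mult_left_mono[OF lnb, of L] par by simp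
    have "(L * ln N + 1) * M \<le> ((L / \<sigma> + 1) * N powr \<sigma>) * (N powr \<sigma> * (D * (L / \<sigma> * N powr \<sigma>) * N powr e'))"
    proof (rule mult_mono)
      show "L * ln N + 1 \<le> (L / \<sigma> + 1) * N powr \<sigma>" using Llnb Ns by (simp add: distrib_right)
      show "M \<le> N powr \<sigma> * (D * (L / \<sigma> * N powr \<sigma>) * N powr e')"
        unfolding M_def using Llnb par(6) by (intro mult_left_mono mult_right_mono) simp_all
      show "0 \<le> (L / \<sigma> + 1) * N powr \<sigma>" using par(1,4) by simp
      show "0 \<le> M" unfolding M_def using par(1,6) lnN by simp
    qed
    also have "\<dots> = C2 * (N powr \<sigma> * N powr \<sigma> * N powr \<sigma> * N powr e')" unfolding C2_def by (simp only: mult_ac)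
    also have "N powr \<sigma> * N powr \<sigma> * N powr \<sigma> * N powr e' = N powr (e' + 3 * \<sigma>)"
    proof -
      have "\<sigma> + \<sigma> + \<sigma> + e' = e' + 3 * \<sigma>" by simp
      then show ?thesis by (simp only: powr_add[symmetric])
    qed
    also have "C2 * N powr (e' + 3 * \<sigma>) \<le> C2 * N powr e" using C2 N par by (intro mult_left_mono powr_mono) auto
    finally have cU2': "real (card U2) \<le> C2 * N powr e" using cU2 by linarith
    show "finite (\<Union>k\<in>Ks. \<Union>a\<in>Adm k. W p k a)" using U finU1 finU2 by (meson finite_UnI finite_subset)
    have "card (\<Union>k\<in>Ks. \<Union>a\<in>Adm k. W p k a) \<le> card (U1 \<union> U2)" using U finU1 finU2 by (intro card_mono) auto
    also have "\<dots> \<le> card U1 + card U2" by (rule card_Un_le)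
    finally have "real (card (\<Union>k\<in>Ks. \<Union>a\<in>Adm k. W p k a)) \<le> real (card U1) + real (card U2)" by linarith
    then show "real (card (\<Union>k\<in>Ks. \<Union>a\<in>Adm k. W p k a)) \<le> (C1 + C2) * sz p powr e"
      using cU1 cU2' by (simp add: N_def distrib_right)
  qed
qed

text \<open>
  The coefficient vectors that any family satisfying the bound on \<open>A\<^sup>\<star>\<close> can use in degree \<open>k r\<close>; the
  constants of the theorem are uniform because these sets do not depend on the family.
\<close>
definition admissible :: "nat \<Rightarrow> real \<Rightarrow> nat \<Rightarrow> int list set" where
  "admissible r mu k = {a. length a = r + 1 \<and> a ! 0 \<noteq> 0 \<and> a ! r \<noteq> 0 \<and>
     discriminant (coeff_poly r a) \<noteq> 0 \<and>
     real_of_int (Astar a) \<le> exp (mu * real (k * r) / ln (real (k * r)))}"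

lemma le_ln_if_exp_le: "exp z \<le> w \<Longrightarrow> z \<le> ln (w::real)"
  using ln_ge_iff[of w z] less_le_trans[OF exp_gt_zero, of z w] by simp

lemma ln_ge_1_if_ge_3: "x \<ge> 3 \<Longrightarrow> ln x \<ge> (1::real)"
  using exp_le by (intro le_ln_if_exp_le) linarith

lemma ln_le_if_le_exp: "0 < w \<Longrightarrow> w \<le> exp z \<Longrightarrow> ln (w::real) \<le> z"
  by (metis exp_gt_zero ln_exp ln_le_cancel_iff)

lemma card_admissible:
  assumes "mu > 0" "k * r \<ge> 3"
  shows "finite (admissible r mu k)"
    and "real (card (admissible r mu k)) \<le> (3 * exp (mu * real (k * r) / ln (real (k * r)))) ^ (r + 1)"
proof -
  define B where "B = exp (mu * real (k * r) / ln (real (k * r)))"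
  have "real (k * r) \<ge> 3" using assms by linarith
  then have "ln (real (k * r)) \<ge> 1" by (rule ln_ge_1_if_ge_3)
  then have B: "B \<ge> 1" using assms by (simp add: B_def del: of_nat_mult)
  let ?I = "{- \<lfloor>B\<rfloor>..\<lfloor>B\<rfloor>}"
  let ?L = "{xs. set xs \<subseteq> ?I \<and> length xs = r + 1}"
  have sub: "admissible r mu k \<subseteq> ?L"
  proof
    fix a assume a: "a \<in> admissible r mu k"
    have "v \<in> ?I" if v: "v \<in> set a" for v
    proof -
      obtain i where i: "i < length a" "a ! i = v" using v unfolding in_set_conv_nth by blast
      have "real_of_int \<bar>v\<bar> \<le> real_of_int (Astar a)"
        using abs_nth_le_Astar[OF i(1)] unfolding i(2) of_int_le_iff .
      also have "\<dots> \<le> B" using a by (simp only: admissible_def B_def mem_Collect_eq)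
      finally have "\<bar>v\<bar> \<le> \<lfloor>B\<rfloor>" by (simp only: le_floor_iff)
      then show ?thesis by auto
    qed
    moreover have "length a = r + 1" using a unfolding admissible_def by blast
    ultimately show "a \<in> ?L" by blast
  qed
  have finL: "finite ?L" by (rule finite_lists_length_eq) simp
  then show "finite (admissible r mu k)" using sub finite_subset by blast
  have "card (admissible r mu k) \<le> card ?L" by (rule card_mono[OF finL sub])
  also have "\<dots> = card ?I ^ (r + 1)" by (rule card_lists_length_eq) simp
  finally have "real (card (admissible r mu k)) \<le> real (card ?I) ^ (r + 1)" by (simp only: of_nat_power[symmetric] of_nat_le_iff)
  also have "\<dots> \<le> (3 * B) ^ (r + 1)"
  proof (intro power_mono)
    have "real (card ?I) = 2 * of_int \<lfloor>B\<rfloor> + 1" using B by simp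
    then show "real (card ?I) \<le> 3 * B" using B of_int_floor_le[of B] by linarith
  qed simp
  finally show "real (card (admissible r mu k)) \<le> (3 * exp (mu * real (k * r) / ln (real (k * r)))) ^ (r + 1)"
    by (simp add: B_def)
qed

text \<open>The logarithm of the coefficient bound is \<open>mu*k*r / ln (k*r)\<close>, which is
  \<open>o(k)\<close>: the denominator \<open>log d\<close> in the hypothesis is used here.\<close>

lemma admissible_eventually:
  assumes mu: "mu > 0" and r: "r \<ge> 1" and T: "T > 0" and \<delta>: "\<delta> > 0"
  shows "\<exists>K0\<ge>3. \<forall>k\<ge>K0. (\<forall>a\<in>admissible r mu k. T * ln (real_of_int (Astar a)) \<le> real k) \<and>
     real (card (admissible r mu k)) \<le> exp (\<delta> * real k)"
proof -
  \<comment> \<open>\<open>b1\<close> makes \<open>ln (k*r)\<close> at least \<open>T*mu*r\<close>.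
    \<open>b2\<close> and \<open>b3\<close> make the coefficient bound and the constant factor 3
    each contribute at most half of \<open>\<delta> * k\<close> to the logarithm of the number of
    vectors.\<close>
  define b1 b2 b3 where "b1 = exp (T * mu * real r)" and "b2 = exp (2 * (real r + 1) * mu * real r / \<delta>)"
    and "b3 = 4 * (real r + 1) / \<delta>"
  define K0 where "K0 = nat \<lceil>b1 + b2 + b3\<rceil> + 3"
  have K3: "K0 \<ge> 3" by (simp add: K0_def)
  have bpos: "b1 > 0" "b2 > 0" "b3 > 0" using \<delta> by (auto simp: b1_def b2_def b3_def)
  show ?thesis
  proof (intro exI[of _ K0] conjI allI impI)
    show "K0 \<ge> 3" by (rule K3)
  next
    fix k assume k: "k \<ge> K0"
    have "b1 + b2 + b3 \<le> real K0" unfolding K0_def by linarith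
    then have kb: "b1 \<le> real k" "b2 \<le> real k" "b3 \<le> real k" using k bpos by linarith+
    have kr1: "k * 1 \<le> k * r" using r by (intro mult_le_mono) auto
    then have kr: "real k \<le> real (k * r)" by (simp only: of_nat_le_iff mult_1_right)
    have k3: "k * r \<ge> 3" using kr1 k K3 by linarith
    define l where "l = ln (real (k * r))"
    have l1: "l \<ge> 1" unfolding l_def using k3 by (intro ln_ge_1_if_ge_3) linarith
    have lb1: "T * mu * real r \<le> l"
      unfolding l_def using kb(1) kr unfolding b1_def by (intro le_ln_if_exp_le) linarith
    have lb2: "2 * (real r + 1) * mu * real r / \<delta> \<le> l"
      unfolding l_def using kb(2) kr unfolding b2_def by (intro le_ln_if_exp_le) linarith
    show "\<forall>a\<in>admissible r mu k. T * ln (real_of_int (Astar a)) \<le> real k"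
    proof
      fix a assume a: "a \<in> admissible r mu k"
      have "0 < real_of_int (Astar a)" using two_le_Astar[of a] by linarith
      moreover have "real_of_int (Astar a) \<le> exp (mu * real (k * r) / l)"
        using a unfolding admissible_def l_def by blast
      ultimately have "ln (real_of_int (Astar a)) \<le> mu * real (k * r) / l" by (rule ln_le_if_le_exp)
      then have "T * ln (real_of_int (Astar a)) \<le> T * (mu * real (k * r) / l)" using T by (intro mult_left_mono) linarith+
      also have "\<dots> = (T * mu * real r) * real k / l" by simp
      also have "\<dots> \<le> l * real k / l" using lb1 l1 by (intro divide_right_mono mult_right_mono) auto
      finally show "T * ln (real_of_int (Astar a)) \<le> real k" using l1 by simp
    qed
    have "real (card (admissible r mu k)) \<le> (3 * exp (mu * real (k * r) / l)) ^ (r + 1)"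
      unfolding l_def by (rule card_admissible(2)[OF mu k3])
    also have "\<dots> \<le> (exp 2 * exp (mu * real (k * r) / l)) ^ (r + 1)"
    proof (intro power_mono mult_right_mono)
      show "(3::real) \<le> exp 2" using exp_ge_add_one_self[of 2] by linarith
    qed auto
    also have "\<dots> = exp (real (r + 1) * (2 + mu * real (k * r) / l))" by (simp only: exp_of_nat_mult exp_add)
    also have "\<dots> \<le> exp (\<delta> * real k)"
    proof -
      have "real (r + 1) * 2 \<le> \<delta> * real k / 2" using kb(3) \<delta> by (simp add: b3_def field_simps)
      moreover have "real (r + 1) * (mu * real (k * r) / l) \<le> \<delta> * real k / 2"
      proof -
        have "2 * (real r + 1) * mu * real r \<le> l * \<delta>" using lb2 \<delta> by (simp add: field_simps)
        then have "2 * (real r + 1) * mu * real r * real k \<le> l * \<delta> * real k" by (rule mult_right_mono) simp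
        then show ?thesis using l1 by (simp add: field_simps)
      qed
      ultimately have "real (r + 1) * 2 + real (r + 1) * (mu * real (k * r) / l) \<le> \<delta> * real k" by linarith
      then show ?thesis unfolding exp_le_cancel_iff distrib_left .
    qed
    finally show "real (card (admissible r mu k)) \<le> exp (\<delta> * real k)" .
  qed
qed

section \<open>Solutions and values of a single form\<close>

definition solutions :: "nat \<Rightarrow> nat \<Rightarrow> int list \<Rightarrow> int \<Rightarrow> (int \<times> int \<times> int poly poly) set" where
  "solutions r k a m = (\<lambda>(x, y). (x, y, fewnomial r k a)) `
     {(x, y). max \<bar>x\<bar> \<bar>y\<bar> \<ge> 2 \<and> eval2 (fewnomial r k a) x y = m}"

text \<open>The value 0 is left out because the lower bounds concern nonzero values; it is added
  again as one extra element in the final count.\<close>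

definition small_values :: "nat \<Rightarrow> nat \<Rightarrow> int list \<Rightarrow> real \<Rightarrow> int set" where
  "small_values r k a N = {m. m \<noteq> 0 \<and> \<bar>real_of_int m\<bar> \<le> N \<and> (\<exists>x y. max \<bar>x\<bar> \<bar>y\<bar> \<ge> 2 \<and> eval2 (fewnomial r k a) x y = m)}"

lemma card_image_subset_le:
  assumes "finite B" "A \<subseteq> h ` B"
  shows "finite A" "card A \<le> card B"
proof -
  show "finite A" by (rule finite_subset[OF assms(2) finite_imageI[OF assms(1)]])
  show "card A \<le> card B"
    by (rule order_trans[OF card_mono[OF finite_imageI[OF assms(1)] assms(2)] card_image_le[OF assms(1)]])
qed

context
  fixes r k :: nat and a :: "int list"
  assumes r: "r \<ge> 1" and k: "k \<ge> 1" and a0: "a ! 0 \<noteq> 0" and ar: "a ! r \<noteq> 0"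
begin

lemma finite_solutions:
  assumes "discriminant (coeff_poly r a) \<noteq> 0" "k * r \<ge> 3" "m \<noteq> 0"
  shows "finite (solutions r k a m)"
proof -
  let ?g = "power_poly r k a"
  obtain c where c: "c > 0" "\<And>x y :: int. hom_form ?g x y \<noteq> 0 \<Longrightarrow>
    c * real_of_int (max \<bar>x\<bar> \<bar>y\<bar>) powr (1/10) \<le> \<bar>real_of_int (hom_form ?g x y)\<bar>"
    using thue_form_lower_bound[OF rsquarefree_power_poly[OF r k a0 ar assms(1)]] assms(2)
    by (auto simp: degree_power_poly[OF r k a0 ar])
  define Y where "Y = max 1 ((\<bar>real_of_int m\<bar> / c) powr 10)"
  have "solutions r k a m \<subseteq> (\<lambda>(x, y). (x, y, fewnomial r k a)) ` {(x, y). real_of_int (max \<bar>x\<bar> \<bar>y\<bar>) \<le> Y}"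
    unfolding solutions_def
  proof (intro image_mono, clarify)
    fix x y :: int assume xy: "2 \<le> max \<bar>x\<bar> \<bar>y\<bar>" "m = eval2 (fewnomial r k a) x y"
    define X where "X = real_of_int (max \<bar>x\<bar> \<bar>y\<bar>)"
    have X: "X \<ge> 2" using xy(1) unfolding X_def by linarith
    have "c * X powr (1/10) \<le> \<bar>real_of_int m\<bar>"
      using c(2)[of x y] assms(3) xy(2) by (simp add: eval2_eq_hom_form_power_poly[OF r k a0 ar] X_def)
    then have "X powr (1/10) \<le> \<bar>real_of_int m\<bar> / c" using c by (simp add: field_simps)
    then have "(X powr (1/10)) powr 10 \<le> (\<bar>real_of_int m\<bar> / c) powr 10" by (intro powr_mono2) auto
    then have "X \<le> (\<bar>real_of_int m\<bar> / c) powr 10" using X by (simp add: powr_powr)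
    then show "real_of_int (max \<bar>x\<bar> \<bar>y\<bar>) \<le> Y" by (simp add: Y_def X_def)
  qed
  moreover have "finite {(x :: int, y :: int). real_of_int (max \<bar>x\<bar> \<bar>y\<bar>) \<le> Y}"
    by (rule card_int_box(1)) (simp add: Y_def)
  ultimately show ?thesis using finite_surj by blast
qed

text \<open>Points of height at most \<open>N^(lam/(2n))\<close>, with \<open>n = k * r\<close>, are
  counted in a box, linearly for one value and quadratically for all values;
  \<open>card_large_points\<close> counts the others. The constants depend on the vector, so this
  serves finitely many forms.\<close>

lemma card_small_degree:
  assumes disc: "discriminant (coeff_poly r a) \<noteq> 0" and n: "k * r \<ge> 3" "d \<le> k * r" "d \<ge> 1"
    and lam: "lam > 2" "real (k * r) * (1 - 2 / lam) > 2"
  shows "\<exists>C\<ge>0. \<forall>m\<in>{m. \<bar>m\<bar> \<ge> 2}. finite (solutions r k a m) \<and>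
      real (card (solutions r k a m)) \<le> C * \<bar>real_of_int m\<bar> powr (lam / (2 * real d))"
    and "\<exists>C\<ge>0. \<forall>N\<in>{2..}. finite (small_values r k a N) \<and>
      real (card (small_values r k a N)) \<le> C * N powr (lam / real d)"
proof -
  let ?g = "power_poly r k a"
  define n where "n = k * r"
  have n3: "n \<ge> 3" and dn: "d \<le> n" using n by (auto simp: n_def)
  have dg: "degree ?g = n" by (simp add: degree_power_poly[OF r k a0 ar] n_def)
  have ev: "eval2 (fewnomial r k a) x y = hom_form ?g x y" for x y by (rule eval2_eq_hom_form_power_poly[OF r k a0 ar])
  define Lg where "Lg N = {(x :: int, y :: int). hom_form ?g x y \<noteq> 0 \<and> \<bar>real_of_int (hom_form ?g x y)\<bar> \<le> N \<and>
       N powr (lam / (2 * real n)) < real_of_int (max \<bar>x\<bar> \<bar>y\<bar>)}" for N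
  obtain C where C: "C > 0" "\<And>N. N \<ge> 1 \<Longrightarrow> finite (Lg N)"
    "\<And>N. N \<ge> 1 \<Longrightarrow> real (card (Lg N)) \<le> C * N powr (lam / (2 * real n))"
    using card_large_points[OF rsquarefree_power_poly[OF r k a0 ar disc] dg n3 lam(1)] lam(2)
    unfolding Lg_def n_def by blast
  have mono: "N powr (lam / (c * real n)) \<le> N powr (lam / (c * real d))" if "N \<ge> 1" "c > 0" for N c :: real
    using that dn n lam by (intro powr_mono divide_left_mono mult_left_mono mult_pos_pos) auto
  show "\<exists>C\<ge>0. \<forall>m\<in>{m. \<bar>m\<bar> \<ge> 2}. finite (solutions r k a m) \<and>
      real (card (solutions r k a m)) \<le> C * \<bar>real_of_int m\<bar> powr (lam / (2 * real d))"
  proof (intro exI[of _ "3 * real n + C"] conjI ballI)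
    show "3 * real n + C \<ge> 0" using C by simp
  next
    fix m :: int assume "m \<in> {m. \<bar>m\<bar> \<ge> 2}"
    then have m2: "\<bar>m\<bar> \<ge> 2" by simp
    define N where "N = \<bar>real_of_int m\<bar>"
    have N: "N \<ge> 2" using m2 unfolding N_def by linarith
    define Y where "Y = N powr (lam / (2 * real n))"
    have Y: "Y \<ge> 1" using N lam by (simp add: Y_def ge_one_powr_ge_zero)
    define Bx where "Bx = {(x, y). hom_form ?g x y = m \<and> real_of_int (max \<bar>x\<bar> \<bar>y\<bar>) \<le> Y}"
    have Bx: "finite Bx" "real (card Bx) \<le> 3 * real n * Y"
      unfolding Bx_def using card_solutions_in_box[OF dg _ Y] n3 by auto
    have sub: "solutions r k a m \<subseteq> (\<lambda>(x, y). (x, y, fewnomial r k a)) ` (Bx \<union> Lg N)"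
      unfolding solutions_def using m2 by (intro image_mono) (auto simp: Bx_def Lg_def ev Y_def N_def)
    have finU: "finite (Bx \<union> Lg N)" using Bx C(2) N by simp
    show "finite (solutions r k a m)" using card_image_subset_le(1)[OF finU sub] .
    have "card (solutions r k a m) \<le> card Bx + card (Lg N)"
      using card_image_subset_le(2)[OF finU sub] card_Un_le[of Bx "Lg N"] by linarith
    then have "real (card (solutions r k a m)) \<le> real (card Bx) + real (card (Lg N))" by linarith
    also have "\<dots> \<le> (3 * real n + C) * Y" using Bx C(3)[of N] N by (simp add: Y_def distrib_right)
    also have "\<dots> \<le> (3 * real n + C) * N powr (lam / (2 * real d))"
      unfolding Y_def using mono[of N 2] N C by (intro mult_left_mono) auto
    finally show "real (card (solutions r k a m)) \<le> (3 * real n + C) * \<bar>real_of_int m\<bar> powr (lam / (2 * real d))"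
      by (simp add: N_def)
  qed
  show "\<exists>C\<ge>0. \<forall>N\<in>{2..}. finite (small_values r k a N) \<and>
      real (card (small_values r k a N)) \<le> C * N powr (lam / real d)"
  proof (intro exI[of _ "9 + C"] conjI ballI)
    show "9 + C \<ge> 0" using C by simp
  next
    fix N :: real assume "N \<in> {2..}"
    then have N: "N \<ge> 2" by simp
    define Y where "Y = N powr (lam / (2 * real n))"
    have Y: "Y \<ge> 1" using N lam by (simp add: Y_def ge_one_powr_ge_zero)
    define Bx where "Bx = {(x :: int, y :: int). real_of_int (max \<bar>x\<bar> \<bar>y\<bar>) \<le> Y}"
    have Bx: "finite Bx" "real (card Bx) \<le> 9 * Y\<^sup>2" unfolding Bx_def using card_int_box[OF Y] by auto
    have sub: "small_values r k a N \<subseteq> (\<lambda>(x, y). eval2 (fewnomial r k a) x y) ` (Bx \<union> Lg N)"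
    proof
      fix m assume "m \<in> small_values r k a N"
      then obtain x y where m: "m \<noteq> 0" "\<bar>real_of_int m\<bar> \<le> N" "eval2 (fewnomial r k a) x y = m"
        by (auto simp: small_values_def)
      then have "(x, y) \<in> Bx \<union> Lg N" by (auto simp: Bx_def Lg_def ev Y_def)
      then show "m \<in> (\<lambda>(x, y). eval2 (fewnomial r k a) x y) ` (Bx \<union> Lg N)" using m(3) by force
    qed
    have finU: "finite (Bx \<union> Lg N)" using Bx C(2) N by simp
    show "finite (small_values r k a N)" using card_image_subset_le(1)[OF finU sub] .
    have "card (small_values r k a N) \<le> card Bx + card (Lg N)"
      using card_image_subset_le(2)[OF finU sub] card_Un_le[of Bx "Lg N"] by linarith
    then have "real (card (small_values r k a N)) \<le> real (card Bx) + real (card (Lg N))" by linarith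
    also have "\<dots> \<le> 9 * Y\<^sup>2 + C * Y" using Bx C(3)[of N] N by (simp add: Y_def)
    also have "\<dots> \<le> 9 * Y\<^sup>2 + C * Y\<^sup>2" using C Y mult_left_mono[of 1 Y Y] by (intro add_left_mono mult_left_mono) (auto simp: power2_eq_square)
    also have "\<dots> = (9 + C) * Y\<^sup>2" by (simp add: distrib_right)
    also have "Y\<^sup>2 = N powr (lam / (1 * real n))" unfolding Y_def power2_eq_square by (simp flip: powr_add)
    also have "(9 + C) * N powr (lam / (1 * real n)) \<le> (9 + C) * N powr (lam / (1 * real d))"
      using mono[of N 1] N C by (intro mult_left_mono) auto
    finally show "real (card (small_values r k a N)) \<le> (9 + C) * N powr (lam / real d)" by simp
  qed
qed

text \<open>Under \<open>lower\<close> every point with nonzero value of size at most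
  \<open>N\<close> lies in the box of side \<open>N^(lam'/(2n))\<close>, so no count of large points
  is involved and the constants are uniform in the vector. As the height is at least 2,
  \<open>lower\<close> also bounds the degree by a multiple of \<open>ln N\<close>.\<close>

lemma card_large_degree:
  fixes lam' :: real
  defines "n \<equiv> k * r"
  assumes lower: "\<And>x y :: int. eval2 (fewnomial r k a) x y \<noteq> 0 \<Longrightarrow>
      real_of_int (max \<bar>x\<bar> \<bar>y\<bar>) powr (real n * (2 / lam')) \<le> \<bar>real_of_int (eval2 (fewnomial r k a) x y)\<bar>"
    and lam': "lam' > 2" and d: "d \<le> n" "d \<ge> 1"
  shows "\<bar>m\<bar> \<ge> 2 \<Longrightarrow> finite (solutions r k a m) \<and>
      (solutions r k a m \<noteq> {} \<longrightarrow> real k \<le> lam' * ln \<bar>real_of_int m\<bar>) \<and>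
      real (card (solutions r k a m)) \<le> 9 * real r * real k * \<bar>real_of_int m\<bar> powr (lam' / (2 * real d))"
    and "N \<ge> 2 \<Longrightarrow> finite (small_values r k a N) \<and>
      (small_values r k a N \<noteq> {} \<longrightarrow> real k \<le> lam' * ln N) \<and>
      real (card (small_values r k a N)) \<le> 9 * real r * real k * N powr (lam' / real d)"
proof -
  have n1: "n \<ge> 1" using d by simp
  have kn: "real k \<le> real n" unfolding n_def using r mult_left_mono[of 1 "real r" "real k"] by simp
  have X_le: "real_of_int (max \<bar>x\<bar> \<bar>y\<bar>) \<le> N powr (lam' / (2 * real n))"
    if "eval2 (fewnomial r k a) x y \<noteq> 0" "\<bar>real_of_int (eval2 (fewnomial r k a) x y)\<bar> \<le> N" "max \<bar>x\<bar> \<bar>y\<bar> \<ge> 2" for x y N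
  proof -
    define X where "X = real_of_int (max \<bar>x\<bar> \<bar>y\<bar>)"
    have X: "X \<ge> 2" using that(3) unfolding X_def by linarith
    have "X powr (real n * (2 / lam')) \<le> N" using lower[OF that(1)] that(2) by (simp add: X_def)
    then have "(X powr (real n * (2 / lam'))) powr (lam' / (2 * real n)) \<le> N powr (lam' / (2 * real n))"
      using lam' by (intro powr_mono2) auto
    moreover have "real n * (2 / lam') * (lam' / (2 * real n)) = 1" using lam' n1 by simp
    ultimately show ?thesis using X by (simp add: powr_powr X_def)
  qed
  have k_le: "real k \<le> lam' * ln N"
    if "eval2 (fewnomial r k a) x y \<noteq> 0" "\<bar>real_of_int (eval2 (fewnomial r k a) x y)\<bar> \<le> N" "max \<bar>x\<bar> \<bar>y\<bar> \<ge> 2" for x y N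
  proof -
    define X where "X = real_of_int (max \<bar>x\<bar> \<bar>y\<bar>)"
    have X: "X \<ge> 2" using that(3) unfolding X_def by linarith
    have "2 powr (real n * (2 / lam')) \<le> X powr (real n * (2 / lam'))" using X lam' by (intro powr_mono2) auto
    also have "\<dots> \<le> N" using lower[OF that(1)] that(2) by (simp add: X_def)
    finally have le: "2 powr (real n * (2 / lam')) \<le> N" .
    then have "ln (2 powr (real n * (2 / lam'))) \<le> ln N"
      using le by (subst ln_le_cancel_iff) (auto intro: less_le_trans[of 0 "2 powr (real n * (2 / lam'))"])
    then have "real n * (2 / lam') * ln 2 \<le> ln N" by (simp add: ln_powr)
    moreover have "real n * (2 / lam') * (1/2) \<le> real n * (2 / lam') * ln 2"
      using half_less_ln_2 lam' by (intro mult_left_mono) auto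
    ultimately have "real n / lam' \<le> ln N" by simp
    then have "real n \<le> lam' * ln N" using lam' by (simp add: field_simps)
    then show ?thesis using kn by linarith
  qed
  have nrk: "real n = real r * real k" by (simp add: n_def)
  show "finite (solutions r k a m) \<and>
      (solutions r k a m \<noteq> {} \<longrightarrow> real k \<le> lam' * ln \<bar>real_of_int m\<bar>) \<and>
      real (card (solutions r k a m)) \<le> 9 * real r * real k * \<bar>real_of_int m\<bar> powr (lam' / (2 * real d))"
    if m2: "\<bar>m\<bar> \<ge> 2"
  proof -
    let ?g = "power_poly r k a"
    have dg: "degree ?g = n" by (simp add: degree_power_poly[OF r k a0 ar] n_def)
    define N where "N = \<bar>real_of_int m\<bar>"
    have N: "N \<ge> 2" using m2 unfolding N_def by linarith
    define Y where "Y = N powr (lam' / (2 * real n))"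
    have Y: "Y \<ge> 1" using N lam' by (simp add: Y_def ge_one_powr_ge_zero)
    define Bx where "Bx = {(x, y). hom_form ?g x y = m \<and> real_of_int (max \<bar>x\<bar> \<bar>y\<bar>) \<le> Y}"
    have Bx: "finite Bx" "real (card Bx) \<le> 3 * real n * Y"
      unfolding Bx_def using card_solutions_in_box[OF dg n1 Y] by auto
    have sub: "solutions r k a m \<subseteq> (\<lambda>(x, y). (x, y, fewnomial r k a)) ` Bx"
      unfolding solutions_def
    proof (intro image_mono, clarify)
      fix x y :: int assume xy: "2 \<le> max \<bar>x\<bar> \<bar>y\<bar>" "m = eval2 (fewnomial r k a) x y"
      have "real_of_int (max \<bar>x\<bar> \<bar>y\<bar>) \<le> Y"
        unfolding Y_def N_def using xy m2 by (intro X_le) auto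
      then show "(x, y) \<in> Bx" using xy(2)
        by (simp add: Bx_def eval2_eq_hom_form_power_poly[OF r k a0 ar])
    qed
    have "real (card (solutions r k a m)) \<le> real (card Bx)" using card_image_subset_le(2)[OF Bx(1) sub] by simp
    also have "\<dots> \<le> 9 * real n * Y" using Bx(2) Y n1 by (auto intro: order_trans)
    also have "\<dots> \<le> 9 * real n * N powr (lam' / (2 * real d))"
      unfolding Y_def using N d lam' by (intro mult_left_mono powr_mono divide_left_mono mult_pos_pos) auto
    finally have "real (card (solutions r k a m)) \<le> 9 * real r * real k * \<bar>real_of_int m\<bar> powr (lam' / (2 * real d))"
      by (simp add: N_def nrk mult_ac)
    moreover have "real k \<le> lam' * ln \<bar>real_of_int m\<bar>" if ne: "solutions r k a m \<noteq> {}"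
    proof -
      obtain p where "p \<in> {(x, y). 2 \<le> max \<bar>x\<bar> \<bar>y\<bar> \<and> eval2 (fewnomial r k a) x y = m}"
        using ne unfolding solutions_def by blast
      then have xy: "2 \<le> max \<bar>fst p\<bar> \<bar>snd p\<bar>" "eval2 (fewnomial r k a) (fst p) (snd p) = m"
        unfolding case_prod_unfold mem_Collect_eq by blast+
      show ?thesis
      proof (rule k_le[OF _ _ xy(1)])
        show "eval2 (fewnomial r k a) (fst p) (snd p) \<noteq> 0" using xy(2) m2 by linarith
        show "\<bar>real_of_int (eval2 (fewnomial r k a) (fst p) (snd p))\<bar> \<le> \<bar>real_of_int m\<bar>" by (simp only: xy(2))
      qed
    qed
    ultimately show ?thesis using card_image_subset_le(1)[OF Bx(1) sub] by blast
  qed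
  show "finite (small_values r k a N) \<and>
      (small_values r k a N \<noteq> {} \<longrightarrow> real k \<le> lam' * ln N) \<and>
      real (card (small_values r k a N)) \<le> 9 * real r * real k * N powr (lam' / real d)"
    if N: "N \<ge> 2"
  proof -
    define Y where "Y = N powr (lam' / (2 * real n))"
    have Y: "Y \<ge> 1" using N lam' by (simp add: Y_def ge_one_powr_ge_zero)
    define Bx where "Bx = {(x :: int, y :: int). real_of_int (max \<bar>x\<bar> \<bar>y\<bar>) \<le> Y}"
    have Bx: "finite Bx" "real (card Bx) \<le> 9 * Y\<^sup>2" unfolding Bx_def using card_int_box[OF Y] by auto
    have sub: "small_values r k a N \<subseteq> (\<lambda>(x, y). eval2 (fewnomial r k a) x y) ` Bx"
    proof
      fix m assume "m \<in> small_values r k a N"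
      then obtain x y where m: "m \<noteq> 0" "\<bar>real_of_int m\<bar> \<le> N" "eval2 (fewnomial r k a) x y = m" "max \<bar>x\<bar> \<bar>y\<bar> \<ge> 2"
        by (auto simp: small_values_def)
      then have "(x, y) \<in> Bx" using X_le[of x y N] by (auto simp: Bx_def Y_def)
      then show "m \<in> (\<lambda>(x, y). eval2 (fewnomial r k a) x y) ` Bx" using m(3) by force
    qed
    have "real (card (small_values r k a N)) \<le> real (card Bx)" using card_image_subset_le(2)[OF Bx(1) sub] by simp
    also have "\<dots> \<le> 9 * Y\<^sup>2" by (rule Bx(2))
    also have "Y\<^sup>2 = N powr (lam' / real n)" unfolding Y_def power2_eq_square by (simp flip: powr_add)
    also have "9 * N powr (lam' / real n) \<le> 9 * N powr (lam' / real d)"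
      using N d lam' by (intro mult_left_mono powr_mono divide_left_mono mult_pos_pos) auto
    also have "\<dots> \<le> 9 * real n * N powr (lam' / real d)"
      using n1 by (intro mult_right_mono) auto
    finally have "real (card (small_values r k a N)) \<le> 9 * real r * real k * N powr (lam' / real d)"
      by (simp add: nrk mult_ac)
    moreover have "real k \<le> lam' * ln N" if ne: "small_values r k a N \<noteq> {}"
    proof -
      obtain m x y where xy: "m \<noteq> 0" "\<bar>real_of_int m\<bar> \<le> N" "2 \<le> max \<bar>x\<bar> \<bar>y\<bar>" "eval2 (fewnomial r k a) x y = m"
        using ne unfolding small_values_def by blast
      show ?thesis by (rule k_le[of x y N]) (simp_all only: xy not_False_eq_True)
    qed
    ultimately show ?thesis using card_image_subset_le(1)[OF Bx(1) sub] by blast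
  qed
qed

end

text \<open>Because \<open>Astar a\<close> is at least 2, an admissible vector exists only if
  \<open>mu * n / ln n >= ln 2\<close> for \<open>n = k * r\<close>, hence
  \<open>mu * n > 1/2\<close>. The bound on \<open>mu\<close> turns this into a lower bound for the
  degree, the condition for the gap principle.\<close>

lemma admissible_degree_large:
  assumes lam: "lam > 2" and mu: "mu \<le> (lam - 2) / (8 * lam)" and k: "k * r \<ge> 3"
    and a: "a \<in> admissible r mu k"
  shows "real (k * r) * (1 - 2 / lam) > 2"
proof -
  define n where "n = real (k * r)"
  have n: "n \<ge> 3" unfolding n_def using k by linarith
  have l: "ln n \<ge> 1" by (rule ln_ge_1_if_ge_3[OF n])
  have "2 \<le> Astar a" using two_le_Astar[of a] a by (simp add: admissible_def)
  then have "2 \<le> real_of_int (Astar a)" by linarith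
  also have "\<dots> \<le> exp (mu * n / ln n)" using a by (simp add: admissible_def n_def)
  finally have e: "2 \<le> exp (mu * n / ln n)" .
  have "ln 2 \<le> mu * n / ln n" by (rule ln_le_if_le_exp[OF _ e]) simp
  then have "1/2 < mu * n / ln n" using half_less_ln_2 by linarith
  then have "ln n / 2 < mu * n" using l by (simp add: field_simps)
  then have "1/2 < mu * n" using l by linarith
  also have "\<dots> \<le> (lam - 2) / (8 * lam) * n" using mu n by (intro mult_right_mono) auto
  also have "\<dots> = n * (1 - 2 / lam) / 8" using lam by (simp add: field_simps)
  finally show ?thesis by (simp add: n_def)
qed

section \<open>From single forms to the family\<close>

lemma family_member_admissible:
  assumes data: "fewnomial_data r E" and bound: "Astar_bound r E mu d0"
    and k: "k \<ge> 1" "k * r \<ge> 3" "a \<in> E k" "k * r \<ge> d0"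
  shows "a \<in> admissible r mu k"
proof -
  have a: "length a = r + 1" "a ! 0 * a ! r \<noteq> 0" "discriminant (coeff_poly r a) \<noteq> 0"
    using data k unfolding fewnomial_data_def by blast+
  have "fewnomial r k a \<in> family_deg r E (k * r)"
    unfolding family_deg_def family_def using k a total_degree_fewnomial[OF k(1), of a r] by auto
  then have "real_of_int (Astar a) \<le> exp (mu * real (k * r) / ln (real (k * r)))"
    using bound k unfolding Astar_bound_def by blast
  then show ?thesis using a by (simp add: admissible_def)
qed

lemma mem_G_ge:
  assumes data: "fewnomial_data r E" and p: "p \<in> G_ge r E d m"
  shows "\<exists>k a. k \<ge> 1 \<and> k * r \<ge> 3 \<and> a \<in> E k \<and> k * r \<ge> d \<and> p \<in> solutions r k a m"
proof -
  obtain x y F where F: "p = (x, y, F)" "F \<in> family r E" "total_degree F \<ge> d" "max \<bar>x\<bar> \<bar>y\<bar> \<ge> 2" "eval2 F x y = m"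
    using p by (auto simp: G_ge_def)
  obtain k a where k: "F = fewnomial r k a" "k \<ge> 1" "k * r \<ge> 3" "a \<in> E k" using F(2) by (auto simp: family_def)
  have "a ! 0 \<noteq> 0" using data k unfolding fewnomial_data_def by fastforce
  then have "total_degree F = k * r" using total_degree_fewnomial[OF k(2)] k(1) by simp
  moreover have "p \<in> solutions r k a m" unfolding solutions_def using F k(1) by force
  ultimately show ?thesis using F(3) k by auto
qed

theorem theorem2p6:
  fixes r :: nat and C lam mu :: real
  assumes "r \<ge> 2"
    and "C = 2 ^ 79 * 3 ^ 15"
    and "lam > 2"
    and "0 < mu" and "mu < (lam - 2) / (C * real r ^ (4 * r) * lam)"
  shows
    "(\<forall>E d0. fewnomial_data r E \<and> d0 \<ge> 3 \<and> Astar_bound r E mu d0 \<longrightarrow>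
        (\<forall>m d. m \<notin> {-1, 0, 1} \<and> d \<ge> 3 \<and> r dvd d \<longrightarrow> finite (G_ge r E d m)))
     \<and> (\<forall>d. r dvd d \<longrightarrow>
        (\<exists>c1::real. \<forall>E d0. fewnomial_data r E \<and> d0 \<ge> 3 \<and> Astar_bound r E mu d0 \<and> d \<ge> d0 \<longrightarrow>
          (\<forall>m. \<bar>m\<bar> \<ge> 2 \<longrightarrow>
             real (card (G_ge r E d m)) \<le> c1 * \<bar>real_of_int m\<bar> powr (lam / (2 * real d)))))
     \<and> (\<forall>d. r dvd d \<longrightarrow>
        (\<exists>c2::real. \<forall>E d0. fewnomial_data r E \<and> d0 \<ge> 3 \<and> Astar_bound r E mu d0 \<and> d \<ge> d0 \<longrightarrow>
          (\<forall>N::real. N \<ge> 2 \<longrightarrow>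
             real (card (R_ge r E d N)) \<le> c2 * N powr (lam / real d))))"
proof -
  have r1: "r \<ge> 1" and mu: "mu > 0" and lam: "lam > 2" using assms by auto
  have mu8: "mu \<le> (lam - 2) / (8 * lam)"
  proof -
    have "(1::real) \<le> real r ^ (4 * r)" using r1 by (intro one_le_power) simp
    moreover have "8 \<le> C" unfolding assms(2) by simp
    ultimately have "8 * 1 \<le> C * real r ^ (4 * r)" by (intro mult_mono) auto
    then have C8: "8 \<le> C * real r ^ (4 * r)" by simp
    then have Cpos: "0 < C * real r ^ (4 * r)" by linarith
    have "(lam - 2) / (C * real r ^ (4 * r) * lam) \<le> (lam - 2) / (8 * lam)"
      using lam C8 by (intro divide_left_mono mult_right_mono Cpos mult_pos_pos) auto
    then show ?thesis using assms(5) by linarith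
  qed
  \<comment> \<open>The midpoint of 2 and \<open>lam\<close>: large degrees are treated with
    \<open>lam'\<close>, and \<open>lam - lam'\<close> pays for summing over the forms.\<close>
  define lam' where "lam' = (lam + 2) / 2"
  have lam': "lam' > 2" "lam' < lam" using lam by (auto simp: lam'_def)
  define \<epsilon> where "\<epsilon> = 1 - 2 / lam'"
  have \<epsilon>: "\<epsilon> > 0" using lam' by (simp add: \<epsilon>_def)
  obtain T where T: "T > 0" "\<And>(f :: int poly) (A :: int) (k :: nat) (x :: int) (y :: int).
    degree f = r \<Longrightarrow> coeff f 0 \<noteq> 0 \<Longrightarrow> (\<forall>i. \<bar>coeff f i\<bar> \<le> A) \<Longrightarrow> A \<ge> 2 \<Longrightarrow>
    T * ln (real_of_int A) \<le> real k \<Longrightarrow> hom_form f (x ^ k) (y ^ k) \<noteq> 0 \<Longrightarrow>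
    real_of_int (max \<bar>x\<bar> \<bar>y\<bar>) powr (real (k * r) * (1 - \<epsilon>)) \<le> \<bar>real_of_int (hom_form f (x ^ k) (y ^ k))\<bar>"
    using power_form_lower_bound[OF r1 \<epsilon>] by blast
  have lower: "real_of_int (max \<bar>x\<bar> \<bar>y\<bar>) powr (real (k * r) * (2 / lam')) \<le> \<bar>real_of_int (eval2 (fewnomial r k a) x y)\<bar>"
    if a: "a \<in> admissible r mu k" and k: "T * ln (real_of_int (Astar a)) \<le> real k"
      and nz: "eval2 (fewnomial r k a) x y \<noteq> 0" for a k x y
  proof -
    have a': "length a = r + 1" "a ! 0 \<noteq> 0" "a ! r \<noteq> 0" using a by (auto simp: admissible_def)
    have "real_of_int (max \<bar>x\<bar> \<bar>y\<bar>) powr (real (k * r) * (1 - \<epsilon>)) \<le>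
        \<bar>real_of_int (hom_form (coeff_poly r a) (x ^ k) (y ^ k))\<bar>"
      using a' k nz abs_coeff_coeff_poly_le[OF a'(1)] two_le_Astar[of a]
      by (intro T(2)[where A = "Astar a"])
         (auto simp: degree_coeff_poly coeff_coeff_poly eval2_eq_hom_form)
    then show ?thesis by (simp add: eval2_eq_hom_form[OF a'(2)] \<epsilon>_def)
  qed
  have finite_part: "finite (G_ge r E d m)"
    if E: "fewnomial_data r E" "d0 \<ge> 3" "Astar_bound r E mu d0" and m: "m \<notin> {-1, 0, 1}" for E d0 m d
  proof -
    have m2: "\<bar>m\<bar> \<ge> 2" and m0: "m \<noteq> 0" using m by auto
    obtain K0 where K0: "K0 \<ge> 3" "\<And>k a. k \<ge> K0 \<Longrightarrow> a \<in> admissible r mu k \<Longrightarrow> T * ln (real_of_int (Astar a)) \<le> real k"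
      using admissible_eventually[OF mu r1 T(1), of 1] by auto
    \<comment> \<open>Above \<open>B\<close> the bound on \<open>Astar\<close> applies, because
      \<open>k * r >= d0\<close>, and the height bound excludes solutions. Below it there are
      finitely many forms, and each has finitely many solutions by Thue's theorem even if its degree
      is less than \<open>d0\<close>.\<close>
    define B where "B = max (max K0 d0) (nat \<lfloor>lam' * ln \<bar>real_of_int m\<bar>\<rfloor>)"
    define Ks where "Ks = {k. k \<le> B \<and> k \<ge> 1 \<and> k * r \<ge> 3}"
    have "G_ge r E d m \<subseteq> (\<Union>k\<in>Ks. \<Union>a\<in>E k. solutions r k a m)"
    proof
      fix p assume "p \<in> G_ge r E d m"
      then obtain k a where k: "k \<ge> 1" "k * r \<ge> 3" "a \<in> E k" "p \<in> solutions r k a m"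
        using mem_G_ge[OF E(1)] by blast
      have "k \<le> B"
      proof (rule ccontr)
        assume "\<not> k \<le> B"
        then have kB: "k > K0" "k > d0" "k > nat \<lfloor>lam' * ln \<bar>real_of_int m\<bar>\<rfloor>" by (auto simp: B_def)
        have "k * 1 \<le> k * r" using r1 by (intro mult_le_mono) auto
        then have "d0 \<le> k * r" using kB by linarith
        then have adm: "a \<in> admissible r mu k" by (rule family_member_admissible[OF E(1,3) k(1-3)])
        then have a': "a ! 0 \<noteq> 0" "a ! r \<noteq> 0" by (auto simp: admissible_def)
        have "real k \<le> lam' * ln \<bar>real_of_int m\<bar>"
          using card_large_degree(1)[OF r1 k(1) a' lower[OF adm K0(2)[OF _ adm]] lam'(1), of 1 m] k kB m2 r1 by auto
        then have "k \<le> nat \<lfloor>lam' * ln \<bar>real_of_int m\<bar>\<rfloor>" by (simp add: le_nat_floor)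
        then show False using kB by simp
      qed
      then show "p \<in> (\<Union>k\<in>Ks. \<Union>a\<in>E k. solutions r k a m)" using k by (auto simp: Ks_def)
    qed
    moreover have "finite (\<Union>k\<in>Ks. \<Union>a\<in>E k. solutions r k a m)"
    proof (intro finite_UN_I)
      show "finite Ks" by (rule finite_subset[of _ "{..B}"]) (auto simp: Ks_def)
    next
      fix k assume k: "k \<in> Ks"
      then show "finite (E k)" using E(1) by (auto simp: fewnomial_data_def Ks_def)
      fix a assume "a \<in> E k"
      then have a: "a ! 0 * a ! r \<noteq> 0" "discriminant (coeff_poly r a) \<noteq> 0"
        using E(1) k unfolding fewnomial_data_def Ks_def by auto
      then show "finite (solutions r k a m)" using k m0 r1
        by (intro finite_solutions) (auto simp: Ks_def)
    qed
    ultimately show ?thesis by (rule finite_subset)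
  qed
  have count_part: "(\<exists>c1::real. \<forall>E d0. fewnomial_data r E \<and> d0 \<ge> 3 \<and> Astar_bound r E mu d0 \<and> d \<ge> d0 \<longrightarrow>
          (\<forall>m. \<bar>m\<bar> \<ge> 2 \<longrightarrow>
             real (card (G_ge r E d m)) \<le> c1 * \<bar>real_of_int m\<bar> powr (lam / (2 * real d)))) \<and>
     (\<exists>c2::real. \<forall>E d0. fewnomial_data r E \<and> d0 \<ge> 3 \<and> Astar_bound r E mu d0 \<and> d \<ge> d0 \<longrightarrow>
          (\<forall>N::real. N \<ge> 2 \<longrightarrow>
             real (card (R_ge r E d N)) \<le> c2 * N powr (lam / real d)))" (is "?P1 \<and> ?P2") for d
  proof (cases "d \<ge> 3")
    case False
    \<comment> \<open>For \<open>d < 3\<close> the premises \<open>3 <= d0 <= d\<close> are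
      contradictory.\<close>
    then show ?thesis by (meson le_trans)
  next
    case d3: True
    \<comment> \<open>Three times \<open>\<sigma>\<close> is exactly the room
      \<open>(lam - lam') / (2 * d)\<close> between the exponents in part (a); part (b) has twice
      this room.\<close>
    define \<sigma> where "\<sigma> = (lam - lam') / (6 * real d)"
    define \<delta> where "\<delta> = \<sigma> / lam'"
    have \<sigma>: "\<sigma> > 0" using lam' d3 by (simp add: \<sigma>_def)
    have \<delta>: "\<delta> > 0" "\<delta> * lam' \<le> \<sigma>" using \<sigma> lam' by (auto simp: \<delta>_def)
    have e1: "lam' / (2 * real d) + 3 * \<sigma> \<le> lam / (2 * real d)"
      using d3 by (simp add: \<sigma>_def field_simps)
    have e2: "lam' / real d + 3 * \<sigma> \<le> lam / real d"
      using d3 lam' by (simp add: \<sigma>_def field_simps)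
    obtain K0 where K0: "K0 \<ge> 3" "\<And>k a. k \<ge> K0 \<Longrightarrow> a \<in> admissible r mu k \<Longrightarrow> T * ln (real_of_int (Astar a)) \<le> real k"
        "\<And>k. k \<ge> K0 \<Longrightarrow> real (card (admissible r mu k)) \<le> exp (\<delta> * real k)"
      using admissible_eventually[OF mu r1 T(1) \<delta>(1)] by auto
    define Ks where "Ks = {k. k \<ge> 1 \<and> k * r \<ge> d}"
    have fin: "finite (admissible r mu k)" if "k \<in> Ks" for k
      using that d3 by (intro card_admissible mu) (auto simp: Ks_def)
    have sub: "\<exists>k\<in>Ks. \<exists>a\<in>admissible r mu k. p \<in> solutions r k a m"
      if E: "fewnomial_data r E" "Astar_bound r E mu d0" "d \<ge> d0" "p \<in> G_ge r E d m" for E d0 p m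
    proof -
      obtain k a where k: "k \<ge> 1" "k * r \<ge> 3" "a \<in> E k" "k * r \<ge> d" "p \<in> solutions r k a m"
        using mem_G_ge[OF E(1,4)] by blast
      moreover have "a \<in> admissible r mu k"
        using k(4) E(3) by (intro family_member_admissible[OF E(1,2) k(1-3)]) linarith
      ultimately show ?thesis by (auto simp: Ks_def)
    qed
    have ?P1
    proof -
      have "\<exists>C\<ge>0. \<forall>m\<in>{m :: int. \<bar>m\<bar> \<ge> 2}. finite (\<Union>k\<in>Ks. \<Union>a\<in>admissible r mu k. solutions r k a m) \<and>
        real (card (\<Union>k\<in>Ks. \<Union>a\<in>admissible r mu k. solutions r k a m)) \<le> C * \<bar>real_of_int m\<bar> powr (lam / (2 * real d))"
      proof (rule card_union_bound[where ?K0.0 = K0 and L = lam' and D = "9 * real r" and e' = "lam' / (2 * real d)"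
            and \<delta> = \<delta> and \<sigma> = \<sigma>])
        fix k a assume k: "k \<in> Ks" "a \<in> admissible r mu k"
        then show "\<exists>C\<ge>0. \<forall>m\<in>{m. 2 \<le> \<bar>m\<bar>}. finite (solutions r k a m) \<and>
            real (card (solutions r k a m)) \<le> C * \<bar>real_of_int m\<bar> powr (lam / (2 * real d))"
          using d3 lam r1 admissible_degree_large[OF lam mu8 _ k(2)]
          by (intro card_small_degree) (auto simp: Ks_def admissible_def)
      next
        fix k a and m :: int assume k: "k \<in> Ks" "K0 \<le> k" "a \<in> admissible r mu k" "m \<in> {m. 2 \<le> \<bar>m\<bar>}"
        then have a': "a ! 0 \<noteq> 0" "a ! r \<noteq> 0" by (auto simp: admissible_def)
        show "finite (solutions r k a m) \<and> (solutions r k a m \<noteq> {} \<longrightarrow> real k \<le> lam' * ln \<bar>real_of_int m\<bar>) \<and>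
           real (card (solutions r k a m)) \<le> 9 * real r * real k * \<bar>real_of_int m\<bar> powr (lam' / (2 * real d))"
          using card_large_degree(1)[OF r1 _ a' lower[OF k(3) K0(2)[OF k(2,3)]] lam'(1), of d m] k d3
          by (auto simp: Ks_def)
      qed (use fin K0 \<sigma> \<delta> lam' e1 in auto)
      then obtain C where C: "\<And>m :: int. \<bar>m\<bar> \<ge> 2 \<Longrightarrow> finite (\<Union>k\<in>Ks. \<Union>a\<in>admissible r mu k. solutions r k a m)"
        "\<And>m :: int. \<bar>m\<bar> \<ge> 2 \<Longrightarrow> real (card (\<Union>k\<in>Ks. \<Union>a\<in>admissible r mu k. solutions r k a m)) \<le> C * \<bar>real_of_int m\<bar> powr (lam / (2 * real d))"
        by auto
      show ?thesis
      proof (intro exI[of _ C] allI impI)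
        fix E d0 and m :: int
        assume E: "fewnomial_data r E \<and> d0 \<ge> 3 \<and> Astar_bound r E mu d0 \<and> d \<ge> d0" and m: "\<bar>m\<bar> \<ge> 2"
        have "G_ge r E d m \<subseteq> (\<Union>k\<in>Ks. \<Union>a\<in>admissible r mu k. solutions r k a m)"
        proof
          fix p assume p: "p \<in> G_ge r E d m"
          have "\<exists>k\<in>Ks. \<exists>a\<in>admissible r mu k. p \<in> solutions r k a m" by (rule sub[OF _ _ _ p]) (use E in auto)
          then show "p \<in> (\<Union>k\<in>Ks. \<Union>a\<in>admissible r mu k. solutions r k a m)" by blast
        qed
        then have "card (G_ge r E d m) \<le> card (\<Union>k\<in>Ks. \<Union>a\<in>admissible r mu k. solutions r k a m)"
          using C(1)[OF m] by (intro card_mono)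
        then show "real (card (G_ge r E d m)) \<le> C * \<bar>real_of_int m\<bar> powr (lam / (2 * real d))"
          using C(2)[OF m] by linarith
      qed
    qed
    moreover have ?P2
    proof -
      have "\<exists>C\<ge>0. \<forall>N\<in>{2::real..}. finite (\<Union>k\<in>Ks. \<Union>a\<in>admissible r mu k. small_values r k a N) \<and>
        real (card (\<Union>k\<in>Ks. \<Union>a\<in>admissible r mu k. small_values r k a N)) \<le> C * N powr (lam / real d)"
      proof (rule card_union_bound[where ?K0.0 = K0 and L = lam' and D = "9 * real r" and e' = "lam' / real d"
            and \<delta> = \<delta> and \<sigma> = \<sigma>])
        fix k a assume k: "k \<in> Ks" "a \<in> admissible r mu k"
        then show "\<exists>C\<ge>0. \<forall>N\<in>{2..}. finite (small_values r k a N) \<and>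
            real (card (small_values r k a N)) \<le> C * N powr (lam / real d)"
          using d3 lam r1 admissible_degree_large[OF lam mu8 _ k(2)]
          by (intro card_small_degree) (auto simp: Ks_def admissible_def)
      next
        fix k a and N :: real assume k: "k \<in> Ks" "K0 \<le> k" "a \<in> admissible r mu k" "N \<in> {2..}"
        then have a': "a ! 0 \<noteq> 0" "a ! r \<noteq> 0" by (auto simp: admissible_def)
        show "finite (small_values r k a N) \<and> (small_values r k a N \<noteq> {} \<longrightarrow> real k \<le> lam' * ln N) \<and>
           real (card (small_values r k a N)) \<le> 9 * real r * real k * N powr (lam' / real d)"
          using card_large_degree(2)[OF r1 _ a' lower[OF k(3) K0(2)[OF k(2,3)]] lam'(1), of d N] k d3
          by (auto simp: Ks_def)
      qed (use fin K0 \<sigma> \<delta> lam' e2 in auto)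
      then obtain C where C: "C \<ge> 0" "\<And>N. N \<ge> 2 \<Longrightarrow> finite (\<Union>k\<in>Ks. \<Union>a\<in>admissible r mu k. small_values r k a N)"
        "\<And>N. N \<ge> 2 \<Longrightarrow> real (card (\<Union>k\<in>Ks. \<Union>a\<in>admissible r mu k. small_values r k a N)) \<le> C * N powr (lam / real d)"
        by auto
      show ?thesis
      proof (intro exI[of _ "C + 1"] allI impI)
        fix E d0 and N :: real
        assume E: "fewnomial_data r E \<and> d0 \<ge> 3 \<and> Astar_bound r E mu d0 \<and> d \<ge> d0" and N: "N \<ge> 2"
        let ?U = "\<Union>k\<in>Ks. \<Union>a\<in>admissible r mu k. small_values r k a N"
        \<comment> \<open>The value 0 may be represented, by zeros of a form; it accounts for the 1
          in \<open>C + 1\<close>.\<close>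
        have "R_ge r E d N \<subseteq> insert 0 ?U"
        proof
          fix m assume m: "m \<in> R_ge r E d N"
          then obtain p where p: "p \<in> G_ge r E d m" by (auto simp: R_ge_def)
          have "\<exists>k\<in>Ks. \<exists>a\<in>admissible r mu k. p \<in> solutions r k a m" by (rule sub[OF _ _ _ p]) (use E in auto)
          then obtain k a where k: "k \<in> Ks" "a \<in> admissible r mu k" "p \<in> solutions r k a m" by blast
          have "m = 0 \<or> m \<in> small_values r k a N"
            using k(3) m by (auto simp: solutions_def small_values_def R_ge_def abs_le_iff)
          then show "m \<in> insert 0 ?U" using k by blast
        qed
        then have "card (R_ge r E d N) \<le> card (insert 0 ?U)" using C(2)[OF N] by (intro card_mono) auto
        also have "\<dots> \<le> card ?U + 1" using C(2)[OF N] by (simp add: card_insert_if)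
        finally have "real (card (R_ge r E d N)) \<le> real (card ?U) + 1" by linarith
        also have "\<dots> \<le> C * N powr (lam / real d) + 1 * N powr (lam / real d)"
          using C(3)[OF N] N lam by (intro add_mono) (auto simp: ge_one_powr_ge_zero)
        finally show "real (card (R_ge r E d N)) \<le> (C + 1) * N powr (lam / real d)" by (simp add: distrib_right)
      qed
    qed
    ultimately show ?thesis by blast
  qed
  show ?thesis
    using finite_part count_part by blast
qed

end
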